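(* Let $S$ be a Damek--Ricci space whose dimension $n=m+k+1$ is odd, and let $Q=\frac m2+k$. Let $x_0\in S$, $R>0$, let $f,g\in C^\infty(S)$ be supported in the ball $B(x_0,R)$, and let $u\in C^\infty(S\times\mathbb{R})$ be the solution to $$\partial_t^2u(x,t)=\Bigl(\Delta_x+\tfrac{Q^2}4\Bigr)u(x,t),\qquad u(x,0)=f(x),\quad\partial_t|_{t=0}\,u(x,t)=g(x).$$ Then $$\operatorname{supp}u\subset\{(x,t)\in S\times\mathbb{R}\;:\;|t|-R\le d(x,x_0)\le|t|+R\}.$$
   Context: Damek--Ricci space: let $m\ge0$ be an even integer and $k\ge1$ an integer, and let $[\cdot,\cdot]:\mathbb{R}^m\times\mathbb{R}^m\to\mathbb{R}^k$ be a skew-symmetric bilinear map of Heisenberg type, i.e. for every $Y\in\mathbb{R}^k$ the endomorphism $J_Y$ of $\mathbb{R}^m$ defined by $\langle J_YX,X'\rangle=\langle Y,[X,X']\rangle$ satisfies $J_Y^2=-|Y|^2\,\mathrm{Id}$ (the degenerate case $m=0$ gives real hyperbolic space). $S=\mathbb{R}^m\times\mathbb{R}^k\times\mathbb{R}$ is the Lie group with multiplication $$(X,Y,z)\cdot(X',Y',z')=\bigl(X+e^{z/2}X',\;Y+e^{z}Y'+\tfrac12e^{z/2}[X,X'],\;z+z'\bigr),$$ identity $e=(0,0,0)$, equipped with the left-invariant Riemannian metric which at $e$ is the standard Euclidean inner product $\langle X,X'\rangle+\langle Y,Y'\rangle+zz'$. Notation: $d$ is the Riemannian distance, $B(x_0,R)$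 the closed geodesic ball, $\Delta\le0$ the Laplace--Beltrami operator. *)

theory Defs
  imports "HOL-Analysis.Analysis"
begin

definition supp :: "('a::topological_space \<Rightarrow> 'b::zero) \<Rightarrow> 'a set" where
  "supp f = closure {x. f x \<noteq> 0}"

primrec C_k :: "nat \<Rightarrow> ('a::real_normed_vector \<Rightarrow> 'b::real_normed_vector) \<Rightarrow> bool" where
  "C_k 0 f \<longleftrightarrow> continuous_on UNIV f"
| "C_k (Suc j) f \<longleftrightarrow> (\<forall>x. f differentiable (at x)) \<and>
     (\<forall>v. C_k j (\<lambda>x. frechet_derivative f (at x) v))"

definition smooth :: "('a::real_normed_vector \<Rightarrow> 'b::real_normed_vector) \<Rightarrow> bool" where
  "smooth f \<longleftrightarrow> (\<forall>j. C_k j f)"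


section \<open>Riemannian metrics on the manifold \<open>real ^ 'n\<close>\<close>

type_synonym 'n metric = "real ^ 'n \<Rightarrow> real ^ 'n \<Rightarrow> real ^ 'n \<Rightarrow> real"

text \<open>
  Infimum of the lengths of piecewise \<open>C\<^sup>1\<close> curves. The library's \<^const>\<open>valid_path\<close> only asks for
  continuity at the finitely many exceptional points, so the speed need not be integrable; such
  curves (of infinite length) are excluded by \<open>has_integral\<close>.
\<close>

definition riem_dist :: "('n::finite) metric \<Rightarrow> real ^ 'n \<Rightarrow> real ^ 'n \<Rightarrow> real" where
  "riem_dist g p q = Inf {L. \<exists>\<gamma>. valid_path \<gamma> \<and> pathstart \<gamma> = p \<and> pathfinish \<gamma> = q \<and>
     ((\<lambda>t. sqrt (g (\<gamma> t) (vector_derivative \<gamma> (at t)) (vector_derivative \<gamma> (at t))))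
        has_integral L) {0..1}}"

definition riem_cball :: "('n::finite) metric \<Rightarrow> real ^ 'n \<Rightarrow> real \<Rightarrow> (real ^ 'n) set" where
  "riem_cball g p r = {q. riem_dist g q p \<le> r}"

definition metric_matrix :: "('n::finite) metric \<Rightarrow> real ^ 'n \<Rightarrow> real ^ 'n ^ 'n" where
  "metric_matrix g p = (\<chi> i j. g p (axis i 1) (axis j 1))"

definition partial_deriv :: "'n::finite \<Rightarrow> (real ^ 'n \<Rightarrow> 'b::real_normed_vector) \<Rightarrow> real ^ 'n \<Rightarrow> 'b" where
  "partial_deriv i f p = frechet_derivative f (at p) (axis i 1)"

text \<open>\<open>\<Delta> f = |g|\<^sup>-\<^sup>1\<^sup>/\<^sup>2 \<Sum>i. \<partial_deriv>\<^sub>i (|g|\<^sup>1\<^sup>/\<^sup>2 \<Sum>j. g\<^sup>i\<^sup>j \<partial_deriv>\<^sub>j f)\<close> (the sign for which \<open>\<Delta> \<le> 0\<close>)\<close>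

definition laplace_beltrami ::
    "('n::finite) metric \<Rightarrow> (real ^ 'n \<Rightarrow> 'b::real_normed_vector) \<Rightarrow> real ^ 'n \<Rightarrow> 'b" where
  "laplace_beltrami g f p = (1 / sqrt (det (metric_matrix g p))) *\<^sub>R
     (\<Sum>i\<in>UNIV. partial_deriv i (\<lambda>q. sqrt (det (metric_matrix g q)) *\<^sub>R
        (\<Sum>j\<in>UNIV. (matrix_inv (metric_matrix g q) $ i $ j) *\<^sub>R partial_deriv j f q)) p)"


section \<open>Damek--Ricci spaces\<close>

text \<open>
  The group \<open>S = \<real>\<^sup>m \<times> \<real>\<^sup>k \<times> \<real>\<close> is modelled on \<open>real ^ 'n\<close>, the index type being partitioned into
  sets \<open>A\<close>, \<open>B\<close> with \<open>m\<close> and \<open>k\<close> elements and a singleton \<open>{c}\<close>; thus \<open>\<real>\<^sup>m\<close> and \<open>\<real>\<^sup>k\<close> are the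
  coordinate subspaces belonging to \<open>A\<close> and \<open>B\<close>. Unlike a product of types \<open>real ^ 'm \<times> _\<close>, this
  includes \<open>m = 0\<close>.
\<close>

definition coord_space :: "'n::finite set \<Rightarrow> (real ^ 'n) set" where
  "coord_space I = {x. \<forall>i. i \<notin> I \<longrightarrow> x $ i = 0}"

definition proj_on :: "'n::finite set \<Rightarrow> real ^ 'n \<Rightarrow> real ^ 'n" where
  "proj_on I p = (\<chi> i. if i \<in> I then p $ i else 0)"

lemma proj_on_in_coord_space [simp]: "proj_on I p \<in> coord_space I"
  by (simp add: proj_on_def coord_space_def)

lemma proj_on_of_coord_space [simp]: "x \<in> coord_space I \<Longrightarrow> proj_on I x = x"
  by (auto simp: proj_on_def coord_space_def vec_eq_iff)

definition J_map ::
    "'n::finite set \<Rightarrow> (real ^ 'n \<Rightarrow> real ^ 'n \<Rightarrow> real ^ 'n) \<Rightarrow> real ^ 'n \<Rightarrow> real ^ 'n \<Rightarrow> real ^ 'n" where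
  "J_map A br Y X =
     (THE W. W \<in> coord_space A \<and> (\<forall>X'\<in>coord_space A. W \<bullet> X' = Y \<bullet> br X X'))"

text \<open>
  Only the values of \<open>br\<close> on \<open>coord_space A\<close> matter, here and below; bilinearity is stated for the
  restriction of \<open>br\<close> to that subspace.
\<close>

definition heisenberg_type ::
    "'n::finite set \<Rightarrow> 'n set \<Rightarrow> (real ^ 'n \<Rightarrow> real ^ 'n \<Rightarrow> real ^ 'n) \<Rightarrow> bool" where
  "heisenberg_type A B br \<longleftrightarrow>
     bilinear (\<lambda>X X'. br (proj_on A X) (proj_on A X')) \<and>
     (\<forall>X\<in>coord_space A. \<forall>X'\<in>coord_space A. br X X' \<in> coord_space B \<and> br X X' = - br X' X) \<and>
     (\<forall>Y\<in>coord_space B. \<forall>X\<in>coord_space A. J_map A br Y (J_map A br Y X) = - (norm Y)\<^sup>2 *\<^sub>R X)"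

definition damek_ricci ::
    "nat \<Rightarrow> nat \<Rightarrow> 'n::finite set \<Rightarrow> 'n set \<Rightarrow> 'n \<Rightarrow> (real ^ 'n \<Rightarrow> real ^ 'n \<Rightarrow> real ^ 'n) \<Rightarrow> bool" where
  "damek_ricci m k A B c br \<longleftrightarrow>
     A \<union> B \<union> {c} = UNIV \<and> A \<inter> B = {} \<and> c \<notin> A \<and> c \<notin> B \<and>
     card A = m \<and> card B = k \<and> even m \<and> k \<ge> 1 \<and> heisenberg_type A B br"

definition dr_mult ::
    "'n::finite set \<Rightarrow> 'n set \<Rightarrow> 'n \<Rightarrow> (real ^ 'n \<Rightarrow> real ^ 'n \<Rightarrow> real ^ 'n) \<Rightarrow>
     real ^ 'n \<Rightarrow> real ^ 'n \<Rightarrow> real ^ 'n" where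
  "dr_mult A B c br p p' =
     (let X = proj_on A p; Y = proj_on B p; z = p $ c; X' = proj_on A p'; Y' = proj_on B p'; z' = p' $ c in
        (X + exp (z / 2) *\<^sub>R X')
        + (Y + exp z *\<^sub>R Y' + (1/2 * exp (z / 2)) *\<^sub>R br X X')
        + axis c (z + z'))"

definition dr_inv :: "'n::finite set \<Rightarrow> 'n set \<Rightarrow> 'n \<Rightarrow> real ^ 'n \<Rightarrow> real ^ 'n" where
  "dr_inv A B c p =
     - exp (- (p $ c) / 2) *\<^sub>R proj_on A p - exp (- (p $ c)) *\<^sub>R proj_on B p - axis c (p $ c)"

text \<open>The left-invariant metric: translate tangent vectors at \<open>p\<close> to the identity \<open>0\<close>.\<close>

definition dr_metric ::
    "'n::finite set \<Rightarrow> 'n set \<Rightarrow> 'n \<Rightarrow> (real ^ 'n \<Rightarrow> real ^ 'n \<Rightarrow> real ^ 'n) \<Rightarrow> 'n metric" where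
  "dr_metric A B c br p v w =
     (let D = frechet_derivative (dr_mult A B c br (dr_inv A B c p)) (at p) in D v \<bullet> D w)"

lemma J_map:
  assumes "heisenberg_type A B br" "X \<in> coord_space A"
  shows "J_map A br Y X \<in> coord_space A"
    and "X' \<in> coord_space A \<Longrightarrow> J_map A br Y X \<bullet> X' = Y \<bullet> br X X'"
proof -
  let ?P = "\<lambda>W. W \<in> coord_space A \<and> (\<forall>X'\<in>coord_space A. W \<bullet> X' = Y \<bullet> br X X')"
  define h where "h V = Y \<bullet> br X (proj_on A V)" for V
  have "bilinear (\<lambda>X X'. br (proj_on A X) (proj_on A X'))"
    using assms(1) unfolding heisenberg_type_def by blast
  then have "linear (\<lambda>V. br (proj_on A X) (proj_on A V))"
    unfolding bilinear_def by blast
  then have "linear (\<lambda>V. br X (proj_on A V))"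
    using assms(2) by simp
  then have h: "linear h"
    unfolding h_def by (simp add: linear_iff inner_add_right)
  have eq: "proj_on A (adjoint h 1) \<bullet> X' = Y \<bullet> br X X'" if X': "X' \<in> coord_space A" for X'
  proof -
    have "proj_on A (adjoint h 1) \<bullet> X' = adjoint h 1 \<bullet> X'"
      unfolding inner_vec_def using X' by (intro sum.cong) (auto simp: proj_on_def coord_space_def)
    also have "\<dots> = h X'"
      using adjoint_clauses(2)[OF h, of 1 X'] by simp
    finally show ?thesis
      using X' by (simp add: h_def)
  qed
  have P: "?P (proj_on A (adjoint h 1))"
    using eq proj_on_in_coord_space by blast
  have uniq: "V = W" if V: "?P V" and W: "?P W" for V W
  proof -
    have D: "V - W \<in> coord_space A"
      using V W by (simp add: coord_space_def)
    have "V \<bullet> (V - W) = W \<bullet> (V - W)"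
      using V W D by metis
    then have "(V - W) \<bullet> (V - W) = 0"
      by (simp add: inner_diff_left)
    then show ?thesis
      by simp
  qed
  have "?P (J_map A br Y X)"
    unfolding J_map_def by (rule theI[of ?P, OF P]) (rule uniq[OF _ P])
  then show "J_map A br Y X \<in> coord_space A"
    and "X' \<in> coord_space A \<Longrightarrow> J_map A br Y X \<bullet> X' = Y \<bullet> br X X'"
    by blast+
qed

lemma dr_mult_inv:
  assumes "damek_ricci m k A B c br"
  shows "dr_mult A B c br p (dr_inv A B c p) = 0"
    and "dr_mult A B c br (dr_inv A B c p) p = 0"
proof -
  have AB: "A \<inter> B = {}" and c: "c \<notin> A" "c \<notin> B" and H: "heisenberg_type A B br"
    using assms unfolding damek_ricci_def by blast+
  let ?X = "proj_on A p"
  let ?e = "- exp (- (p $ c) / 2)"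
  have pA: "proj_on A (dr_inv A B c p) = ?e *\<^sub>R ?X"
    using AB c by (auto simp: dr_inv_def proj_on_def vec_eq_iff axis_def)
  have pB: "proj_on B (dr_inv A B c p) = - exp (- (p $ c)) *\<^sub>R proj_on B p"
    using AB c by (auto simp: dr_inv_def proj_on_def vec_eq_iff axis_def)
  have pc: "dr_inv A B c p $ c = - (p $ c)"
    using c by (simp add: dr_inv_def proj_on_def axis_def)
  have b: "bilinear (\<lambda>X X'. br (proj_on A X) (proj_on A X'))"
    using H unfolding heisenberg_type_def by blast
  have "br ?X ?X = - br ?X ?X"
    using H proj_on_in_coord_space[of A p] unfolding heisenberg_type_def by blast
  then have z: "br ?X ?X = 0"
    unfolding vec_eq_iff by simp
  have s: "proj_on A (r *\<^sub>R ?X) = r *\<^sub>R ?X" for r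
    by (simp add: proj_on_def vec_eq_iff)
  have pp: "proj_on A ?X = ?X"
    by simp
  have 1: "br ?X (?e *\<^sub>R ?X) = 0"
    using bilinear_rmul[OF b, of ?X ?e ?X] unfolding s pp z by simp
  have 2: "br (?e *\<^sub>R ?X) ?X = 0"
    using bilinear_lmul[OF b, of ?e ?X ?X] unfolding s pp z by simp
  show "dr_mult A B c br p (dr_inv A B c p) = 0"
    unfolding dr_mult_def Let_def pA pB pc 1
    by (simp add: vec_eq_iff axis_def flip: exp_add)
  show "dr_mult A B c br (dr_inv A B c p) p = 0"
    unfolding dr_mult_def Let_def pA pB pc 2
    by (simp add: vec_eq_iff axis_def)
qed

end

(*
  Huygens' principle by duality. Fix (x, t) and let r be the distance to x. In odd dimension m and k
  are even, and the radial part of Delta + Q^2/4 is intertwined with d^2/dr^2 by the differential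
  operator (d/d cosh^2(r/2))^(k/2) (d/d cosh(r/2))^(m/2). Applying it to h(s + r) + h(s - r), where h
  is odd and h' is a bump of width eps, gives a smooth radial solution w of the wave equation that at
  time s lives in the shell | |s| - r | <= eps, has w = 0 at s = 0, and whose time derivative at s = 0
  is nonnegative and positive at x. By Green's identity the pairing
  int (u(., s) w_s(., s - t) - u_s(., s) w(., s - t)) dvol does not depend on s. If f and g vanish
  where | |t| - r | <= eps, it is 0 at s = 0, hence at s = t, where it averages u(., t) near x. So
  u(x, t) = 0 unless the support of f or g meets the sphere of radius |t| about x, and the triangle
  inequality gives both inclusions.

  The point r = 0 is harmless because cosh^2(r/2) has an explicit formula that is smooth on S. That r
  is the Riemannian distance follows from |grad r| = 1 and from the explicit geodesics.
*)
theory Submission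
  imports Defs
begin

text \<open>The obstacle is positivity: the velocity of the kernel at time 0 must have a sign
  although, with m = 2 a and k = 2 b, it arises from the bump by a + b differentiations. Hence the
  bump is a truncated power of cosh(\<epsilon>/2) - cosh(x/2). In the variable \<xi> = cosh(r/2) its
  successive derivatives alternate in sign, and a minus sign built into every step compensates. The
  price is finite regularity, so orders of differentiability are counted throughout.

  The primitive h is odd, which makes the kernel vanish at time 0, but past \<epsilon> it is a
  nonzero constant. So h(s + r) + h(s - r) is constant, not zero, inside the light cone. A
  differentiation removes the constant, and k \<ge> 1 guarantees that there is one.

  The order of the steps matters: d/d\<xi> intertwines the radial operators only as long as \<beta>
  = 1/2, so all steps for m precede those for k.

  Even functions of r are carried as functions of q = r^2 on a closed half-line, with one-sided
  derivatives at q = 0; the passage to \<rho> is made at the end.\<close>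

section \<open>Averages of even functions\<close>

text \<open>Derivatives are taken within \<open>X\<close> because the half-lines used below have an
  endpoint. The derivative is existentially quantified since \<open>deriv\<close> does not see
  one-sided derivatives.\<close>

primrec Ck_on :: "nat \<Rightarrow> real set \<Rightarrow> (real \<Rightarrow> real) \<Rightarrow> bool" where
  "Ck_on 0 X f \<longleftrightarrow> continuous_on X f"
| "Ck_on (Suc n) X f \<longleftrightarrow>
     (\<exists>f'. (\<forall>x\<in>X. (f has_real_derivative f' x) (at x within X)) \<and> Ck_on n X f')"

lemma Ck_on_continuous: "Ck_on n X f \<Longrightarrow> continuous_on X f"
  by (cases n) (auto simp: continuous_on_eq_continuous_within intro: DERIV_continuous)

lemma Ck_on_SucI:
  "(\<And>x. x \<in> X \<Longrightarrow> (f has_real_derivative f' x) (at x within X)) \<Longrightarrow> Ck_on n X f' \<Longrightarrow> Ck_on (Suc n) X f"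
  by auto

lemma Ck_on_SucD: "Ck_on (Suc n) X f \<Longrightarrow> Ck_on n X f"
proof (induction n arbitrary: f)
  case 0
  then show ?case using Ck_on_continuous[OF 0] by simp
next
  case (Suc n)
  then obtain f' where "\<forall>x\<in>X. (f has_real_derivative f' x) (at x within X)" "Ck_on (Suc n) X f'"
    by auto
  with Suc.IH[of f'] show ?case by auto
qed

lemma Ck_on_mono: "Ck_on n X f \<Longrightarrow> m \<le> n \<Longrightarrow> Ck_on m X f"
  by (induction n) (auto simp: le_Suc_eq simp del: Ck_on.simps intro: Ck_on_SucD)

lemma Ck_on_const: "Ck_on n X (\<lambda>x. a)"
  by (induction n arbitrary: a) (auto intro!: exI[of _ "\<lambda>x. 0"])

lemma Ck_on_add: "Ck_on n X f \<Longrightarrow> Ck_on n X g \<Longrightarrow> Ck_on n X (\<lambda>x. f x + g x)"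
proof (induction n arbitrary: f g)
  case 0
  then show ?case by (auto intro: continuous_intros)
next
  case (Suc n)
  then obtain f' g' where "\<forall>x\<in>X. (f has_real_derivative f' x) (at x within X)" "Ck_on n X f'"
    "\<forall>x\<in>X. (g has_real_derivative g' x) (at x within X)" "Ck_on n X g'" by auto
  with Suc.IH show ?case
    by (intro Ck_on_SucI[where f' = "\<lambda>x. f' x + g' x"] DERIV_add) auto
qed

lemma Ck_on_mult: "Ck_on n X f \<Longrightarrow> Ck_on n X g \<Longrightarrow> Ck_on n X (\<lambda>x. f x * g x)"
proof (induction n arbitrary: f g)
  case 0
  then show ?case by (auto intro: continuous_intros)
next
  case (Suc n)
  then obtain f' g' where *: "\<forall>x\<in>X. (f has_real_derivative f' x) (at x within X)" "Ck_on n X f'"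
    "\<forall>x\<in>X. (g has_real_derivative g' x) (at x within X)" "Ck_on n X g'" by auto
  with Suc.IH Suc.prems[THEN Ck_on_SucD] show ?case
    by (intro Ck_on_SucI[where f' = "\<lambda>x. f' x * g x + g' x * f x"] DERIV_mult Ck_on_add) auto
qed

lemma Ck_on_inverse:
  assumes "\<And>x. x \<in> X \<Longrightarrow> f x \<noteq> 0"
  shows "Ck_on n X f \<Longrightarrow> Ck_on n X (\<lambda>x. inverse (f x))"
proof (induction n)
  case 0
  then show ?case using assms by (auto intro: continuous_intros)
next
  case (Suc n)
  then obtain f' where *: "\<forall>x\<in>X. (f has_real_derivative f' x) (at x within X)" "Ck_on n X f'" by auto
  have "Ck_on n X (\<lambda>x. inverse (f x))" using Suc by (auto dest: Ck_on_SucD simp del: Ck_on.simps)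
  then show ?case using assms *
    by (intro Ck_on_SucI[where f' = "\<lambda>x. (-1) * (inverse (f x) * f' x * inverse (f x))"] Ck_on_mult Ck_on_const)
      (auto intro!: derivative_eq_intros)
qed

lemma Ck_on_UNIV_deriv:
  assumes "Ck_on (Suc n) UNIV h"
  shows "(h has_real_derivative deriv h x) (at x)" and "Ck_on n UNIV (deriv h)"
proof -
  obtain h' where *: "\<And>x. (h has_real_derivative h' x) (at x)" "Ck_on n UNIV h'" using assms by auto
  then have "deriv h = h'" by (auto intro!: DERIV_imp_deriv)
  with * show "(h has_real_derivative deriv h x) (at x)" "Ck_on n UNIV (deriv h)" by auto
qed

lemma Ck_on_UNIV_funpow: "Ck_on (n + j) UNIV h \<Longrightarrow> Ck_on n UNIV ((deriv ^^ j) h)"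
proof (induction j arbitrary: n)
  case (Suc j)
  from Suc.IH[of "Suc n"] Suc.prems have "Ck_on (Suc n) UNIV ((deriv ^^ j) h)" by simp
  then show ?case using Ck_on_UNIV_deriv(2) by simp
qed simp

lemma funpow_deriv_has_deriv:
  assumes "Ck_on N UNIV h" "j < N"
  shows "((deriv ^^ j) h has_real_derivative (deriv ^^ Suc j) h x) (at x)"
proof -
  have "Ck_on (Suc 0) UNIV ((deriv ^^ j) h)"
    using Ck_on_mono[OF assms(1), of "Suc 0 + j"] assms(2) by (intro Ck_on_UNIV_funpow) simp
  then show ?thesis using Ck_on_UNIV_deriv(1) by fastforce
qed

lemma funpow_deriv_continuous:
  assumes "Ck_on N UNIV h" "j \<le> N"
  shows "continuous_on X ((deriv ^^ j) h)"
proof -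
  have "Ck_on 0 UNIV ((deriv ^^ j) h)"
    using Ck_on_mono[OF assms(1), of "0 + j"] assms(2) by (intro Ck_on_UNIV_funpow) simp
  then show ?thesis using continuous_on_subset by auto
qed

text \<open>The fundamental theorem gives \<open>F y = F a + integral {a..y} f\<close>, and the
  integral of a continuous function is differentiable at the endpoint too. This removes the
  singularities of \<open>sqrt\<close> at 0 and of \<open>arcosh\<close> at 1.\<close>

lemma DERIV_closed_right:
  fixes F f :: "real \<Rightarrow> real"
  assumes F: "continuous_on {a..} F" and f: "continuous_on {a..} f"
    and d: "\<And>x. x > a \<Longrightarrow> (F has_real_derivative f x) (at x)" and "x \<ge> a"
  shows "(F has_real_derivative f x) (at x within {a..})"
proof -
  have I: "(f has_integral F y - F a) {a..y}" if "y \<ge> a" for y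
    using that d by (intro fundamental_theorem_of_calculus_interior continuous_on_subset[OF F])
      (auto simp: has_real_derivative_iff_has_vector_derivative)
  have eq: "F y = F a + integral {a..y} f" if "y \<ge> a" for y
    using integral_unique[OF I[OF that]] by simp
  have "((\<lambda>y. integral {a..y} f) has_real_derivative f x) (at x within {a..x + 1})"
    using \<open>x \<ge> a\<close> by (intro integral_has_real_derivative continuous_on_subset[OF f]) auto
  then have "((\<lambda>y. F a + integral {a..y} f) has_real_derivative f x) (at x within {a..x + 1})"
    by (auto intro!: derivative_eq_intros)
  then have "(F has_real_derivative f x) (at x within {a..x + 1})"
  proof (rule has_field_derivative_transform_within[where d = 1])
    fix y assume "y \<in> {a..x + 1}"
    then show "F a + integral {a..y} f = F y" using eq[of y] by auto
  qed (use \<open>x \<ge> a\<close> in auto)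
  moreover have "at x within {a..x + 1} = at x within {a..}"
    by (rule at_within_nhd[of x "{x - 1<..<x + 1}"]) auto
  ultimately show ?thesis by simp
qed

lemma DERIV_within_unique:
  fixes F :: "real \<Rightarrow> real"
  assumes "(F has_real_derivative a) (at x within {c..})" "(F has_real_derivative b) (at x within {c..})"
    and "x \<ge> c"
  shows "a = b"
proof -
  have "(F has_real_derivative a) (at x within {x..})" "(F has_real_derivative b) (at x within {x..})"
    using assms by (auto intro: has_field_derivative_subset)
  moreover have "at x within {x..} \<noteq> bot"
    by (metis at_within_Icc_at_right at_within_Ici_at_right trivial_limit_at_right_real)
  ultimately show ?thesis
    using has_field_derivative_unique by blast
qed

text \<open>
  As functions of \<open>q = r\<^sup>2\<close>, the averages \<open>even_avg j h\<close> are, up to constants, the derivatives of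
  \<open>h (s + r) + h (s - r)\<close>. The integral representation shows that they extend continuously to \<open>r = 0\<close>.
\<close>

fun even_avg :: "nat \<Rightarrow> (real \<Rightarrow> real) \<Rightarrow> real \<Rightarrow> real \<Rightarrow> real" where
  "even_avg 0 h q s = h (s + sqrt q) + h (s - sqrt q)"
| "even_avg (Suc j) h q s =
     integral {-1..1} (\<lambda>\<sigma>. (deriv ^^ (2 * j + 2)) h (s + \<sigma> * sqrt q) * (1 - \<sigma>\<^sup>2) ^ j)"

context
  fixes N :: nat and h :: "real \<Rightarrow> real"
  assumes h: "Ck_on N UNIV h"
begin

private definition G :: "nat \<Rightarrow> real \<Rightarrow> real" where "G i = (deriv ^^ i) h"

private lemma G_deriv:
  assumes "i < N" "(f has_real_derivative f') (at x within X)"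
  shows "((\<lambda>x. G i (f x)) has_real_derivative G (Suc i) (f x) * f') (at x within X)"
  unfolding G_def by (rule DERIV_chain2[OF funpow_deriv_has_deriv[OF h assms(1)] assms(2)])

private lemma G_cont:
  assumes "i \<le> N" "continuous_on X f"
  shows "continuous_on X (\<lambda>x. G i (f x))"
  unfolding G_def by (rule continuous_on_compose2[OF funpow_deriv_continuous[OF h assms(1)] assms(2)]) auto

private lemma even_avg_G:
  "even_avg 0 h q s = G 0 (s + sqrt q) + G 0 (s - sqrt q)"
  "even_avg (Suc j) h q s = integral (cbox (-1) 1) (\<lambda>\<sigma>. G (2 * j + 2) (s + \<sigma> * sqrt q) * (1 - \<sigma>\<^sup>2) ^ j)"
  "even_avg 0 (deriv h) q s = G 1 (s + sqrt q) + G 1 (s - sqrt q)"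
  "even_avg (Suc j) (deriv h) q s = integral (cbox (-1) 1) (\<lambda>\<sigma>. G (Suc (2 * j + 2)) (s + \<sigma> * sqrt q) * (1 - \<sigma>\<^sup>2) ^ j)"
proof -
  have "(deriv ^^ i) (deriv h) = G (Suc i)" for i
    unfolding G_def by (simp only: funpow_swap1 funpow.simps o_def)
  from this[of 0] this show
    "even_avg 0 h q s = G 0 (s + sqrt q) + G 0 (s - sqrt q)"
  "even_avg (Suc j) h q s = integral (cbox (-1) 1) (\<lambda>\<sigma>. G (2 * j + 2) (s + \<sigma> * sqrt q) * (1 - \<sigma>\<^sup>2) ^ j)"
  "even_avg 0 (deriv h) q s = G 1 (s + sqrt q) + G 1 (s - sqrt q)"
  "even_avg (Suc j) (deriv h) q s = integral (cbox (-1) 1) (\<lambda>\<sigma>. G (Suc (2 * j + 2)) (s + \<sigma> * sqrt q) * (1 - \<sigma>\<^sup>2) ^ j)"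
    by (simp_all add: G_def[symmetric] del: funpow.simps) (simp_all add: G_def)
qed

lemma continuous_on_even_avg:
  assumes "2 * j \<le> N"
  shows "continuous_on ({0..} \<times> UNIV) (\<lambda>(q, s). even_avg j h q s)"
proof (cases j)
  case 0
  show ?thesis unfolding 0 split_beta even_avg_G by (intro continuous_intros G_cont) auto
next
  case (Suc i)
  define n where "n = 2 * i + 2"
  have "n \<le> N" using assms Suc by (simp add: n_def)
  then show ?thesis unfolding split_beta Suc even_avg_G n_def[symmetric]
    by (intro integral_continuous_on_param) (auto intro!: continuous_intros G_cont simp: split_beta)
qed

lemma even_avg_deriv_s:
  assumes "2 * j < N"
  shows "((\<lambda>s. even_avg j h q s) has_real_derivative even_avg j (deriv h) q s) (at s)"
proof (cases j)
  case 0
  have "((\<lambda>s. G 0 (s + a)) has_real_derivative G (Suc 0) (s + a) * 1) (at s)" for a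
    using assms by (intro G_deriv) (auto intro!: derivative_eq_intros)
  from DERIV_add[OF this[of "sqrt q"] this[of "- sqrt q"]] show ?thesis
    by (simp add: 0 even_avg_G del: even_avg.simps)
next
  case (Suc i)
  define n where "n = 2 * i + 2"
  have "n < N" using assms Suc by (simp add: n_def)
  then show ?thesis unfolding Suc even_avg_G n_def[symmetric]
    by (intro leibniz_rule_field_derivative)
      (auto intro!: derivative_eq_intros continuous_intros G_deriv[THEN DERIV_cong] G_cont
          integrable_continuous_interval simp: split_beta)
qed

text \<open>The integrand times \<open>sqrt q\<close> is the \<sigma>-derivative of
  \<open>deriv h (s + \<sigma> * sqrt q)\<close>.\<close>

lemma even_avg_1_mult_sqrt:
  assumes "2 \<le> N"
  shows "even_avg 1 h q s * sqrt q = deriv h (s + sqrt q) - deriv h (s - sqrt q)"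
proof -
  define r where "r = sqrt q"
  have "((\<lambda>\<sigma>. G (Suc (Suc 0)) (s + \<sigma> * r) * r) has_integral G (Suc 0) (s + 1 * r) - G (Suc 0) (s + (-1) * r)) {-1..1}"
  proof (rule fundamental_theorem_of_calculus)
    fix x :: real
    have "((\<lambda>\<sigma>. G (Suc 0) (s + \<sigma> * r)) has_real_derivative G (Suc (Suc 0)) (s + x * r) * r) (at x within {-1..1})"
      using assms by (intro G_deriv) (auto intro!: derivative_eq_intros)
    then show "((\<lambda>\<sigma>. G (Suc 0) (s + \<sigma> * r)) has_vector_derivative G (Suc (Suc 0)) (s + x * r) * r) (at x within {-1..1})"
      by (simp add: has_real_derivative_iff_has_vector_derivative)
  qed simp
  then have "even_avg (Suc 0) h q s * r = G 1 (s + r) - G 1 (s - r)"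
    unfolding even_avg_G by (simp add: integral_unique r_def numeral_2_eq_2 flip: integral_mult_left)
  then show ?thesis by (simp add: r_def G_def)
qed

text \<open>For \<open>q > 0\<close> the chain rule through r = \<open>sqrt q\<close> produces a
  factor \<sigma> / (2 r). Integration by parts against \<sigma> (1 - \<sigma>^2)^i trades it for
  one more derivative of \<open>h\<close> and a factor r / (2 (i + 1)), so 1 / r cancels; with j = i
  + 1 the constant is 4 j. The point \<open>q = 0\<close> follows from
  \<open>DERIV_closed_right\<close>.\<close>

lemma even_avg_deriv_q:
  assumes "2 * j + 2 \<le> N" "q \<ge> 0"
  shows "((\<lambda>q. even_avg j h q s) has_real_derivative
           even_avg (Suc j) h q s / (if j = 0 then 2 else 4 * j)) (at q within {0..})"
    (is "(_ has_real_derivative ?f q) _")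
proof (rule DERIV_closed_right[OF _ _ _ assms(2)])
  have slice: "continuous_on {0..} (\<lambda>q. even_avg i h q s)" if "2 * i \<le> N" for i
    using continuous_on_compose2[OF continuous_on_even_avg[OF that], of "{0..}" "\<lambda>q. (q, s)"]
    by (force intro!: continuous_intros simp del: even_avg.simps)
  show "continuous_on {0..} (\<lambda>q. even_avg j h q s)" "continuous_on {0..} ?f"
    using assms(1) slice[of j] slice[of "Suc j"] by (auto intro!: continuous_intros simp del: even_avg.simps)
  fix q :: real assume "q > 0"
  define r where "r = sqrt q"
  have r: "r > 0" "r\<^sup>2 = q" using \<open>q > 0\<close> by (auto simp: r_def)
  have sq: "(sqrt has_real_derivative 1 / (2 * r)) (at q)"
    using DERIV_real_sqrt[of q] \<open>q > 0\<close> by (simp add: r_def field_simps)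
  show "((\<lambda>q. even_avg j h q s) has_real_derivative ?f q) (at q)"
  proof (cases j)
    case 0
    have "even_avg (Suc 0) h q s * r = G 1 (s + r) - G 1 (s - r)"
      using even_avg_1_mult_sqrt assms(1) by (simp add: G_def r_def del: even_avg.simps)
    then have eq: "even_avg (Suc 0) h q s = (G 1 (s + r) - G 1 (s - r)) / r" using r by (simp add: field_simps)
    have d: "((\<lambda>q. even_avg 0 h q s) has_real_derivative
       G (Suc 0) (s + sqrt q) * (0 + 1 / (2 * r)) + G (Suc 0) (s - sqrt q) * (0 - 1 / (2 * r))) (at q)"
      unfolding even_avg_G using assms(1) by (intro DERIV_add DERIV_diff G_deriv DERIV_const sq) auto
    moreover have "G (Suc 0) (s + sqrt q) * (0 + 1 / (2 * r)) + G (Suc 0) (s - sqrt q) * (0 - 1 / (2 * r)) = ?f q"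
      using eq r(1) by (simp add: 0 field_simps flip: r_def del: even_avg.simps)
    ultimately show ?thesis by (simp only: 0)
  next
    case (Suc i)
    let ?w = "\<lambda>\<sigma>::real. 1 - \<sigma>\<^sup>2"
    define n where "n = 2 * i + 2"
    have n: "n < N" "Suc n < N" "Suc (Suc n) \<le> N" "2 * Suc i + 2 = Suc (Suc n)"
      using assms(1) Suc by (auto simp: n_def)
    have "((\<lambda>r. integral (cbox (-1) 1) (\<lambda>\<sigma>. G n (s + \<sigma> * r) * ?w \<sigma> ^ i)) has_real_derivative
       integral (cbox (-1) 1) (\<lambda>\<sigma>. G (Suc n) (s + \<sigma> * r) * \<sigma> * ?w \<sigma> ^ i)) (at r within UNIV)"
    proof (rule leibniz_rule_field_derivative)
      fix r \<sigma> :: real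
      have "((\<lambda>r. G n (s + \<sigma> * r)) has_real_derivative G (Suc n) (s + \<sigma> * r) * \<sigma>) (at r within UNIV)"
        using n by (intro G_deriv) (auto intro!: derivative_eq_intros)
      then show "((\<lambda>r. G n (s + \<sigma> * r) * ?w \<sigma> ^ i) has_real_derivative
          G (Suc n) (s + \<sigma> * r) * \<sigma> * ?w \<sigma> ^ i) (at r within UNIV)"
        by (rule DERIV_cmult_right)
      show "(\<lambda>\<sigma>. G n (s + \<sigma> * r) * ?w \<sigma> ^ i) integrable_on cbox (-1) 1"
        using n unfolding box_real by (intro integrable_continuous_interval continuous_intros G_cont) auto
      show "continuous_on (UNIV \<times> cbox (-1) 1) (\<lambda>(r, \<sigma>). G (Suc n) (s + \<sigma> * r) * \<sigma> * ?w \<sigma> ^ i)"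
        using n unfolding split_beta by (intro continuous_intros G_cont) auto
    qed auto
    from DERIV_chain2[OF this[unfolded r_def] sq]
    have "((\<lambda>q. integral (cbox (-1) 1) (\<lambda>\<sigma>. G n (s + \<sigma> * sqrt q) * ?w \<sigma> ^ i)) has_real_derivative
       integral (cbox (-1) 1) (\<lambda>\<sigma>. G (Suc n) (s + \<sigma> * r) * \<sigma> * ?w \<sigma> ^ i) * (1 / (2 * r))) (at q)"
      by (simp only: r_def)
    moreover have "integral (cbox (-1) 1) (\<lambda>\<sigma>. G (Suc n) (s + \<sigma> * r) * \<sigma> * ?w \<sigma> ^ i) * (1 / (2 * r)) = ?f q"
    proof -
      \<comment> \<open>No boundary terms arise, because the weight vanishes at \<sigma> = 1 and
        \<sigma> = -1.\<close>
      let ?\<Phi> = "\<lambda>\<sigma>. - (?w \<sigma> ^ Suc i * G (Suc n) (s + \<sigma> * r)) / (2 * real (Suc i))"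
      have "((\<lambda>\<sigma>. G (Suc n) (s + \<sigma> * r) * \<sigma> * ?w \<sigma> ^ i
          - r / (2 * real (Suc i)) * (G (Suc (Suc n)) (s + \<sigma> * r) * ?w \<sigma> ^ Suc i)) has_integral ?\<Phi> 1 - ?\<Phi> (-1)) {-1..1}"
      proof (intro fundamental_theorem_of_calculus, goal_cases)
        case (2 \<sigma>)
        have w: "((\<lambda>\<sigma>. ?w \<sigma> ^ Suc i) has_real_derivative Suc i * (?w \<sigma> ^ i * (- (2 * \<sigma>)))) (at \<sigma> within {-1..1})"
        proof -
          have "(?w has_real_derivative - (2 * \<sigma>)) (at \<sigma> within {-1..1})"
            by (auto intro!: derivative_eq_intros)
          from DERIV_power_Suc[OF this, of i] show ?thesis
            by (rule DERIV_cong) (simp add: mult_ac)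
        qed
        have g: "((\<lambda>\<sigma>. G (Suc n) (s + \<sigma> * r)) has_real_derivative G (Suc (Suc n)) (s + \<sigma> * r) * r) (at \<sigma> within {-1..1})"
          using n by (intro G_deriv) (auto intro!: derivative_eq_intros)
        have "(?\<Phi> has_real_derivative
           - (real (Suc i) * (?w \<sigma> ^ i * (- (2 * \<sigma>))) * G (Suc n) (s + \<sigma> * r)
              + G (Suc (Suc n)) (s + \<sigma> * r) * r * ?w \<sigma> ^ Suc i) / (2 * real (Suc i))) (at \<sigma> within {-1..1})"
          by (intro DERIV_cdivide DERIV_minus DERIV_mult w g)
        moreover have "- (real (Suc i) * (?w \<sigma> ^ i * (- (2 * \<sigma>))) * G (Suc n) (s + \<sigma> * r)
              + G (Suc (Suc n)) (s + \<sigma> * r) * r * ?w \<sigma> ^ Suc i) / (2 * real (Suc i))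
           = G (Suc n) (s + \<sigma> * r) * \<sigma> * ?w \<sigma> ^ i
          - r / (2 * real (Suc i)) * (G (Suc (Suc n)) (s + \<sigma> * r) * ?w \<sigma> ^ Suc i)"
        proof -
          have *: "- (c * (W * (- (2 * \<sigma>))) * g + g2 * r * w) / (2 * c) = g * \<sigma> * W - r / (2 * c) * (g2 * w)"
            if "c \<noteq> 0" for c W g g2 w :: real using that by (simp add: field_simps)
          show ?thesis by (rule *) simp
        qed
        ultimately show ?case by (simp only: has_real_derivative_iff_has_vector_derivative)
      qed auto
      from integral_unique[OF this]
      have "0 = integral {-1..1} (\<lambda>\<sigma>. G (Suc n) (s + \<sigma> * r) * \<sigma> * ?w \<sigma> ^ i
          - r / (2 * real (Suc i)) * (G (Suc (Suc n)) (s + \<sigma> * r) * ?w \<sigma> ^ Suc i))"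
        by (simp only:) simp
      also have "\<dots> = integral {-1..1} (\<lambda>\<sigma>. G (Suc n) (s + \<sigma> * r) * \<sigma> * ?w \<sigma> ^ i)
          - r / (2 * real (Suc i)) * integral {-1..1} (\<lambda>\<sigma>. G (Suc (Suc n)) (s + \<sigma> * r) * ?w \<sigma> ^ Suc i)"
      proof -
        have "(\<lambda>\<sigma>. G (Suc n) (s + \<sigma> * r) * \<sigma> * ?w \<sigma> ^ i) integrable_on {-1..1}"
          "(\<lambda>\<sigma>. G (Suc (Suc n)) (s + \<sigma> * r) * ?w \<sigma> ^ Suc i) integrable_on {-1..1}"
          using n by (intro integrable_continuous_interval continuous_intros G_cont; simp)+
        then show ?thesis
          by (subst Henstock_Kurzweil_Integration.integral_diff)
            (simp_all only: integral_mult_right integrable_on_mult_right)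
      qed
      finally have I: "integral (cbox (-1) 1) (\<lambda>\<sigma>. G (Suc n) (s + \<sigma> * r) * \<sigma> * ?w \<sigma> ^ i)
          = r / (2 * real (Suc i)) * even_avg (Suc j) h q s"
        unfolding Suc even_avg_G n(4) r_def[symmetric] interval_cbox[symmetric] by linarith
      have *: "r / (2 * c) * E * (1 / (2 * r)) = E / (4 * c)" for c E :: real
        using r(1) by (simp add: field_simps)
      show ?thesis unfolding I * by (simp add: Suc del: even_avg.simps)
    qed
    ultimately show ?thesis
      unfolding Suc even_avg_G(2)[of i] n_def[symmetric] by simp
  qed
qed

text \<open>In the variable q = r^2 the operator d^2/dr^2 is 4 q d^2/dq^2 + 2 d/dq, and the first
  two \<open>q\<close>-derivatives of \<open>even_avg 0\<close> are \<open>even_avg 1 / 2\<close>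
  and \<open>even_avg 2 / 8\<close>. The proof by an integral in \<sigma> covers
  \<open>q = 0\<close> as well.\<close>

lemma even_avg_wave_identity:
  assumes "4 \<le> N" "q \<ge> 0"
  shows "even_avg 1 h q s + q / 2 * even_avg 2 h q s = even_avg 0 (deriv (deriv h)) q s"
proof -
  define r where "r = sqrt q"
  have r2: "r\<^sup>2 = q" using assms by (simp add: r_def)
  \<comment> \<open>Chosen so that the \<open>G 3\<close> terms cancel on differentiation.\<close>
  let ?\<Phi> = "\<lambda>\<sigma>. r * ((1 - \<sigma>\<^sup>2) * G 3 (s + \<sigma> * r)) + 2 * (\<sigma> * G 2 (s + \<sigma> * r))"
  have "((\<lambda>\<sigma>. r\<^sup>2 * (G 4 (s + \<sigma> * r) * (1 - \<sigma>\<^sup>2)) + 2 * G 2 (s + \<sigma> * r)) has_integral ?\<Phi> 1 - ?\<Phi> (-1)) {-1..1}"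
  proof (rule fundamental_theorem_of_calculus)
    fix \<sigma> :: real
    have l: "((\<lambda>\<sigma>. s + \<sigma> * r) has_real_derivative r) (at \<sigma> within {-1..1})"
      by (auto intro!: derivative_eq_intros)
    have 2: "((\<lambda>\<sigma>. G 2 (s + \<sigma> * r)) has_real_derivative G 3 (s + \<sigma> * r) * r) (at \<sigma> within {-1..1})"
      and 3: "((\<lambda>\<sigma>. G 3 (s + \<sigma> * r)) has_real_derivative G 4 (s + \<sigma> * r) * r) (at \<sigma> within {-1..1})"
      using G_deriv[of 2, OF _ l] G_deriv[of 3, OF _ l] assms(1) by (simp_all add: eval_nat_numeral)
    have "((\<lambda>\<sigma>. (1 - \<sigma>\<^sup>2)) has_real_derivative - (2 * \<sigma>)) (at \<sigma> within {-1..1})"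
      by (auto intro!: derivative_eq_intros)
    from DERIV_add[OF DERIV_cmult[OF DERIV_mult[OF this 3], of r] DERIV_cmult[OF DERIV_mult[OF DERIV_ident 2], of 2]]
    have "(?\<Phi> has_real_derivative r\<^sup>2 * (G 4 (s + \<sigma> * r) * (1 - \<sigma>\<^sup>2)) + 2 * G 2 (s + \<sigma> * r)) (at \<sigma> within {-1..1})"
      by (rule DERIV_cong) (simp add: algebra_simps power2_eq_square)
    then show "(?\<Phi> has_vector_derivative r\<^sup>2 * (G 4 (s + \<sigma> * r) * (1 - \<sigma>\<^sup>2)) + 2 * G 2 (s + \<sigma> * r)) (at \<sigma> within {-1..1})"
      by (simp only: has_real_derivative_iff_has_vector_derivative)
  qed simp
  from integral_unique[OF this]
  have "integral {-1..1} (\<lambda>\<sigma>. r\<^sup>2 * (G 4 (s + \<sigma> * r) * (1 - \<sigma>\<^sup>2)) + 2 * G 2 (s + \<sigma> * r))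
      = 2 * (G 2 (s + r) + G 2 (s - r))" by simp
  also have "integral {-1..1} (\<lambda>\<sigma>. r\<^sup>2 * (G 4 (s + \<sigma> * r) * (1 - \<sigma>\<^sup>2)) + 2 * G 2 (s + \<sigma> * r))
      = r\<^sup>2 * integral {-1..1} (\<lambda>\<sigma>. G 4 (s + \<sigma> * r) * (1 - \<sigma>\<^sup>2)) + 2 * integral {-1..1} (\<lambda>\<sigma>. G 2 (s + \<sigma> * r))"
  proof -
    have "(\<lambda>\<sigma>. G 4 (s + \<sigma> * r) * (1 - \<sigma>\<^sup>2)) integrable_on {-1..1}" "(\<lambda>\<sigma>. G 2 (s + \<sigma> * r)) integrable_on {-1..1}"
      using assms(1) by (intro integrable_continuous_interval continuous_intros G_cont; simp)+
    then show ?thesis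
      by (subst Henstock_Kurzweil_Integration.integral_add) (simp_all only: integral_mult_right integrable_on_mult_right)
  qed
  finally have "q * integral {-1..1} (\<lambda>\<sigma>. G 4 (s + \<sigma> * r) * (1 - \<sigma>\<^sup>2)) + 2 * integral {-1..1} (\<lambda>\<sigma>. G 2 (s + \<sigma> * r))
     = 2 * (G 2 (s + r) + G 2 (s - r))" unfolding r2 .
  moreover have "even_avg 2 h q s = integral {-1..1} (\<lambda>\<sigma>. G 4 (s + \<sigma> * r) * (1 - \<sigma>\<^sup>2))"
    "even_avg 1 h q s = integral {-1..1} (\<lambda>\<sigma>. G 2 (s + \<sigma> * r))"
    using even_avg_G(2)[of 1 q s] even_avg_G(2)[of 0 q s]
    by (simp_all add: r_def numeral_2_eq_2 eval_nat_numeral del: even_avg.simps)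
  moreover have "even_avg 0 (deriv (deriv h)) q s = G 2 (s + r) + G 2 (s - r)"
    by (simp add: G_def r_def numeral_2_eq_2)
  ultimately show ?thesis by simp
qed

text \<open>A derivative in \<open>q\<close> raises \<open>j\<close> by one and so costs two
  derivatives of \<open>h\<close>.\<close>

lemma Ck_on_even_avg:
  "2 * (j + n) \<le> N \<Longrightarrow> Ck_on n {0..} (\<lambda>q. even_avg j h q s)"
proof (induction n arbitrary: j)
  case 0
  then show ?case
    using continuous_on_compose2[OF continuous_on_even_avg[of j], of "{0..}" "\<lambda>q. (q, s)"]
    by (force intro!: continuous_intros simp del: even_avg.simps)
next
  case (Suc n)
  have "Ck_on n {0..} (\<lambda>q. 1 / (if j = 0 then 2 else 4 * j) * even_avg (Suc j) h q s)"
    using Suc.prems by (intro Ck_on_mult Ck_on_const Suc.IH) simp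
  then show ?case using Suc.prems even_avg_deriv_q[of j]
    by (intro Ck_on_SucI[where f' = "\<lambda>q. 1 / (if j = 0 then 2 else 4 * j) * even_avg (Suc j) h q s"])
      (auto simp del: even_avg.simps)
qed

end

section \<open>Radial functions in the variable \<open>q = r\<^sup>2\<close>\<close>

lemma Ck_on_cong: "(\<And>x. x \<in> X \<Longrightarrow> f x = g x) \<Longrightarrow> Ck_on n X f \<Longrightarrow> Ck_on n X g"
proof (cases n)
  case (Suc m)
  assume eq: "\<And>x. x \<in> X \<Longrightarrow> f x = g x" and "Ck_on n X f"
  then obtain f' where *: "\<forall>x\<in>X. (f has_real_derivative f' x) (at x within X)" "Ck_on m X f'"
    using Suc by auto
  have "(g has_real_derivative f' x) (at x within X)" if "x \<in> X" for x
    by (rule has_field_derivative_transform_within[OF *(1)[rule_format, OF that], of 1]) (use eq that in auto)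
  then show ?thesis using *(2) Suc by auto
qed (auto cong: continuous_on_cong)

lemma Ck_on_cosh: "Ck_on n UNIV (\<lambda>x. cosh (a * x))" and Ck_on_sinh: "Ck_on n UNIV (\<lambda>x. sinh (a * x))"
proof (induction n)
  case (Suc n)
  { case 1
    have "Ck_on n UNIV (\<lambda>x. a * sinh (a * x))" by (intro Ck_on_mult Ck_on_const Suc)
    then show ?case
      by (rule Ck_on_SucI[rotated]) (auto intro!: derivative_eq_intros)
  next
    case 2
    have "Ck_on n UNIV (\<lambda>x. a * cosh (a * x))" by (intro Ck_on_mult Ck_on_const Suc)
    then show ?case
      by (rule Ck_on_SucI[rotated]) (auto intro!: derivative_eq_intros)
  }
qed (auto intro!: continuous_intros)

text \<open>The functions \<open>sinhc\<close> and \<open>coshh\<close> are \<open>sinh r / r\<close> and \<open>cosh (r / 2)\<close> in the variable \<open>q = r\<^sup>2\<close>.\<close>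

definition sinhc :: "real \<Rightarrow> real" where "sinhc q = even_avg 1 (\<lambda>x. cosh (1 * x)) q 0 / 2"
definition coshh :: "real \<Rightarrow> real" where "coshh q = cosh (sqrt q / 2)"

lemma Ck_on_sinhc: "Ck_on n {0..} sinhc"
proof -
  have "Ck_on n {0..} (\<lambda>q. (1/2) * even_avg 1 (\<lambda>x. cosh (1 * x)) q 0)"
    by (intro Ck_on_mult Ck_on_const Ck_on_even_avg[OF Ck_on_cosh order_refl])
  then show ?thesis by (rule Ck_on_cong[rotated]) (simp add: sinhc_def)
qed

lemma Ck_on_coshh: "Ck_on n {0..} coshh"
proof -
  have "Ck_on n {0..} (\<lambda>q. (1/2) * even_avg 0 (\<lambda>x. cosh ((1/2) * x)) q 0)"
    by (intro Ck_on_mult Ck_on_const Ck_on_even_avg[OF Ck_on_cosh order_refl])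
  then show ?thesis by (rule Ck_on_cong[rotated]) (simp add: coshh_def)
qed

lemma deriv_cosh_sinh:
  "deriv (\<lambda>x. cosh (1 * x :: real)) = (\<lambda>x. sinh (1 * x))" "deriv (\<lambda>x. sinh (1 * x :: real)) = (\<lambda>x. cosh (1 * x))"
  by (auto intro!: DERIV_imp_deriv derivative_eq_intros)

lemma sinhc_mult_sqrt: "q \<ge> 0 \<Longrightarrow> sinhc q * sqrt q = sinh (sqrt q)"
  using even_avg_1_mult_sqrt[OF Ck_on_cosh, of 2 1 q 0]
  by (simp add: sinhc_def deriv_cosh_sinh[simplified] del: even_avg.simps)

text \<open>At 0 the product formula says nothing; there the wave identity for cosh, which is its
  own second derivative, gives \<open>even_avg 1 = even_avg 0 = 2\<close>.\<close>

lemma sinhc_pos: "q \<ge> 0 \<Longrightarrow> sinhc q > 0"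
proof (cases "q = 0")
  case True
  then show ?thesis using even_avg_wave_identity[OF Ck_on_cosh, of 4 0 1 0]
    by (simp add: sinhc_def deriv_cosh_sinh[simplified] del: even_avg.simps(2))
next
  case False
  assume "q \<ge> 0"
  then have "sinhc q * sqrt q > 0" using False by (simp add: sinhc_mult_sqrt)
  then show ?thesis using \<open>q \<ge> 0\<close> False by (simp add: zero_less_mult_iff)
qed

lemma coshh_ge_1: "coshh q \<ge> 1" by (simp add: coshh_def cosh_real_ge_1)

lemma coshh_sq: "(coshh q)\<^sup>2 = (cosh (sqrt q) + 1) / 2"
  using cosh_double_cosh[of "sqrt q / 2"] by (simp add: coshh_def)

text \<open>Both sides are sinh^2 r / 4 = (d\<rho>/dr)^2, the leading coefficient of the radial
  Laplacian in the variable \<rho>.\<close>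

lemma coshh_sq_sinhc: "q \<ge> 0 \<Longrightarrow> (coshh q)\<^sup>2 * ((coshh q)\<^sup>2 - 1) = q * (sinhc q)\<^sup>2 / 4"
proof -
  assume "q \<ge> 0"
  then have "q * (sinhc q)\<^sup>2 = (sinhc q * sqrt q)\<^sup>2" by (simp add: power_mult_distrib)
  also have "\<dots> = (cosh (sqrt q))\<^sup>2 - 1"
    using \<open>q \<ge> 0\<close> by (simp add: sinhc_mult_sqrt sinh_square_eq)
  finally show ?thesis unfolding coshh_sq by (simp add: field_simps power2_eq_square)
qed

text \<open>The equation is r d/dr (sinh r / r) = cosh r - sinh r / r. The derivative exists at
  \<open>q = 0\<close> because it is a weighted average of the fourth derivative of cosh.\<close>

lemma sinhc_deriv:
  assumes "q \<ge> 0"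
  shows "\<exists>d. (sinhc has_real_derivative d) (at q within {0..}) \<and> 2 * q * d = cosh (sqrt q) - sinhc q"
proof (intro exI conjI)
  show "(sinhc has_real_derivative even_avg 2 (\<lambda>x. cosh (1 * x)) q 0 / 8) (at q within {0..})"
    using DERIV_cdivide[OF even_avg_deriv_q[OF Ck_on_cosh, of 1 4 q 1 0], of 2] assms
    by (simp add: sinhc_def[abs_def] numeral_2_eq_2 del: even_avg.simps)
  show "2 * q * (even_avg 2 (\<lambda>x. cosh (1 * x)) q 0 / 8) = cosh (sqrt q) - sinhc q"
    using even_avg_wave_identity[OF Ck_on_cosh, of 4 q 1 0] assms
    by (simp add: sinhc_def deriv_cosh_sinh[simplified] del: even_avg.simps(2) )
qed

text \<open>\<open>has_D F G\<close> says that \<open>G\<close> is the derivative of \<open>F\<close> in the variable \<open>\<rho> = cosh\<^sup>2 (r / 2)\<close>.\<close>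

definition has_D :: "(real \<Rightarrow> real) \<Rightarrow> (real \<Rightarrow> real) \<Rightarrow> bool" where
  "has_D F G \<longleftrightarrow> (\<forall>q\<ge>0. (F has_real_derivative sinhc q / 4 * G q) (at q within {0..}))"

text \<open>The factor \<open>sinhc q / 4\<close> is d\<rho>/dq. It has no zero, so it can be
  divided out.\<close>

lemma has_D_unique: "has_D F G \<Longrightarrow> has_D F G' \<Longrightarrow> q \<ge> 0 \<Longrightarrow> G q = G' q"
  using sinhc_pos[of q] DERIV_within_unique[of F "sinhc q / 4 * G q" q 0 "sinhc q / 4 * G' q"]
  by (auto simp: has_D_def)

lemma has_D_cong: "has_D F G \<Longrightarrow> (\<And>q. q \<ge> 0 \<Longrightarrow> F q = F' q) \<Longrightarrow> (\<And>q. q \<ge> 0 \<Longrightarrow> G q = G' q) \<Longrightarrow> has_D F' G'"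
  unfolding has_D_def by (auto intro!: has_field_derivative_transform_within[where f = F and g = F' and d = 1])

lemma has_D_const: "has_D (\<lambda>q. a) (\<lambda>q. 0)"
  by (simp add: has_D_def)

lemma has_D_add: "has_D F F' \<Longrightarrow> has_D G G' \<Longrightarrow> has_D (\<lambda>q. F q + G q) (\<lambda>q. F' q + G' q)"
  unfolding has_D_def by (auto intro!: derivative_eq_intros simp: algebra_simps)

lemma has_D_mult: "has_D F F' \<Longrightarrow> has_D G G' \<Longrightarrow> has_D (\<lambda>q. F q * G q) (\<lambda>q. F' q * G q + F q * G' q)"
  unfolding has_D_def by (auto intro!: derivative_eq_intros simp: algebra_simps)

lemma has_D_chain:
  "has_D F F' \<Longrightarrow> (\<And>q. q \<ge> 0 \<Longrightarrow> (\<Phi> has_real_derivative \<Phi>' (F q)) (at (F q))) \<Longrightarrow>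
    has_D (\<lambda>q. \<Phi> (F q)) (\<lambda>q. \<Phi>' (F q) * F' q)"
  unfolding has_D_def
proof safe
  fix q :: real
  assume "\<forall>q\<ge>0. (F has_real_derivative sinhc q / 4 * F' q) (at q within {0..})" "0 \<le> q"
    and "\<And>q. 0 \<le> q \<Longrightarrow> (\<Phi> has_real_derivative \<Phi>' (F q)) (at (F q))"
  then have "((\<lambda>q. \<Phi> (F q)) has_real_derivative \<Phi>' (F q) * (sinhc q / 4 * F' q)) (at q within {0..})"
    using DERIV_chain2 by blast
  then show "((\<lambda>q. \<Phi> (F q)) has_real_derivative sinhc q / 4 * (\<Phi>' (F q) * F' q)) (at q within {0..})"
    by (simp add: mult_ac)
qed

text \<open>Since \<rho> = \<xi>^2 for \<xi> = cosh(r/2), the derivative is 1 / (2 \<xi>), which is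
  regular because \<xi> \<ge> 1. The chain rule through \<open>sqrt\<close> settles
  \<open>q > 0\<close>, continuity the rest.\<close>

lemma has_D_coshh: "has_D coshh (\<lambda>q. 1 / (2 * coshh q))"
  unfolding has_D_def
proof safe
  fix q :: real assume "q \<ge> 0"
  show "(coshh has_real_derivative sinhc q / 4 * (1 / (2 * coshh q))) (at q within {0..})"
  proof (rule DERIV_closed_right[OF _ _ _ \<open>q \<ge> 0\<close>])
    have nz: "coshh x \<noteq> 0" for x using coshh_ge_1[of x] by linarith
    show "continuous_on {0..} coshh" by (rule Ck_on_continuous[OF Ck_on_coshh])
    then show "continuous_on {0..} (\<lambda>q. sinhc q / 4 * (1 / (2 * coshh q)))"
      using Ck_on_continuous[OF Ck_on_sinhc] nz by (intro continuous_intros) auto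
    fix q :: real assume "q > 0"
    then have sq: "(sqrt has_real_derivative 1 / (2 * sqrt q)) (at q)"
      using DERIV_real_sqrt[of q] by (simp add: field_simps)
    have "(coshh has_real_derivative sinh (sqrt q / 2) * (1 / (2 * sqrt q) / 2)) (at q)"
      unfolding coshh_def
      by (rule DERIV_chain2[OF _ DERIV_cdivide[OF sq]]) (auto intro!: derivative_eq_intros)
    moreover have "sinh (sqrt q / 2) * (1 / (2 * sqrt q) / 2) = sinhc q / 4 * (1 / (2 * coshh q))"
      using sinhc_mult_sqrt[of q] \<open>q > 0\<close> nz[of q] sinh_double[of "sqrt q / 2"]
      by (simp add: field_simps coshh_def)
    ultimately show "(coshh has_real_derivative sinhc q / 4 * (1 / (2 * coshh q))) (at q)" by simp
  qed
qed

text \<open>Lets supports pass through \<open>D\<close>. It also kills functions that are merely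
  constant near \<open>q\<close>, which is the situation inside the light cone.\<close>

lemma has_D_const_on:
  assumes "has_D F G" "open U" "q \<in> U" "q \<ge> 0" "\<And>x. x \<in> U \<Longrightarrow> x \<ge> 0 \<Longrightarrow> F x = a"
  shows "G q = 0"
proof -
  obtain d where d: "d > 0" "ball q d \<subseteq> U" using assms(2,3) openE by blast
  have "((\<lambda>x. a) has_real_derivative sinhc q / 4 * G q) (at q within {0..})"
  proof (rule has_field_derivative_transform_within[OF _ d(1)])
    show "(F has_real_derivative sinhc q / 4 * G q) (at q within {0..})" using assms by (auto simp: has_D_def)
  qed (use assms d in \<open>auto simp: dist_commute subset_eq\<close>)
  from DERIV_within_unique[OF this DERIV_const assms(4)] sinhc_pos[of q] assms(4) show ?thesis by auto
qed

text \<open>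
  \<open>evop l T\<close>: the operator \<open>T\<close> sends \<open>h\<close> to a function of \<open>q\<close> and the time \<open>s\<close>. It commutes with
  differentiation in \<open>s\<close>, because its coefficients depend on \<open>q\<close> only.
\<close>

definition evop :: "nat \<Rightarrow> ((real \<Rightarrow> real) \<Rightarrow> real \<Rightarrow> real \<Rightarrow> real) \<Rightarrow> bool" where
  "evop l T \<longleftrightarrow> (\<exists>c. (\<forall>j n. Ck_on n {0..} (c j)) \<and> (\<forall>h q s. T h q s = (\<Sum>j\<le>l. c j q * even_avg j h q s)))"

text \<open>\<open>Ck_on\<close> supplies a derivative for each order separately; by uniqueness of
  one-sided derivatives a single \<open>c'\<close> serves all orders.\<close>

lemma Ck_on_all_deriv:
  assumes "\<And>n. Ck_on n {0..} c"
  obtains c' where "\<And>q. q \<ge> 0 \<Longrightarrow> (c has_real_derivative c' q) (at q within {0..})" "\<And>n. Ck_on n {0..} c'"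
proof -
  obtain c' where c': "\<forall>q\<in>{0..}. (c has_real_derivative c' q) (at q within {0..})"
    using assms[of "Suc 0"] by auto
  have "Ck_on n {0..} c'" for n
  proof -
    obtain f' where f': "\<forall>q\<in>{0..}. (c has_real_derivative f' q) (at q within {0..})" "Ck_on n {0..} f'"
      using assms[of "Suc n"] by auto
    show ?thesis
      by (rule Ck_on_cong[OF _ f'(2)])
        (rule DERIV_within_unique[OF f'(1)[rule_format] c'[rule_format]], auto)
  qed
  with c' that show ?thesis by auto
qed

text \<open>By the product rule and \<open>even_avg_deriv_q\<close> the order grows by one. The
  coefficients of \<open>T'\<close> are fixed before \<open>h\<close> and \<open>s\<close>, so the
  same operator serves every \<open>h\<close>; this is what allows \<open>h\<close> to be replaced
  by its derivatives later.\<close>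

lemma evop_D:
  assumes "evop l T"
  obtains T' where "evop (Suc l) T'"
    "\<And>N h s. Ck_on N UNIV h \<Longrightarrow> 2 * l + 2 \<le> N \<Longrightarrow> has_D (\<lambda>q. T h q s) (\<lambda>q. T' h q s)"
proof -
  from assms obtain c where c: "\<And>j n. Ck_on n {0..} (c j)"
    and T: "\<And>h q s. T h q s = (\<Sum>j\<le>l. c j q * even_avg j h q s)" unfolding evop_def by auto
  have "\<forall>j. \<exists>c'. (\<forall>q\<ge>0. (c j has_real_derivative c' q) (at q within {0..})) \<and> (\<forall>n. Ck_on n {0..} c')"
    using Ck_on_all_deriv[OF c] by metis
  then obtain c' where c': "\<And>j q. q \<ge> 0 \<Longrightarrow> (c j has_real_derivative c' j q) (at q within {0..})"
    "\<And>j n. Ck_on n {0..} (c' j)" by metis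
  let ?w = "\<lambda>j::nat. real (if j = 0 then 2 else 4 * j)"
  \<comment> \<open>The factor \<open>4 * inverse (sinhc q)\<close> is dq/d\<rho>. The second
    summand collects the contribution of index \<open>j - 1\<close>; the case split guards against
    \<open>0 - 1 = 0\<close>.\<close>
  define e where "e j q = 4 * inverse (sinhc q) * ((if j \<le> l then c' j q else 0)
      + (if j = 0 then 0 else inverse (?w (j - 1)) * c (j - 1) q))" for j q
  define T' where "T' h q s = (\<Sum>j\<le>Suc l. e j q * even_avg j h q s)" for h q s
  have s0: "q \<ge> 0 \<Longrightarrow> sinhc q \<noteq> 0" for q using sinhc_pos[of q] by auto
  have "Ck_on n {0..} (e j)" for j n
  proof -
    have "Ck_on n {0..} (\<lambda>q. if j \<le> l then c' j q else 0)"
      using c'(2)[of n j] Ck_on_const[of n "{0..}" 0] by (cases "j \<le> l") simp_all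
    moreover have "Ck_on n {0..} (\<lambda>q. if j = 0 then 0 else inverse (?w (j - 1)) * c (j - 1) q)"
      using Ck_on_mult[OF Ck_on_const c, of n "inverse (?w (j - 1))" "j - 1"] Ck_on_const[of n "{0..}" 0]
      by (cases "j = 0") simp_all
    ultimately show ?thesis unfolding e_def
      by (intro Ck_on_mult Ck_on_add Ck_on_const Ck_on_inverse Ck_on_sinhc) (auto dest: s0)
  qed
  then have "evop (Suc l) T'" unfolding evop_def T'_def by (intro exI[of _ e]) simp
  moreover have "has_D (\<lambda>q. T h q s) (\<lambda>q. T' h q s)" if "Ck_on N UNIV h" "2 * l + 2 \<le> N" for N h s
    unfolding has_D_def
  proof safe
    fix q :: real assume q: "q \<ge> 0"
    have "((\<lambda>q. T h q s) has_real_derivative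
       (\<Sum>j\<le>l. c' j q * even_avg j h q s + even_avg (Suc j) h q s / ?w j * c j q)) (at q within {0..})"
      unfolding T using that q
      by (intro DERIV_sum DERIV_mult c' even_avg_deriv_q) auto
    moreover have "sinhc q / 4 * T' h q s = (\<Sum>j\<le>l. c' j q * even_avg j h q s + even_avg (Suc j) h q s / ?w j * c j q)"
    proof -
      have "sinhc q / 4 * T' h q s = (\<Sum>j\<le>Suc l. (if j \<le> l then c' j q else 0) * even_avg j h q s)
          + (\<Sum>j\<le>Suc l. (if j = 0 then 0 else inverse (?w (j - 1)) * c (j - 1) q) * even_avg j h q s)"
        unfolding T'_def sum_distrib_left sum.distrib[symmetric] e_def
        using s0[OF q] by (intro sum.cong) (auto simp: field_simps simp del: even_avg.simps)
      also have "(\<Sum>j\<le>Suc l. (if j \<le> l then c' j q else 0) * even_avg j h q s) = (\<Sum>j\<le>l. c' j q * even_avg j h q s)"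
        by (simp del: even_avg.simps)
      also have "(\<Sum>j\<le>Suc l. (if j = 0 then 0 else inverse (?w (j - 1)) * c (j - 1) q) * even_avg j h q s)
          = (\<Sum>j\<le>l. even_avg (Suc j) h q s / ?w j * c j q)"
        unfolding sum.atMost_Suc_shift by (auto intro!: sum.cong simp: divide_inverse simp del: even_avg.simps)
      finally show ?thesis by (simp add: sum.distrib del: even_avg.simps)
    qed
    ultimately show "((\<lambda>q. T h q s) has_real_derivative sinhc q / 4 * T' h q s) (at q within {0..})" by simp
  qed
  ultimately show ?thesis using that by blast
qed

lemma evop_mult:
  assumes "evop l T" "\<And>n. Ck_on n {0..} \<omega>"
  shows "evop l (\<lambda>h q s. \<omega> q * T h q s)"
proof -
  from assms(1) obtain c where c: "\<And>j n. Ck_on n {0..} (c j)"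
    and T: "\<And>h q s. T h q s = (\<Sum>j\<le>l. c j q * even_avg j h q s)" unfolding evop_def by auto
  show ?thesis unfolding evop_def
    by (rule exI[of _ "\<lambda>j q. \<omega> q * c j q"]) (auto simp: T sum_distrib_left mult.assoc simp del: even_avg.simps
        intro: Ck_on_mult assms(2) c)
qed

lemma evop_add:
  assumes "evop l T" "evop l T'"
  shows "evop l (\<lambda>h q s. T h q s + T' h q s)"
proof -
  from assms(1) obtain c where c: "\<And>j n. Ck_on n {0..} (c j)"
    and T: "\<And>h q s. T h q s = (\<Sum>j\<le>l. c j q * even_avg j h q s)" unfolding evop_def by auto
  from assms(2) obtain c' where c': "\<And>j n. Ck_on n {0..} (c' j)"
    and T': "\<And>h q s. T' h q s = (\<Sum>j\<le>l. c' j q * even_avg j h q s)" unfolding evop_def by auto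
  show ?thesis unfolding evop_def
    by (rule exI[of _ "\<lambda>j q. c j q + c' j q"])
      (auto simp: T T' sum.distrib algebra_simps simp del: even_avg.simps intro: Ck_on_add c c')
qed

lemma evop_Suc:
  assumes "evop l T" shows "evop (Suc l) T"
proof -
  from assms obtain c where c: "\<And>j n. Ck_on n {0..} (c j)"
    and T: "\<And>h q s. T h q s = (\<Sum>j\<le>l. c j q * even_avg j h q s)" unfolding evop_def by auto
  have "Ck_on n {0..} (if j \<le> l then c j else (\<lambda>q. 0))" for j n using c Ck_on_const by auto
  then show ?thesis unfolding evop_def
    by (intro exI[of _ "\<lambda>j. if j \<le> l then c j else (\<lambda>q. 0)"]) (auto simp: T simp del: even_avg.simps)
qed

lemma evop_deriv_s:
  assumes "evop l T" "Ck_on N UNIV h" "2 * l < N"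
  shows "((\<lambda>s. T h q s) has_real_derivative T (deriv h) q s) (at s)"
proof -
  from assms(1) obtain c where T: "\<And>h q s. T h q s = (\<Sum>j\<le>l. c j q * even_avg j h q s)" unfolding evop_def by auto
  show ?thesis unfolding T using assms(2,3) by (intro DERIV_sum DERIV_cmult even_avg_deriv_s) auto
qed

lemma evop_continuous:
  assumes "evop l T" "Ck_on N UNIV h" "2 * l \<le> N"
  shows "continuous_on ({0..} \<times> UNIV) (\<lambda>(q, s). T h q s)"
proof -
  from assms(1) obtain c where c: "\<And>j n. Ck_on n {0..} (c j)"
    and T: "\<And>h q s. T h q s = (\<Sum>j\<le>l. c j q * even_avg j h q s)" unfolding evop_def by auto
  show ?thesis unfolding T split_beta
  proof (intro continuous_intros)
    fix j assume "j \<in> {..l}"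
    have "continuous_on ({0..} \<times> UNIV) (\<lambda>p::real \<times> real. (c j \<circ> fst) p)"
      by (intro continuous_on_compose continuous_intros continuous_on_subset[OF Ck_on_continuous[OF c[of 0 j]]]) auto
    then show "continuous_on ({0..} \<times> UNIV) (\<lambda>p::real \<times> real. c j (fst p))" by simp
    show "continuous_on ({0..} \<times> UNIV) (\<lambda>p. even_avg j h (fst p) (snd p))"
      using continuous_on_even_avg[OF assms(2), of j] assms(3) \<open>j \<in> {..l}\<close>
      by (simp add: split_beta del: even_avg.simps)
  qed
qed

section \<open>The radial wave operators\<close>

declare Ck_on.simps [simp del]

text \<open>
  In the variable \<open>\<rho>\<close> the shifted Laplacian of a radial function is
  \<open>\<rho> (\<rho> - 1) D\<^sup>2 + ((1 + \<alpha>) \<rho> - \<beta>) D + \<alpha>\<^sup>2 / 4\<close> with \<open>\<alpha> = Q\<close> and \<open>\<beta> = (k + 1) / 2\<close>. For \<open>\<alpha> = 0\<close> and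
  \<open>\<beta> = 1 / 2\<close> it is \<open>d\<^sup>2 / dr\<^sup>2\<close>. The operator \<open>D\<close> intertwines the parameters of \<open>(m, k)\<close> and
  \<open>(m, k + 2)\<close>, and \<open>\<surd>\<rho> D\<close> those of \<open>(m, 0)\<close> and \<open>(m + 2, 0)\<close>.
\<close>

definition wave_level where
  "wave_level l \<alpha> \<beta> T T1 T2 \<longleftrightarrow> evop l T \<and> evop (Suc l) T1 \<and> evop (Suc (Suc l)) T2 \<and>
     (\<forall>h s. Ck_on (2 * l + 8) UNIV h \<longrightarrow>
       has_D (\<lambda>q. T h q s) (\<lambda>q. T1 h q s) \<and> has_D (\<lambda>q. T1 h q s) (\<lambda>q. T2 h q s) \<and>
       (\<forall>q\<ge>0. (coshh q)\<^sup>2 * ((coshh q)\<^sup>2 - 1) * T2 h q s + ((1 + \<alpha>) * (coshh q)\<^sup>2 - \<beta>) * T1 h q s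
          + \<alpha>\<^sup>2 / 4 * T h q s = T (deriv (deriv h)) q s))"

lemma has_D_rho: "has_D (\<lambda>q. (coshh q)\<^sup>2) (\<lambda>q. 1)"
proof -
  have "coshh q \<noteq> 0" for q using coshh_ge_1[of q] by linarith
  then show ?thesis
    by (intro has_D_cong[OF has_D_mult[OF has_D_coshh has_D_coshh]]) (auto simp: power2_eq_square)
qed

text \<open>For \<alpha> = 0 and \<beta> = 1/2 the radial operator is d^2/dr^2, so after the change
  of variables the equation is \<open>even_avg_wave_identity\<close>.\<close>

lemma wave_level_base:
  obtains T1 T2 where "wave_level 0 0 (1/2) (even_avg 0) T1 T2"
proof -
  define T1 where "T1 h q s = 2 * inverse (sinhc q) * even_avg 1 h q s" for h q s
  have s0: "q \<ge> 0 \<Longrightarrow> sinhc q \<noteq> 0" for q using sinhc_pos[of q] by auto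
  have e0: "evop 0 (even_avg 0)"
    unfolding evop_def by (rule exI[of _ "\<lambda>j q. 1"]) (auto simp: Ck_on_const)
  have "Ck_on n {0..} (\<lambda>q. if j = 0 then 0 else 2 * inverse (sinhc q))" for j n :: nat
  proof -
    have "Ck_on n {0..} (\<lambda>q. 2 * inverse (sinhc q))"
      by (intro Ck_on_mult Ck_on_const Ck_on_inverse Ck_on_sinhc) (auto dest: s0)
    then show ?thesis using Ck_on_const[of n "{0..}" 0] by (cases "j = 0") simp_all
  qed
  then have e1: "evop (Suc 0) T1"
    unfolding evop_def
    by (intro exI[of _ "\<lambda>j q. if j = 0 then 0 else 2 * inverse (sinhc q)"])
       (auto simp: T1_def simp del: even_avg.simps)
  obtain T2 where e2: "evop (Suc (Suc 0)) T2"
    and T2: "\<And>N h s. Ck_on N UNIV h \<Longrightarrow> 2 * Suc 0 + 2 \<le> N \<Longrightarrow> has_D (\<lambda>q. T1 h q s) (\<lambda>q. T2 h q s)"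
    using evop_D[OF e1] by metis
  have "has_D (\<lambda>q. even_avg 0 h q s) (\<lambda>q. T1 h q s) \<and> has_D (\<lambda>q. T1 h q s) (\<lambda>q. T2 h q s) \<and>
       (\<forall>q\<ge>0. (coshh q)\<^sup>2 * ((coshh q)\<^sup>2 - 1) * T2 h q s + ((1 + 0) * (coshh q)\<^sup>2 - 1/2) * T1 h q s
          + 0\<^sup>2 / 4 * even_avg 0 h q s = even_avg 0 (deriv (deriv h)) q s)"
    if h: "Ck_on (2 * 0 + 8) UNIV h" for h s
  proof (intro conjI allI impI)
    show "has_D (\<lambda>q. even_avg 0 h q s) (\<lambda>q. T1 h q s)"
      unfolding has_D_def T1_def
    proof safe
      fix q :: real assume q: "q \<ge> 0"
      have eq: "sinhc q / 4 * (2 * inverse (sinhc q) * even_avg 1 h q s) = even_avg 1 h q s / 2"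
        using s0[OF q] by (simp add: field_simps del: even_avg.simps)
      show "((\<lambda>q. even_avg 0 h q s) has_real_derivative
          sinhc q / 4 * (2 * inverse (sinhc q) * even_avg 1 h q s)) (at q within {0..})"
        unfolding eq using even_avg_deriv_q[OF h, of 0 q s] q by (simp del: even_avg.simps)
    qed
    show hd: "has_D (\<lambda>q. T1 h q s) (\<lambda>q. T2 h q s)" using T2[OF h] by simp
    fix q :: real assume q: "q \<ge> 0"
    define E1 E2 where "E1 = even_avg 1 h q s" and "E2 = even_avg 2 h q s"
    obtain d where d: "(sinhc has_real_derivative d) (at q within {0..})" "2 * q * d = cosh (sqrt q) - sinhc q"
      using sinhc_deriv[OF q] by blast
    have "((\<lambda>q. even_avg 1 h q s) has_real_derivative E2 / 4) (at q within {0..})"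
      using even_avg_deriv_q[OF h, of 1 q s] q by (simp add: E2_def numeral_2_eq_2 del: even_avg.simps)
    \<comment> \<open>\<open>T2\<close> is known only through \<open>evop_D\<close>; its value is
      found by differentiating the formula for \<open>T1\<close> and comparing one-sided
      derivatives.\<close>
    from DERIV_mult[OF DERIV_cmult[OF DERIV_inverse_fun[OF d(1) s0[OF q]], of 2] this]
    have "((\<lambda>q. T1 h q s) has_real_derivative
        2 * - (d * inverse (sinhc q ^ Suc (Suc 0))) * E1 + E2 / 4 * (2 * inverse (sinhc q))) (at q within {0..})"
      by (simp add: T1_def[abs_def] E1_def mult_ac del: even_avg.simps)
    moreover have "((\<lambda>q. T1 h q s) has_real_derivative sinhc q / 4 * T2 h q s) (at q within {0..})"
      using hd q by (simp add: has_D_def)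
    ultimately have "sinhc q / 4 * T2 h q s = 2 * - (d * inverse (sinhc q ^ Suc (Suc 0))) * E1 + E2 / 4 * (2 * inverse (sinhc q))"
      using DERIV_within_unique q by blast
    then have "(sinhc q)\<^sup>2 / 4 * T2 h q s = sinhc q * (2 * - (d * inverse (sinhc q ^ Suc (Suc 0))) * E1 + E2 / 4 * (2 * inverse (sinhc q)))"
      by (simp add: power2_eq_square)
    also have "\<dots> = E2 / 2 - 2 * d * E1 * inverse (sinhc q)"
      using s0[OF q] by (simp add: field_simps)
    finally have X: "(sinhc q)\<^sup>2 / 4 * T2 h q s = E2 / 2 - 2 * d * E1 * inverse (sinhc q)" .
    \<comment> \<open>Multiplication by \<open>q\<close> brings in the product
      \<open>2 * q * d\<close>, whose value is known, and matches the leading coefficient given by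
      \<open>coshh_sq_sinhc\<close>.\<close>
    have "q * ((sinhc q)\<^sup>2 / 4 * T2 h q s) = q * (E2 / 2) - (2 * q * d) * E1 * inverse (sinhc q)"
      unfolding X by (simp add: algebra_simps)
    then have 1: "q * ((sinhc q)\<^sup>2 / 4 * T2 h q s) = q * (E2 / 2) - (cosh (sqrt q) - sinhc q) * E1 * inverse (sinhc q)"
      unfolding d(2) .
    have "(coshh q)\<^sup>2 * ((coshh q)\<^sup>2 - 1) * T2 h q s + ((1 + 0) * (coshh q)\<^sup>2 - 1/2) * T1 h q s
        = q * ((sinhc q)\<^sup>2 / 4 * T2 h q s) + (cosh (sqrt q) / 2) * (2 * inverse (sinhc q) * E1)"
      unfolding coshh_sq_sinhc[OF q] by (simp add: coshh_sq T1_def E1_def add_divide_distrib)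
    also have "\<dots> = E1 + q / 2 * E2"
      unfolding 1 using s0[OF q] by (simp add: field_simps)
    also have "\<dots> = even_avg 0 (deriv (deriv h)) q s"
      unfolding E1_def E2_def by (rule even_avg_wave_identity[OF h _ q]) simp
    finally show "(coshh q)\<^sup>2 * ((coshh q)\<^sup>2 - 1) * T2 h q s + ((1 + 0) * (coshh q)\<^sup>2 - 1/2) * T1 h q s
          + 0\<^sup>2 / 4 * even_avg 0 h q s = even_avg 0 (deriv (deriv h)) q s"
      by (simp del: even_avg.simps)
  qed
  with e0 e1 e2 have "wave_level 0 0 (1/2) (even_avg 0) T1 T2" unfolding wave_level_def by auto
  then show ?thesis by (rule that)
qed

text \<open>Writing L and L' for the radial operators with parameters (\<alpha>, \<beta>) and
  (\<alpha>', \<beta>'), the assumption \<open>alg\<close> is the intertwining relation L' (\<omega>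
  D) = \<omega> D L, with t1, t2, t3 standing for the first three derivatives of \<open>T\<close> in
  \<rho>. The minus sign in the new operator keeps the velocity at time 0 nonnegative, since D turns
  nonnegative cone functions into nonpositive ones.\<close>

lemma wave_level_step:
  assumes L: "wave_level l \<alpha> \<beta> T T1 T2"
    and \<omega>: "has_D \<omega> \<omega>1" "has_D \<omega>1 \<omega>2" "\<And>n. Ck_on n {0..} \<omega>" "\<And>n. Ck_on n {0..} \<omega>1" "\<And>n. Ck_on n {0..} \<omega>2"
    and alg: "\<And>q \<rho> t1 t2 t3. q \<ge> 0 \<Longrightarrow> \<rho> = (coshh q)\<^sup>2 \<Longrightarrow>
       \<rho> * (\<rho> - 1) * (\<omega>2 q * t1 + 2 * \<omega>1 q * t2 + \<omega> q * t3)
       + ((1 + \<alpha>') * \<rho> - \<beta>') * (\<omega>1 q * t1 + \<omega> q * t2) + \<alpha>'\<^sup>2 / 4 * (\<omega> q * t1)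
       = \<omega> q * ((2 * \<rho> - 1) * t2 + \<rho> * (\<rho> - 1) * t3 + (1 + \<alpha>) * t1 + ((1 + \<alpha>) * \<rho> - \<beta>) * t2 + \<alpha>\<^sup>2 / 4 * t1)"
  obtains T2' where "wave_level (Suc l) \<alpha>' \<beta>' (\<lambda>h q s. - \<omega> q * T1 h q s)
     (\<lambda>h q s. - \<omega>1 q * T1 h q s + - \<omega> q * T2 h q s) T2'"
proof -
  have e: "evop l T" "evop (Suc l) T1" "evop (Suc (Suc l)) T2" using L by (auto simp: wave_level_def)
  have LD: "has_D (\<lambda>q. T h q s) (\<lambda>q. T1 h q s)" "has_D (\<lambda>q. T1 h q s) (\<lambda>q. T2 h q s)"
    and LE: "q \<ge> 0 \<Longrightarrow> (coshh q)\<^sup>2 * ((coshh q)\<^sup>2 - 1) * T2 h q s + ((1 + \<alpha>) * (coshh q)\<^sup>2 - \<beta>) * T1 h q s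
          + \<alpha>\<^sup>2 / 4 * T h q s = T (deriv (deriv h)) q s"
    if "Ck_on (2 * l + 8) UNIV h" for h s q using L that unfolding wave_level_def by auto
  obtain T3 where e3: "evop (Suc (Suc (Suc l))) T3"
    and T3: "\<And>N h s. Ck_on N UNIV h \<Longrightarrow> 2 * Suc (Suc l) + 2 \<le> N \<Longrightarrow> has_D (\<lambda>q. T2 h q s) (\<lambda>q. T3 h q s)"
    using evop_D[OF e(3)] by metis
  have m: "Ck_on n {0..} (\<lambda>q. - f q)" if "Ck_on n {0..} f" for n f
    using Ck_on_mult[OF Ck_on_const that, of "-1"] by simp
  define T2' where "T2' h q s = - \<omega>2 q * T1 h q s + ((- \<omega>1 q * T2 h q s + - \<omega>1 q * T2 h q s) + - \<omega> q * T3 h q s)" for h q s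
  have "wave_level (Suc l) \<alpha>' \<beta>' (\<lambda>h q s. - \<omega> q * T1 h q s)
     (\<lambda>h q s. - \<omega>1 q * T1 h q s + - \<omega> q * T2 h q s) T2'"
    unfolding wave_level_def
  proof (intro conjI allI impI)
    show "evop (Suc l) (\<lambda>h q s. - \<omega> q * T1 h q s)" by (intro evop_mult e m \<omega>)
    show "evop (Suc (Suc l)) (\<lambda>h q s. - \<omega>1 q * T1 h q s + - \<omega> q * T2 h q s)"
      by (intro evop_add evop_mult e m \<omega> evop_Suc[OF e(2)])
    show "evop (Suc (Suc (Suc l))) T2'" unfolding T2'_def
      by (intro evop_add evop_mult e3 m \<omega> evop_Suc[OF evop_Suc[OF e(2)]] evop_Suc[OF e(3)])
    fix h s assume h: "Ck_on (2 * Suc l + 8) UNIV h"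
    then have h': "Ck_on (2 * l + 8) UNIV h" by (rule Ck_on_mono) simp
    \<comment> \<open>The two extra orders available at the next level pay for the passage from
      \<open>h\<close> to \<open>deriv (deriv h)\<close> at the present one.\<close>
    have h'': "Ck_on (2 * l + 8) UNIV (deriv (deriv h))"
      using h by (intro Ck_on_UNIV_deriv(2)) simp
    have t3: "has_D (\<lambda>q. T2 h q s) (\<lambda>q. T3 h q s)" using T3[OF h] by simp
    have n: "has_D (\<lambda>q. - f q) (\<lambda>q. - g q)" if "has_D f g" for f g
      using has_D_mult[OF has_D_const that, of "-1"] by simp
    show "has_D (\<lambda>q. - \<omega> q * T1 h q s) (\<lambda>q. - \<omega>1 q * T1 h q s + - \<omega> q * T2 h q s)"
      by (intro has_D_mult n \<omega> LD h')
    show "has_D (\<lambda>q. - \<omega>1 q * T1 h q s + - \<omega> q * T2 h q s) (\<lambda>q. T2' h q s)"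
      by (rule has_D_cong[OF has_D_add[OF has_D_mult[OF n[OF \<omega>(2)] LD(2)[OF h']] has_D_mult[OF n[OF \<omega>(1)] t3]]])
        (auto simp: T2'_def)
    fix q :: real assume q: "q \<ge> 0"
    let ?\<rho> = "\<lambda>q. (coshh q)\<^sup>2"
    \<comment> \<open>The equation satisfied by \<open>T\<close> is differentiated once; the zeros
      and ones are those left by the product rule.\<close>
    have "has_D (\<lambda>q. (?\<rho> q * (?\<rho> q + - 1)) * T2 h q s + (((1 + \<alpha>) * ?\<rho> q + - \<beta>) * T1 h q s + \<alpha>\<^sup>2 / 4 * T h q s))
       (\<lambda>q. ((1 * (?\<rho> q + - 1) + ?\<rho> q * (1 + 0)) * T2 h q s + (?\<rho> q * (?\<rho> q + - 1)) * T3 h q s)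
          + (((((0 * ?\<rho> q) + (1 + \<alpha>) * 1) + 0) * T1 h q s + ((1 + \<alpha>) * ?\<rho> q + - \<beta>) * T2 h q s)
             + (0 * T h q s + \<alpha>\<^sup>2 / 4 * T1 h q s)))"
      by (intro has_D_add has_D_mult has_D_rho has_D_const LD h' t3)
    then have "has_D (\<lambda>q. T (deriv (deriv h)) q s)
       (\<lambda>q. (2 * ?\<rho> q - 1) * T2 h q s + ?\<rho> q * (?\<rho> q - 1) * T3 h q s + (1 + \<alpha>) * T1 h q s
          + ((1 + \<alpha>) * ?\<rho> q - \<beta>) * T2 h q s + \<alpha>\<^sup>2 / 4 * T1 h q s)"
      by (rule has_D_cong) (simp_all flip: LE[OF h'])
    from has_D_unique[OF this LD(1)[OF h''] q] alg[OF q refl, of "T1 h q s" "T2 h q s" "T3 h q s"]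
    show "?\<rho> q * (?\<rho> q - 1) * T2' h q s + ((1 + \<alpha>') * ?\<rho> q - \<beta>') * (- \<omega>1 q * T1 h q s + - \<omega> q * T2 h q s)
          + \<alpha>'\<^sup>2 / 4 * (- \<omega> q * T1 h q s) = - \<omega> q * T1 (deriv (deriv h)) q s"
      unfolding T2'_def by (simp add: algebra_simps)
  qed
  then show ?thesis by (rule that)
qed

text \<open>D L = (L + (2 \<rho> - 1) D + (1 + \<alpha>)) D, and the constant terms fit because
  \<alpha>^2 / 4 + \<alpha> + 1 = (\<alpha> + 2)^2 / 4.\<close>

lemma wave_level_step_one:
  assumes "wave_level l \<alpha> \<beta> T T1 T2"
  obtains T2' where "wave_level (Suc l) (\<alpha> + 2) (\<beta> + 1) (\<lambda>h q s. - 1 * T1 h q s)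
     (\<lambda>h q s. - 0 * T1 h q s + - 1 * T2 h q s) T2'"
proof (rule wave_level_step[OF assms has_D_const[of 1] has_D_const[of 0], where \<alpha>' = "\<alpha> + 2" and \<beta>' = "\<beta> + 1"])
  show "Ck_on n {0..} (\<lambda>q. 1)" "Ck_on n {0..} (\<lambda>q. 0)" for n by (rule Ck_on_const)+
qed (simp_all add: Ck_on_const field_simps power2_eq_square that)

text \<open>In the variable \<xi> the operator with \<beta> = 1/2 is a quarter of (\<xi>^2 - 1)
  d^2/d\<xi>^2 + (1 + 2 \<alpha>) \<xi> d/d\<xi> + \<alpha>^2, so d/d\<xi> = 2 \<xi> D raises
  \<alpha> by one. For other \<beta> a term (1 - 2 \<beta>) / (4 \<xi>) d/d\<xi> would remain, which
  forces these steps to come first.\<close>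

lemma wave_level_step_coshh:
  assumes "wave_level l \<alpha> (1/2) T T1 T2"
  obtains T2' where "wave_level (Suc l) (\<alpha> + 1) (1/2) (\<lambda>h q s. - coshh q * T1 h q s)
     (\<lambda>h q s. - (1 / (2 * coshh q)) * T1 h q s + - coshh q * T2 h q s) T2'"
proof (rule wave_level_step[OF assms has_D_coshh, where \<alpha>' = "\<alpha> + 1" and \<beta>' = "1/2"])
  have nz: "coshh q \<noteq> 0" for q using coshh_ge_1[of q] by linarith
  let ?f = "\<lambda>q. - (1/4) * inverse (coshh q * (coshh q * coshh q))"
  have "has_D (\<lambda>q. (\<lambda>x. 1 / (2 * x)) (coshh q)) (\<lambda>q. (\<lambda>x. - 1 / (2 * x\<^sup>2)) (coshh q) * (1 / (2 * coshh q)))"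
    by (rule has_D_chain[OF has_D_coshh]) (use nz in \<open>auto intro!: derivative_eq_intros simp: field_simps power2_eq_square\<close>)
  then show "has_D (\<lambda>q. 1 / (2 * coshh q)) ?f"
    by (rule has_D_cong) (auto simp: field_simps power2_eq_square)
  show "Ck_on n {0..} coshh" for n by (rule Ck_on_coshh)
  have "Ck_on n {0..} (\<lambda>q. (1/2) * inverse (coshh q))" for n
    by (intro Ck_on_mult Ck_on_const Ck_on_inverse Ck_on_coshh nz)
  then show "Ck_on n {0..} (\<lambda>q. 1 / (2 * coshh q))" for n by (simp add: field_simps)
  show "Ck_on n {0..} ?f" for n
    using nz by (intro Ck_on_mult Ck_on_const Ck_on_inverse Ck_on_coshh) simp
  fix q \<rho> t1 t2 t3 :: real
  assume "q \<ge> 0" "\<rho> = (coshh q)\<^sup>2"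
  then show "\<rho> * (\<rho> - 1) * (?f q * t1 + 2 * (1 / (2 * coshh q)) * t2 + coshh q * t3)
       + ((1 + (\<alpha> + 1)) * \<rho> - 1/2) * (1 / (2 * coshh q) * t1 + coshh q * t2) + (\<alpha> + 1)\<^sup>2 / 4 * (coshh q * t1)
       = coshh q * ((2 * \<rho> - 1) * t2 + \<rho> * (\<rho> - 1) * t3 + (1 + \<alpha>) * t1 + ((1 + \<alpha>) * \<rho> - 1/2) * t2 + \<alpha>\<^sup>2 / 4 * t1)"
    using nz[of q] by (simp add: field_simps power2_eq_square)
qed

section \<open>Positivity of the velocity at time 0\<close>

text \<open>Finite sums of the functions \<open>a \<xi>\<^sup>-\<^sup>p (c - \<xi>)\<^sub>+\<^sup>n\<close> with \<open>a \<ge> 0\<close> and \<open>\<xi> = cosh (r / 2)\<close>: this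
  class is preserved by \<open>- d / d\<xi>\<close>, which makes the final data of the kernel nonnegative.\<close>

inductive cone :: "real \<Rightarrow> nat \<Rightarrow> (real \<Rightarrow> real) \<Rightarrow> bool" for c where
  base: "a > 0 \<Longrightarrow> M < n \<Longrightarrow> cone c M (\<lambda>q. a * (inverse (coshh q) ^ p * max 0 (c - coshh q) ^ n))"
| sum: "cone c M f \<Longrightarrow> cone c M g \<Longrightarrow> cone c M (\<lambda>q. f q + g q)"

lemma cone_nonneg: "cone c M f \<Longrightarrow> f q \<ge> 0"
proof (induction rule: cone.induct)
  case (base a M n p)
  have "coshh q \<ge> 0" using coshh_ge_1[of q] by linarith
  then show ?case using base by simp
qed simp

lemma cone_pos: "cone c M f \<Longrightarrow> c > 1 \<Longrightarrow> f 0 > 0"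
  by (induction rule: cone.induct) (auto simp: coshh_def)

lemma cone_div: "cone c M f \<Longrightarrow> cone c M (\<lambda>q. inverse (coshh q) * f q)"
proof (induction rule: cone.induct)
  case (base a M n p)
  then show ?case using cone.base[of a M n c "Suc p"] by (simp add: mult_ac)
next
  case (sum M f g)
  then show ?case using cone.sum[OF sum.IH] by (simp add: distrib_left)
qed

text \<open>An exponent of at least 2 makes the kink harmless: at \<open>x = c\<close> the
  difference quotient is bounded by a positive power of \<open>max 0 (c - x)\<close>.\<close>

lemma DERIV_max_power:
  fixes x c :: real
  shows "((\<lambda>x. max 0 (c - x) ^ Suc (Suc n)) has_real_derivative - real (Suc (Suc n)) * max 0 (c - x) ^ Suc n) (at x)"
proof (cases x c rule: linorder_cases)
  case less
  have "((\<lambda>x. (c - x) ^ Suc (Suc n)) has_real_derivative - real (Suc (Suc n)) * max 0 (c - x) ^ Suc n) (at x)"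
  proof -
    have "((\<lambda>x. c - x) has_real_derivative - 1) (at x)" by (auto intro!: derivative_eq_intros)
    from DERIV_power_Suc[OF this, of "Suc n"] show ?thesis
      by (rule DERIV_cong) (use less in \<open>simp add: max_def algebra_simps\<close>)
  qed
  then show ?thesis
    by (rule has_field_derivative_transform_within_open[of _ _ _ "{..<c}"]) (use less in auto)
next
  case greater
  have "((\<lambda>x. 0) has_real_derivative - real (Suc (Suc n)) * max 0 (c - x) ^ Suc n) (at x)"
    using greater by simp
  then show ?thesis
    by (rule has_field_derivative_transform_within_open[of _ _ _ "{c<..}"]) (use greater in auto)
next
  case equal
  have "((\<lambda>y. max 0 (c - y) ^ Suc n * (max 0 (c - y) / (y - c))) \<longlongrightarrow> 0) (at c)"
  proof (rule Lim_null_comparison)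
    show "\<forall>\<^sub>F y in at c. norm (max 0 (c - y) ^ Suc n * (max 0 (c - y) / (y - c))) \<le> max 0 (c - y) ^ Suc n * 1"
    proof (intro always_eventually allI)
      fix y :: real
      have "\<bar>max 0 (c - y) / (y - c)\<bar> \<le> 1" by (auto simp: divide_le_eq_1 max_def)
      from mult_left_mono[OF this, of "max 0 (c - y) ^ Suc n"]
      show "norm (max 0 (c - y) ^ Suc n * (max 0 (c - y) / (y - c))) \<le> max 0 (c - y) ^ Suc n * 1"
        unfolding real_norm_def abs_mult by (simp del: power_Suc)
    qed
    have "((\<lambda>y. max 0 (c - y) ^ Suc n * 1) \<longlongrightarrow> max 0 (c - c) ^ Suc n * 1) (at c)"
      by (intro tendsto_intros)
    then show "((\<lambda>y. max 0 (c - y) ^ Suc n * 1) \<longlongrightarrow> 0) (at c)" by simp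
  qed
  then show ?thesis unfolding equal has_field_derivative_iff by (simp add: mult_ac)
qed

lemma has_D_max_power:
  "has_D (\<lambda>q. max 0 (c - coshh q) ^ Suc (Suc n))
     (\<lambda>q. - (real (Suc (Suc n)) / 2) * (inverse (coshh q) * max 0 (c - coshh q) ^ Suc n))"
proof -
  have eq: "- (K / 2) * (inverse x * Y) = - K * Y * (1 / (2 * x))" for K Y x :: real
    by (cases "x = 0") (simp_all add: field_simps)
  show ?thesis unfolding eq
    using has_D_chain[OF has_D_coshh, of "\<lambda>x. max 0 (c - x) ^ Suc (Suc n)"
        "\<lambda>x. - real (Suc (Suc n)) * max 0 (c - x) ^ Suc n"] DERIV_max_power by blast
qed

lemma has_D_inverse_power:
  "has_D (\<lambda>q. inverse (coshh q) ^ p) (\<lambda>q. - (real p / 2) * inverse (coshh q) ^ Suc (Suc p))"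
proof -
  have nz: "coshh q \<noteq> 0" for q using coshh_ge_1[of q] by linarith
  have "((\<lambda>x. inverse x ^ p) has_real_derivative - real p * inverse x ^ Suc p) (at x)" if "x \<noteq> 0" for x :: real
  proof (cases p)
    case (Suc n)
    show ?thesis unfolding Suc
      by (rule DERIV_cong[OF DERIV_power_Suc[OF DERIV_inverse[OF that]]]) (simp add: algebra_simps)
  qed simp
  then show ?thesis
    by (intro has_D_cong[OF has_D_chain[OF has_D_coshh, of "\<lambda>x. inverse x ^ p" "\<lambda>x. - real p * inverse x ^ Suc p"]])
      (use nz in \<open>auto simp: field_simps\<close>)
qed

text \<open>D is 1 / (2 \<xi>) times d/d\<xi>, and - d/d\<xi> of \<xi>^(-p) (c - \<xi>)^n is a sum
  of two terms of the same shape with coefficients p and n. The index \<open>M\<close> is a budget: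
  a derivative lowers the exponent n by at most one.\<close>

lemma cone_D:
  assumes "cone c M0 f" "M0 = Suc M"
  shows "\<exists>g. cone c M g \<and> has_D f (\<lambda>q. - (inverse (coshh q) * g q))"
  using assms
proof (induction rule: cone.induct)
  case (base a M0 n p)
  define n' where "n' = n - 2"
  have n: "n = Suc (Suc n')" "M < Suc n'" using base by (auto simp: n'_def)
  let ?X = "\<lambda>q. inverse (coshh q)" and ?Y = "\<lambda>q. max 0 (c - coshh q)"
  let ?g2 = "\<lambda>q. (a * (real n / 2)) * (?X q ^ p * ?Y q ^ Suc n')"
  let ?g1 = "\<lambda>q. (a * (real p / 2)) * (?X q ^ Suc p * ?Y q ^ n)"
  have c2: "cone c M ?g2" using base n by (intro cone.base) auto
  have g: "cone c M (\<lambda>q. ?g1 q + ?g2 q)"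
  \<comment> \<open>For \<open>p = 0\<close> the first summand is 0 and not itself in the cone,
    whose coefficients are strictly positive.\<close>
  proof (cases "p = 0")
    case False
    then show ?thesis using base n by (intro cone.sum c2 cone.base) auto
  qed (use c2 in simp)
  have "has_D (\<lambda>q. a * (?X q ^ p * ?Y q ^ n)) (\<lambda>q. - (?X q * (?g1 q + ?g2 q)))"
  proof -
    have "has_D (\<lambda>q. a * (?X q ^ p * ?Y q ^ n))
       (\<lambda>q. 0 * (?X q ^ p * ?Y q ^ n) + a * (- (real p / 2) * ?X q ^ Suc (Suc p) * ?Y q ^ n
           + ?X q ^ p * (- (real n / 2) * (?X q * ?Y q ^ Suc n'))))"
      unfolding n by (intro has_D_mult has_D_const has_D_inverse_power has_D_max_power)
    then show ?thesis by (rule has_D_cong) (simp_all add: algebra_simps)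
  qed
  with g show ?case by blast
next
  case (sum M0 f g)
  then obtain f' g' where "cone c M f'" "has_D f (\<lambda>q. - (inverse (coshh q) * f' q))"
     "cone c M g'" "has_D g (\<lambda>q. - (inverse (coshh q) * g' q))" by blast
  then have "cone c M (\<lambda>q. f' q + g' q)" "has_D (\<lambda>q. f q + g q) (\<lambda>q. - (inverse (coshh q) * (f' q + g' q)))"
    using has_D_cong[OF has_D_add[of f _ g], of "\<lambda>q. - (inverse (coshh q) * f' q)" "\<lambda>q. - (inverse (coshh q) * g' q)"]
    by (auto intro!: cone.sum simp: algebra_simps)
  then show ?case by blast
qed

section \<open>The radial kernel\<close>

text \<open>The invariant of the construction, with \<open>M\<close> the number of steps still
  allowed. Inside the light cone only \<open>T1\<close> is asked to vanish, because the initial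
  \<open>even_avg 0 h\<close> is a constant 2 h(\<epsilon>) or - 2 h(\<epsilon>) there.\<close>

definition kernel_state where
  "kernel_state h \<epsilon> M l \<alpha> \<beta> T \<longleftrightarrow> (\<exists>T1 T2. wave_level l \<alpha> \<beta> T T1 T2 \<and>
     (\<forall>q\<ge>0. T h q 0 = 0) \<and>
     (\<exists>\<phi>. cone (cosh (\<epsilon> / 2)) M \<phi> \<and> (\<forall>q\<ge>0. T (deriv h) q 0 = \<phi> q)) \<and>
     (\<forall>q\<ge>0. \<forall>s. sqrt q > \<bar>s\<bar> + \<epsilon> \<longrightarrow> T h q s = 0) \<and>
     (\<forall>q\<ge>0. \<forall>s. sqrt q < \<bar>s\<bar> - \<epsilon> \<longrightarrow> T1 h q s = 0))"

text \<open>Vanishing at time 0, outside and inside the light cone passes through D by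
  \<open>has_D_const_on\<close>. The velocity goes from \<phi> to \<omega> / \<xi> times a cone
  function, and the last assumption says that this is again in the cone.\<close>

lemma kernel_state_step:
  assumes h: "Ck_on N UNIV h" "2 * l + 9 \<le> N"
    and L: "wave_level l \<alpha> \<beta> T T1 T2"
    and L': "wave_level (Suc l) \<alpha>' \<beta>' (\<lambda>h q s. - \<omega> q * T1 h q s)
     (\<lambda>h q s. - \<omega>1 q * T1 h q s + - \<omega> q * T2 h q s) T2'"
    and zero: "\<And>q. q \<ge> 0 \<Longrightarrow> T h q 0 = 0"
    and cone: "cone (cosh (\<epsilon> / 2)) (Suc M) \<phi>" "\<And>q. q \<ge> 0 \<Longrightarrow> T (deriv h) q 0 = \<phi> q"
    and outside: "\<And>q s. q \<ge> 0 \<Longrightarrow> sqrt q > \<bar>s\<bar> + \<epsilon> \<Longrightarrow> T h q s = 0"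
    and inside: "\<And>q s. q \<ge> 0 \<Longrightarrow> sqrt q < \<bar>s\<bar> - \<epsilon> \<Longrightarrow> T1 h q s = 0"
    and \<omega>: "\<And>g. cone (cosh (\<epsilon> / 2)) M g \<Longrightarrow> cone (cosh (\<epsilon> / 2)) M (\<lambda>q. \<omega> q * inverse (coshh q) * g q)"
  shows "kernel_state h \<epsilon> M (Suc l) \<alpha>' \<beta>' (\<lambda>h q s. - \<omega> q * T1 h q s)"
proof -
  have h8: "Ck_on (2 * l + 8) UNIV h" using Ck_on_mono[OF h(1)] h(2) by simp
  have h8': "Ck_on (2 * l + 8) UNIV (deriv h)"
    using Ck_on_mono[OF h(1), of "Suc (2 * l + 8)"] h(2) by (intro Ck_on_UNIV_deriv(2)) simp
  have D: "has_D (\<lambda>q. T h q s) (\<lambda>q. T1 h q s)" "has_D (\<lambda>q. T1 h q s) (\<lambda>q. T2 h q s)"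
    "has_D (\<lambda>q. T (deriv h) q s) (\<lambda>q. T1 (deriv h) q s)" for s
    using L h8 h8' unfolding wave_level_def by auto
  have 1: "T1 h q 0 = 0" if "q \<ge> 0" for q
    by (rule has_D_const_on[OF D(1) open_UNIV _ that]) (use zero in auto)
  have 2: "T1 h q s = 0" if "q \<ge> 0" "sqrt q > \<bar>s\<bar> + \<epsilon>" for q s
    by (rule has_D_const_on[OF D(1), of "{q. sqrt q > \<bar>s\<bar> + \<epsilon>}"])
      (use outside that in \<open>auto intro!: open_Collect_less continuous_intros\<close>)
  have 3: "T2 h q s = 0" if "q \<ge> 0" "sqrt q < \<bar>s\<bar> - \<epsilon>" for q s
    by (rule has_D_const_on[OF D(2), of "{q. sqrt q < \<bar>s\<bar> - \<epsilon>}"])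
      (use inside that in \<open>auto intro!: open_Collect_less continuous_intros\<close>)
  obtain g where g: "cone (cosh (\<epsilon> / 2)) M g" "has_D \<phi> (\<lambda>q. - (inverse (coshh q) * g q))"
    using cone_D[OF cone(1) refl] by blast
  have "T1 (deriv h) q 0 = - (inverse (coshh q) * g q)" if "q \<ge> 0" for q
    by (rule has_D_unique[OF _ g(2) that], rule has_D_cong[OF D(3)[of 0]]) (use cone(2) in auto)
  then have 4: "- \<omega> q * T1 (deriv h) q 0 = \<omega> q * inverse (coshh q) * g q" if "q \<ge> 0" for q
    using that by simp
  show ?thesis unfolding kernel_state_def
    by (rule exI[of _ "\<lambda>h q s. - \<omega>1 q * T1 h q s + - \<omega> q * T2 h q s"], rule exI[of _ T2'])
      (use L' 1 2 3 4 \<omega>[OF g(1)] inside in auto)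
qed

lemma kernel_state_step_coshh:
  assumes "Ck_on N UNIV h" "2 * l + 9 \<le> N" "kernel_state h \<epsilon> (Suc M) l \<alpha> (1/2) T"
  shows "\<exists>T. kernel_state h \<epsilon> M (Suc l) (\<alpha> + 1) (1/2) T"
proof -
  from assms(3) obtain T1 T2 \<phi> where *: "wave_level l \<alpha> (1/2) T T1 T2" "\<forall>q\<ge>0. T h q 0 = 0"
     "cone (cosh (\<epsilon> / 2)) (Suc M) \<phi>" "\<forall>q\<ge>0. T (deriv h) q 0 = \<phi> q"
     "\<forall>q\<ge>0. \<forall>s. sqrt q > \<bar>s\<bar> + \<epsilon> \<longrightarrow> T h q s = 0"
     "\<forall>q\<ge>0. \<forall>s. sqrt q < \<bar>s\<bar> - \<epsilon> \<longrightarrow> T1 h q s = 0"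
    unfolding kernel_state_def by blast
  obtain T2' where L': "wave_level (Suc l) (\<alpha> + 1) (1/2) (\<lambda>h q s. - coshh q * T1 h q s)
     (\<lambda>h q s. - (1 / (2 * coshh q)) * T1 h q s + - coshh q * T2 h q s) T2'"
    using wave_level_step_coshh[OF *(1)] by blast
  have "coshh q * inverse (coshh q) = 1" for q using coshh_ge_1[of q] by simp
  then have "kernel_state h \<epsilon> M (Suc l) (\<alpha> + 1) (1/2) (\<lambda>h q s. - coshh q * T1 h q s)"
    by (intro kernel_state_step[OF assms(1,2) *(1) L' _ *(3)]) (use * in auto)
  then show ?thesis by blast
qed

text \<open>The new operator is \<open>- T1\<close>, so the vanishing of \<open>T1\<close> inside
  the light cone becomes vanishing of the kernel itself. One such step is enough for a sharp
  shell.\<close>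

lemma kernel_state_step_one:
  assumes "Ck_on N UNIV h" "2 * l + 9 \<le> N" "kernel_state h \<epsilon> (Suc M) l \<alpha> \<beta> T"
  shows "\<exists>T. kernel_state h \<epsilon> M (Suc l) (\<alpha> + 2) (\<beta> + 1) T \<and>
     (\<forall>q\<ge>0. \<forall>s. sqrt q < \<bar>s\<bar> - \<epsilon> \<longrightarrow> T h q s = 0)"
proof -
  from assms(3) obtain T1 T2 \<phi> where *: "wave_level l \<alpha> \<beta> T T1 T2" "\<forall>q\<ge>0. T h q 0 = 0"
     "cone (cosh (\<epsilon> / 2)) (Suc M) \<phi>" "\<forall>q\<ge>0. T (deriv h) q 0 = \<phi> q"
     "\<forall>q\<ge>0. \<forall>s. sqrt q > \<bar>s\<bar> + \<epsilon> \<longrightarrow> T h q s = 0"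
     "\<forall>q\<ge>0. \<forall>s. sqrt q < \<bar>s\<bar> - \<epsilon> \<longrightarrow> T1 h q s = 0"
    unfolding kernel_state_def by blast
  obtain T2' where L': "wave_level (Suc l) (\<alpha> + 2) (\<beta> + 1) (\<lambda>h q s. - 1 * T1 h q s)
     (\<lambda>h q s. - 0 * T1 h q s + - 1 * T2 h q s) T2'"
    using wave_level_step_one[OF *(1)] by blast
  have "kernel_state h \<epsilon> M (Suc l) (\<alpha> + 2) (\<beta> + 1) (\<lambda>h q s. - 1 * T1 h q s)"
    by (intro kernel_state_step[OF assms(1,2) *(1) L' _ *(3)]) (use * in \<open>auto intro: cone_div\<close>)
  then show ?thesis using *(6) by (intro exI[of _ "\<lambda>h q s. - 1 * T1 h q s"]) auto
qed

lemma Ck_on_bump: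
  "Ck_on n UNIV (\<lambda>x. max 0 (c - cosh ((1/2) * x)) ^ Suc n)"
proof (induction n)
  case 0
  show ?case by (auto intro!: continuous_intros simp: Ck_on.simps)
next
  case (Suc n)
  have d: "((\<lambda>x. max 0 (c - cosh ((1/2) * x)) ^ Suc (Suc n)) has_real_derivative
      (- (real (Suc (Suc n)) / 2)) * (max 0 (c - cosh ((1/2) * x)) ^ Suc n * sinh ((1/2) * x))) (at x)" for x
  proof -
    have "((\<lambda>x. cosh ((1/2) * x)) has_real_derivative sinh ((1/2) * x) * (1/2)) (at x)"
      by (auto intro!: derivative_eq_intros)
    from DERIV_chain2[OF DERIV_max_power this]
    show ?thesis by (rule DERIV_cong) (simp add: algebra_simps)
  qed
  have "Ck_on n UNIV (\<lambda>x. (- (real (Suc (Suc n)) / 2)) * (max 0 (c - cosh ((1/2) * x)) ^ Suc n * sinh ((1/2) * x)))"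
    by (intro Ck_on_mult Ck_on_const Suc.IH Ck_on_sinh)
  then show ?case by (rule Ck_on_SucI[rotated]) (use d in auto)
qed

text \<open>Antisymmetrizing a primitive of the even bump makes it odd without changing its
  derivative. The bump is written in cosh(x/2) so that the velocity at time 0 is a truncated power
  in \<xi>, as the cone requires.\<close>

lemma bump_primitive:
  obtains h where "Ck_on (Suc n) UNIV h" "\<And>s. h (- s) = - h s"
    "deriv h = (\<lambda>x. max 0 (cosh (\<epsilon> / 2) - cosh ((1/2) * x)) ^ Suc n)" "\<And>s. \<epsilon> > 0 \<Longrightarrow> s \<ge> \<epsilon> \<Longrightarrow> h s = h \<epsilon>"
proof -
  define \<psi> :: "real \<Rightarrow> real" where "\<psi> x = max 0 (cosh (\<epsilon> / 2) - cosh ((1/2) * x)) ^ Suc n" for x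
  have ck: "Ck_on n UNIV \<psi>" unfolding \<psi>_def[abs_def] by (rule Ck_on_bump)
  have "\<exists>F. \<forall>x::real. - \<infinity> < ereal x \<longrightarrow> ereal x < \<infinity> \<longrightarrow> (F has_vector_derivative \<psi> x) (at x)"
    using Ck_on_continuous[OF ck] by (intro einterval_antiderivative) (auto simp: continuous_on_eq_continuous_at)
  then obtain F where F: "\<And>x. (F has_real_derivative \<psi> x) (at x)"
    by (auto simp: has_real_derivative_iff_has_vector_derivative)
  define h where "h s = (F s - F (- s)) / 2" for s
  have ev: "\<psi> (- x) = \<psi> x" for x by (simp add: \<psi>_def)
  have h': "(h has_real_derivative \<psi> x) (at x)" for x
  proof -
    have "((\<lambda>s. F (- s)) has_real_derivative \<psi> (- x) * - 1) (at x)"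
      by (rule DERIV_chain2[OF F]) (auto intro!: derivative_eq_intros)
    from DERIV_cdivide[OF DERIV_diff[OF F this], of 2] show ?thesis
      by (simp add: h_def[abs_def] ev)
  qed
  show ?thesis
  proof
    show "Ck_on (Suc n) UNIV h" using h' ck by (intro Ck_on_SucI) auto
    show "h (- s) = - h s" for s by (simp add: h_def field_simps)
    show "deriv h = (\<lambda>x. max 0 (cosh (\<epsilon> / 2) - cosh ((1/2) * x)) ^ Suc n)"
      using h' by (auto intro!: DERIV_imp_deriv simp: \<psi>_def)
    fix s assume s: "\<epsilon> > 0" "s \<ge> \<epsilon>"
    have "\<psi> x = 0" if "x \<ge> \<epsilon>" for x
      using that s cosh_real_nonneg_le_iff[of "\<epsilon> / 2" "(1/2) * x"] by (auto simp: \<psi>_def)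
    then have "\<exists>a. \<forall>x\<in>{\<epsilon>..}. h x = a"
      by (intro has_field_derivative_zero_constant)
        (auto intro: has_field_derivative_at_within[OF h'[THEN DERIV_cong]])
    then obtain a where "\<And>x. x \<ge> \<epsilon> \<Longrightarrow> h x = a" by auto
    then show "h s = h \<epsilon>" using s by simp
  qed
qed

text \<open>Outside the light cone s + r and s - r lie on opposite sides of
  [-\<epsilon>, \<epsilon>] and the values of the odd \<open>h\<close> cancel. Inside they lie on
  the same side and the sum is constant in \<open>q\<close>. At time 0 the velocity is twice the
  bump at r.\<close>

lemma kernel_state_base:
  assumes "\<epsilon> > 0" "M \<le> n" "n \<ge> 8"
    and h: "Ck_on (Suc n) UNIV h" "\<And>s. h (- s) = - h s"
    "deriv h = (\<lambda>x. max 0 (cosh (\<epsilon> / 2) - cosh ((1/2) * x)) ^ Suc n)" "\<And>s. \<epsilon> > 0 \<Longrightarrow> s \<ge> \<epsilon> \<Longrightarrow> h s = h \<epsilon>"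
  shows "kernel_state h \<epsilon> M 0 0 (1/2) (even_avg 0)"
proof -
  obtain T1 T2 where L: "wave_level 0 0 (1/2) (even_avg 0) T1 T2" using wave_level_base .
  have D: "has_D (\<lambda>q. even_avg 0 h q s) (\<lambda>q. T1 h q s)" for s
    using L Ck_on_mono[OF h(1), of 8] assms(3) unfolding wave_level_def by auto
  have neg: "h s = - h \<epsilon>" if "s \<le> - \<epsilon>" for s
    using h(2)[of "- s"] h(4)[of "- s"] that assms(1) by simp
  let ?\<phi> = "\<lambda>q. 2 * (inverse (coshh q) ^ 0 * max 0 (cosh (\<epsilon> / 2) - coshh q) ^ Suc n)"
  have "cone (cosh (\<epsilon> / 2)) M ?\<phi>" using assms(2) by (intro cone.base) auto
  moreover have "even_avg 0 (deriv h) q 0 = ?\<phi> q" for q by (simp add: h(3) coshh_def)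
  moreover have "even_avg 0 h q 0 = 0" for q using h(2)[of "sqrt q"] by simp
  moreover have "even_avg 0 h q s = 0" if "sqrt q > \<bar>s\<bar> + \<epsilon>" for q s
    using h(4)[of "s + sqrt q"] neg[of "s - sqrt q"] that assms(1) by (auto simp: abs_if split: if_splits)
  moreover have "T1 h q s = 0" if "q \<ge> 0" "sqrt q < \<bar>s\<bar> - \<epsilon>" for q s
  proof (rule has_D_const_on[OF D, of "{q. sqrt q < \<bar>s\<bar> - \<epsilon>}", OF _ _ that(1)])
    show "even_avg 0 h x s = (if s > 0 then 2 * h \<epsilon> else - 2 * h \<epsilon>)"
      if "x \<in> {q. sqrt q < \<bar>s\<bar> - \<epsilon>}" "x \<ge> 0" for x
    proof -
      have x: "sqrt x \<ge> 0" "sqrt x < \<bar>s\<bar> - \<epsilon>" using that by auto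
      show ?thesis
      proof (cases "s > 0")
        case True
        then have "s + sqrt x \<ge> \<epsilon>" "s - sqrt x \<ge> \<epsilon>" using x by linarith+
        then show ?thesis using True h(4)[of "s + sqrt x"] h(4)[of "s - sqrt x"] assms(1) by simp
      next
        case False
        then have "s + sqrt x \<le> - \<epsilon>" "s - sqrt x \<le> - \<epsilon>" using x by linarith+
        then show ?thesis using False neg[of "s + sqrt x"] neg[of "s - sqrt x"] by simp
      qed
    qed
  qed (use that in \<open>auto intro!: open_Collect_less continuous_intros\<close>)
  ultimately show ?thesis unfolding kernel_state_def using L by blast
qed

text \<open>First \<open>a\<close> steps with d/d\<xi>, then \<open>b\<close> steps with D; \<alpha>
  grows to a + 2 b and \<beta> to 1/2 + b. The cone budget starts at a + b and every step uses one
  unit.\<close>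

lemma kernel_state_exists:
  assumes "\<epsilon> > 0" "b \<ge> 1"
  obtains h N T where "Ck_on N UNIV h" "2 * (a + b) + 9 \<le> N"
    "kernel_state h \<epsilon> 0 (a + b) (real a + 2 * real b) (1/2 + real b) T"
    "\<And>q s. q \<ge> 0 \<Longrightarrow> sqrt q < \<bar>s\<bar> - \<epsilon> \<Longrightarrow> T h q s = 0"
proof -
  \<comment> \<open>Large enough for the 2 (a + b) + 9 derivatives asked of \<open>h\<close> and for
    the cone budget.\<close>
  define n where "n = 2 * (a + b) + 20"
  obtain h where h: "Ck_on (Suc n) UNIV h" "\<And>s. h (- s) = - h s"
    "deriv h = (\<lambda>x. max 0 (cosh (\<epsilon> / 2) - cosh ((1/2) * x)) ^ Suc n)" "\<And>s. \<epsilon> > 0 \<Longrightarrow> s \<ge> \<epsilon> \<Longrightarrow> h s = h \<epsilon>"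
    using bump_primitive by blast
  have A: "\<exists>T. kernel_state h \<epsilon> M i (real i) (1/2) T" if "i \<le> a" "M + i \<le> a + b" for M i
    using that
  proof (induction i arbitrary: M)
    case 0
    then show ?case using kernel_state_base[OF assms(1) _ _ h, of M] by (auto simp: n_def)
  next
    case (Suc i)
    have "\<exists>T. kernel_state h \<epsilon> (Suc M) i (real i) (1/2) T"
      using Suc.prems by (intro Suc.IH) auto
    then obtain T where T: "kernel_state h \<epsilon> (Suc M) i (real i) (1/2) T" by blast
    from kernel_state_step_coshh[OF h(1) _ T] Suc.prems show ?case by (auto simp: n_def add.commute)
  qed
  have B: "\<exists>T. kernel_state h \<epsilon> M (a + i) (real a + 2 * real i) (1/2 + real i) T \<and>
      (i \<ge> 1 \<longrightarrow> (\<forall>q\<ge>0. \<forall>s. sqrt q < \<bar>s\<bar> - \<epsilon> \<longrightarrow> T h q s = 0))" if "M + i \<le> b" for M i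
    using that
  proof (induction i arbitrary: M)
    case 0
    then show ?case using A[of a M] by auto
  next
    case (Suc i)
    have "\<exists>T. kernel_state h \<epsilon> (Suc M) (a + i) (real a + 2 * real i) (1/2 + real i) T"
      using Suc.prems Suc.IH[of "Suc M"] by auto
    then obtain T where T: "kernel_state h \<epsilon> (Suc M) (a + i) (real a + 2 * real i) (1/2 + real i) T" by blast
    from kernel_state_step_one[OF h(1) _ T] Suc.prems show ?case by (auto simp: n_def algebra_simps)
  qed
  from B[of 0 b] assms(2) obtain T where "kernel_state h \<epsilon> 0 (a + b) (real a + 2 * real b) (1/2 + real b) T"
      "\<And>q s. q \<ge> 0 \<Longrightarrow> sqrt q < \<bar>s\<bar> - \<epsilon> \<Longrightarrow> T h q s = 0" by auto
  with h(1) show ?thesis by (intro that[of "Suc n" h T]) (auto simp: n_def)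
qed

section \<open>The kernel as a function of \<rho>\<close>

definition sqdist :: "real \<Rightarrow> real" where "sqdist \<rho> = (arcosh (2 * \<rho> - 1))\<^sup>2"

lemma sqdist_nonneg: "sqdist \<rho> \<ge> 0" by (simp add: sqdist_def)

lemma sqrt_sqdist: "\<rho> \<ge> 1 \<Longrightarrow> sqrt (sqdist \<rho>) = arcosh (2 * \<rho> - 1)"
  by (simp add: sqdist_def)

lemma coshh_sqdist: "\<rho> \<ge> 1 \<Longrightarrow> (coshh (sqdist \<rho>))\<^sup>2 = \<rho>"
  by (simp add: coshh_sq sqrt_sqdist)

lemma continuous_on_sqdist: "continuous_on {1..} sqdist"
  unfolding sqdist_def[abs_def] by (intro continuous_intros) auto

text \<open>\<open>arcosh\<close> has infinite slope at 1, but its square does not: dq/d\<rho> = 4 /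
  \<open>sinhc\<close> stays finite.\<close>

lemma sqdist_deriv:
  assumes "\<rho> \<ge> 1"
  shows "(sqdist has_real_derivative 4 / sinhc (sqdist \<rho>)) (at \<rho> within {1..})"
proof (rule DERIV_closed_right[OF continuous_on_sqdist _ _ assms])
  have s0: "sinhc (sqdist x) \<noteq> 0" for x using sinhc_pos[OF sqdist_nonneg, of x] by simp
  have "continuous_on {1..} (\<lambda>x. sinhc (sqdist x))"
    by (rule continuous_on_compose2[OF Ck_on_continuous[OF Ck_on_sinhc[of 0]] continuous_on_sqdist])
      (auto simp: sqdist_nonneg)
  then show "continuous_on {1..} (\<lambda>x. 4 / sinhc (sqdist x))"
    using s0 by (intro continuous_intros) auto
  fix x :: real assume x: "x > 1"
  define r where "r = arcosh (2 * x - 1)"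
  have r: "r > 0" using x by (simp add: r_def)
  have "sinhc (sqdist x) * r = sinh r"
    using sinhc_mult_sqrt[OF sqdist_nonneg, of x] x by (simp add: sqrt_sqdist r_def)
  moreover have "sinh r = sqrt ((2 * x - 1)\<^sup>2 - 1)" using x by (simp add: r_def sinh_arcosh_real)
  ultimately have eq: "sqrt ((2 * x - 1)\<^sup>2 - 1) = sinhc (sqdist x) * r" by simp
  have "((\<lambda>x. 2 * x - 1) has_real_derivative 2) (at x)" by (auto intro!: derivative_eq_intros)
  from DERIV_chain2[OF arcosh_real_has_field_derivative this]
  have d: "((\<lambda>x. arcosh (2 * x - 1)) has_real_derivative 1 / sqrt ((2 * x - 1)\<^sup>2 - 1) * 2) (at x)"
    using x by simp
  have "(sqdist has_real_derivative 2 * r * (1 / sqrt ((2 * x - 1)\<^sup>2 - 1) * 2)) (at x)"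
    unfolding sqdist_def[abs_def] by (rule DERIV_cong[OF DERIV_power[OF d]]) (simp add: r_def)
  moreover have "2 * r * (1 / sqrt ((2 * x - 1)\<^sup>2 - 1) * 2) = 4 / sinhc (sqdist x)"
    unfolding eq using r s0[of x] by (simp add: field_simps)
  ultimately show "(sqdist has_real_derivative 4 / sinhc (sqdist x)) (at x)" by simp
qed

lemma has_D_sqdist:
  assumes "has_D F G" "\<rho> \<ge> 1"
  shows "((\<lambda>\<rho>. F (sqdist \<rho>)) has_real_derivative G (sqdist \<rho>)) (at \<rho> within {1..})"
proof -
  have "(F has_real_derivative sinhc (sqdist \<rho>) / 4 * G (sqdist \<rho>)) (at (sqdist \<rho>) within {0..})"
    using assms(1) sqdist_nonneg unfolding has_D_def by blast
  then have "(F has_real_derivative sinhc (sqdist \<rho>) / 4 * G (sqdist \<rho>)) (at (sqdist \<rho>) within sqdist ` {1..})"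
    by (rule DERIV_subset) (auto simp: sqdist_nonneg)
  from DERIV_image_chain[OF this sqdist_deriv[OF assms(2)]] show ?thesis
    using sinhc_pos[OF sqdist_nonneg, of \<rho>] by (simp add: o_def)
qed

text \<open>For m = 2 a and k = 2 b the parameters reached are \<alpha> = a + 2 b = \<open>Q\<close>
  and \<beta> = 1/2 + b = (k + 1) / 2, those of the shifted Laplacian. Time derivatives are obtained
  by applying the same operator to the derivatives of \<open>h\<close>.\<close>

lemma radial_kernel:
  fixes m k :: nat and \<epsilon> Q :: real
  assumes "even m" "even k" "k \<ge> 1" "\<epsilon> > 0" and Q: "Q = real m / 2 + real k"
  obtains W W1 W2 Wt Wtt :: "real \<Rightarrow> real \<Rightarrow> real" where
    "continuous_on ({1..} \<times> UNIV) (\<lambda>(\<rho>, s). W \<rho> s)"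
    "continuous_on ({1..} \<times> UNIV) (\<lambda>(\<rho>, s). W1 \<rho> s)"
    "continuous_on ({1..} \<times> UNIV) (\<lambda>(\<rho>, s). W2 \<rho> s)"
    "continuous_on ({1..} \<times> UNIV) (\<lambda>(\<rho>, s). Wt \<rho> s)"
    "continuous_on ({1..} \<times> UNIV) (\<lambda>(\<rho>, s). Wtt \<rho> s)"
    "\<And>\<rho> s. \<rho> \<ge> 1 \<Longrightarrow> ((\<lambda>\<rho>. W \<rho> s) has_real_derivative W1 \<rho> s) (at \<rho> within {1..})"
    "\<And>\<rho> s. \<rho> \<ge> 1 \<Longrightarrow> ((\<lambda>\<rho>. W1 \<rho> s) has_real_derivative W2 \<rho> s) (at \<rho> within {1..})"
    "\<And>\<rho> s. \<rho> \<ge> 1 \<Longrightarrow> ((\<lambda>s. W \<rho> s) has_real_derivative Wt \<rho> s) (at s)"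
    "\<And>\<rho> s. \<rho> \<ge> 1 \<Longrightarrow> ((\<lambda>s. Wt \<rho> s) has_real_derivative Wtt \<rho> s) (at s)"
    "\<And>\<rho> s. \<rho> \<ge> 1 \<Longrightarrow> \<rho> * (\<rho> - 1) * W2 \<rho> s + ((1 + Q) * \<rho> - (real k + 1) / 2) * W1 \<rho> s
        + Q\<^sup>2 / 4 * W \<rho> s = Wtt \<rho> s"
    "\<And>\<rho>. \<rho> \<ge> 1 \<Longrightarrow> W \<rho> 0 = 0" "\<And>\<rho>. \<rho> \<ge> 1 \<Longrightarrow> Wt \<rho> 0 \<ge> 0" "Wt 1 0 > 0"
    "\<And>\<rho> s. \<rho> \<ge> 1 \<Longrightarrow> \<bar>\<bar>s\<bar> - arcosh (2 * \<rho> - 1)\<bar> > \<epsilon> \<Longrightarrow> W \<rho> s = 0"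
    "\<And>\<rho> s. \<rho> \<ge> 1 \<Longrightarrow> \<bar>\<bar>s\<bar> - arcosh (2 * \<rho> - 1)\<bar> > \<epsilon> \<Longrightarrow> Wt \<rho> s = 0"
proof -
  obtain a b where ab: "m = 2 * a" "k = 2 * b" using assms(1,2) by (auto elim!: evenE)
  define l where "l = a + b"
  have "b \<ge> 1" using ab assms(3) by simp
  have Q': "Q = real a + 2 * real b" "(real k + 1) / 2 = 1/2 + real b" using ab Q by (simp_all add: field_simps)
  obtain h N T where h: "Ck_on N UNIV h" "2 * l + 9 \<le> N"
    and ks: "kernel_state h \<epsilon> 0 l Q (1/2 + real b) T"
    and inside: "\<And>q s. q \<ge> 0 \<Longrightarrow> sqrt q < \<bar>s\<bar> - \<epsilon> \<Longrightarrow> T h q s = 0"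
    unfolding l_def Q'(1) by (rule kernel_state_exists[OF assms(4) \<open>b \<ge> 1\<close>, of a]) blast
  from ks obtain T1 T2 \<phi> where L: "wave_level l Q (1/2 + real b) T T1 T2" and zero: "\<forall>q\<ge>0. T h q 0 = 0"
     and cone: "cone (cosh (\<epsilon> / 2)) 0 \<phi>" "\<forall>q\<ge>0. T (deriv h) q 0 = \<phi> q"
     and outside: "\<forall>q\<ge>0. \<forall>s. sqrt q > \<bar>s\<bar> + \<epsilon> \<longrightarrow> T h q s = 0"
    unfolding kernel_state_def by blast
  have h9: "Ck_on (Suc (2 * l + 8)) UNIV h" using Ck_on_mono[OF h(1)] h(2) by simp
  have h8: "Ck_on (2 * l + 8) UNIV h" by (rule Ck_on_SucD[OF h9])
  have h': "Ck_on (Suc (2 * l + 7)) UNIV (deriv h)" using Ck_on_UNIV_deriv(2)[OF h9] by (simp add: add.commute)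
  have h'': "Ck_on (2 * l + 7) UNIV (deriv (deriv h))" by (rule Ck_on_UNIV_deriv(2)[OF h'])
  have e: "evop l T" "evop (Suc l) T1" "evop (Suc (Suc l)) T2"
    and D: "\<And>s. has_D (\<lambda>q. T h q s) (\<lambda>q. T1 h q s)" "\<And>s. has_D (\<lambda>q. T1 h q s) (\<lambda>q. T2 h q s)"
    and E: "\<And>q s. q \<ge> 0 \<Longrightarrow> (coshh q)\<^sup>2 * ((coshh q)\<^sup>2 - 1) * T2 h q s
        + ((1 + Q) * (coshh q)\<^sup>2 - (1/2 + real b)) * T1 h q s + Q\<^sup>2 / 4 * T h q s = T (deriv (deriv h)) q s"
    using L h8 unfolding wave_level_def by auto
  have c: "continuous_on ({1..} \<times> UNIV) (\<lambda>(\<rho>, s). F (sqdist \<rho>) s)"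
    if "continuous_on ({0..} \<times> UNIV) (\<lambda>(q, s). F q s)" for F :: "real \<Rightarrow> real \<Rightarrow> real"
  proof -
    have "continuous_on ({1..} \<times> UNIV) (\<lambda>p::real \<times> real. sqdist (fst p))"
      by (rule continuous_on_compose2[OF continuous_on_sqdist]) (auto intro!: continuous_intros)
    then have "continuous_on ({1..} \<times> UNIV) (\<lambda>p::real \<times> real. (sqdist (fst p), snd p))"
      by (intro continuous_intros)
    from continuous_on_compose2[OF that this] show ?thesis
      by (simp add: split_beta image_subset_iff sqdist_nonneg)
  qed
  have dt: "((\<lambda>s. T h (sqdist \<rho>) s) has_real_derivative T (deriv h) (sqdist \<rho>) s) (at s)" for \<rho> s
    by (rule evop_deriv_s[OF e(1) h8]) simp
  have supp: "T h (sqdist \<rho>) s = 0" if "\<rho> \<ge> 1" "\<bar>\<bar>s\<bar> - arcosh (2 * \<rho> - 1)\<bar> > \<epsilon>" for \<rho> s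
    using that inside[OF sqdist_nonneg, of \<rho> s] outside sqdist_nonneg[of \<rho>]
    by (auto simp: sqrt_sqdist abs_if split: if_splits)
  show ?thesis
  proof
    show "continuous_on ({1..} \<times> UNIV) (\<lambda>(\<rho>, s). T h (sqdist \<rho>) s)"
      "continuous_on ({1..} \<times> UNIV) (\<lambda>(\<rho>, s). T1 h (sqdist \<rho>) s)"
      "continuous_on ({1..} \<times> UNIV) (\<lambda>(\<rho>, s). T2 h (sqdist \<rho>) s)"
      by (intro c evop_continuous[OF e(1) h8] evop_continuous[OF e(2) h8] evop_continuous[OF e(3) h8]; simp)+
    show "continuous_on ({1..} \<times> UNIV) (\<lambda>(\<rho>, s). T (deriv h) (sqdist \<rho>) s)"
      "continuous_on ({1..} \<times> UNIV) (\<lambda>(\<rho>, s). T (deriv (deriv h)) (sqdist \<rho>) s)"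
      by (intro c evop_continuous[OF e(1) h'] evop_continuous[OF e(1) h'']; simp)+
    fix \<rho> :: real assume \<rho>: "\<rho> \<ge> 1"
    fix s
    show "((\<lambda>\<rho>. T h (sqdist \<rho>) s) has_real_derivative T1 h (sqdist \<rho>) s) (at \<rho> within {1..})"
      "((\<lambda>\<rho>. T1 h (sqdist \<rho>) s) has_real_derivative T2 h (sqdist \<rho>) s) (at \<rho> within {1..})"
      by (rule has_D_sqdist[OF D(1) \<rho>], rule has_D_sqdist[OF D(2) \<rho>])
    show "((\<lambda>s. T h (sqdist \<rho>) s) has_real_derivative T (deriv h) (sqdist \<rho>) s) (at s)" by (rule dt)
    show "((\<lambda>s. T (deriv h) (sqdist \<rho>) s) has_real_derivative T (deriv (deriv h)) (sqdist \<rho>) s) (at s)"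
      by (rule evop_deriv_s[OF e(1) h']) simp
    show "\<rho> * (\<rho> - 1) * T2 h (sqdist \<rho>) s + ((1 + Q) * \<rho> - (real k + 1) / 2) * T1 h (sqdist \<rho>) s
        + Q\<^sup>2 / 4 * T h (sqdist \<rho>) s = T (deriv (deriv h)) (sqdist \<rho>) s"
      using E[OF sqdist_nonneg, of \<rho> s] unfolding coshh_sqdist[OF \<rho>] Q'(2) .
    show "T h (sqdist \<rho>) 0 = 0" "T (deriv h) (sqdist \<rho>) 0 \<ge> 0"
      using zero cone cone_nonneg[OF cone(1)] sqdist_nonneg by auto
    assume s: "\<bar>\<bar>s\<bar> - arcosh (2 * \<rho> - 1)\<bar> > \<epsilon>"
    show "T h (sqdist \<rho>) s = 0" by (rule supp[OF \<rho> s])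
    \<comment> \<open>For fixed \<rho> the kernel vanishes at all times near \<open>s\<close>, hence
      so does its time derivative.\<close>
    have "((\<lambda>s. 0) has_real_derivative T (deriv h) (sqdist \<rho>) s) (at s)"
      by (rule has_field_derivative_transform_within_open[OF dt, of "{s. \<bar>\<bar>s\<bar> - arcosh (2 * \<rho> - 1)\<bar> > \<epsilon>}"])
        (use s supp[OF \<rho>] in \<open>auto intro!: open_Collect_less continuous_intros\<close>)
    then show "T (deriv h) (sqdist \<rho>) s = 0" using DERIV_unique DERIV_const by blast
  next
    have "cosh (\<epsilon> / 2) > 1" using assms(4) cosh_real_nonneg_less_iff[of 0 "\<epsilon> / 2"] by simp
    then show "T (deriv h) (sqdist 1) 0 > 0"
      using cone cone_pos[OF cone(1)] by (simp add: sqdist_def)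
  qed
qed

section \<open>Differential calculus and the divergence theorem\<close>

lemma C_k_SucI:
  assumes "\<And>x. (f has_derivative f' x) (at x)" "\<And>v. C_k j (\<lambda>x. f' x v)"
  shows "C_k (Suc j) f"
proof -
  have "frechet_derivative f (at x) = f' x" for x using frechet_derivative_at[OF assms(1)] by simp
  then show ?thesis using assms by (auto simp: differentiable_def)
qed

lemma C_k_has_derivative: "C_k (Suc j) f \<Longrightarrow> (f has_derivative frechet_derivative f (at x)) (at x)"
  by (simp add: frechet_derivative_works)

lemma C_k_frechet: "C_k (Suc j) f \<Longrightarrow> C_k j (\<lambda>x. frechet_derivative f (at x) v)"
  by simp

lemma C_k_continuous: "C_k j f \<Longrightarrow> continuous_on S f"
proof (cases j)
  case (Suc i)
  assume "C_k j f"
  then have "f differentiable_on S" using Suc by (auto simp: differentiable_on_def intro: differentiable_at_withinI)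
  then show ?thesis by (rule differentiable_imp_continuous_on)
qed (auto intro: continuous_on_subset)

lemma C_k_SucD: "C_k (Suc j) f \<Longrightarrow> C_k j f"
proof (induction j arbitrary: f)
  case 0
  then show ?case using C_k_continuous[OF 0] by simp
qed auto

lemma C_k_const: "C_k j (\<lambda>x. a)"
proof (induction j arbitrary: a)
  case (Suc j)
  then show ?case by (intro C_k_SucI[of _ "\<lambda>x v. 0"]) auto
qed simp

lemma C_k_linear: "bounded_linear f \<Longrightarrow> C_k j f"
proof (cases j)
  case (Suc i)
  assume "bounded_linear f"
  then show ?thesis unfolding Suc
    by (intro C_k_SucI[of _ "\<lambda>x. f"] C_k_const bounded_linear_imp_has_derivative)
qed (auto intro: linear_continuous_on)

lemma C_k_add: "C_k j f \<Longrightarrow> C_k j g \<Longrightarrow> C_k j (\<lambda>x. f x + g x)"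
proof (induction j arbitrary: f g)
  case (Suc j)
  show ?case
    by (rule C_k_SucI[where f' = "\<lambda>x v. frechet_derivative f (at x) v + frechet_derivative g (at x) v"])
      (intro has_derivative_add C_k_has_derivative[OF Suc.prems(1)] C_k_has_derivative[OF Suc.prems(2)]
        Suc.IH C_k_frechet Suc.prems)+
qed (auto intro: continuous_intros)

lemma (in bounded_bilinear) C_k_prod: "C_k j f \<Longrightarrow> C_k j g \<Longrightarrow> C_k j (\<lambda>x. prod (f x) (g x))"
proof (induction j arbitrary: f g)
  case (Suc j)
  show ?case
    by (rule C_k_SucI[where f' = "\<lambda>x v. prod (f x) (frechet_derivative g (at x) v) + prod (frechet_derivative f (at x) v) (g x)"])
      (intro FDERIV C_k_has_derivative[OF Suc.prems(1)] C_k_has_derivative[OF Suc.prems(2)] C_k_add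
        Suc.IH C_k_frechet Suc.prems Suc.prems[THEN C_k_SucD])+
qed (auto intro: continuous_on)

lemmas C_k_mult = bounded_bilinear.C_k_prod[OF bounded_bilinear_mult]
lemmas C_k_scaleR = bounded_bilinear.C_k_prod[OF bounded_bilinear_scaleR]

lemma C_k_sum: "(\<And>i. i \<in> I \<Longrightarrow> C_k j (f i)) \<Longrightarrow> C_k j (\<lambda>x. \<Sum>i\<in>I. f i x)"
  by (induction I rule: infinite_finite_induct) (auto intro: C_k_const C_k_add simp del: C_k.simps)

lemma C_k_diff: "C_k j f \<Longrightarrow> C_k j g \<Longrightarrow> C_k j (\<lambda>x. f x - g x)"
  using C_k_add[OF _ C_k_scaleR[OF C_k_const, of j g "-1"]] by simp

lemma C_k_power: "C_k j f \<Longrightarrow> C_k j (\<lambda>x. f x ^ n)" for f :: "_ \<Rightarrow> real"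
  by (induction n) (auto intro: C_k_const C_k_mult simp del: C_k.simps)

lemma C_k_exp: "C_k j f \<Longrightarrow> C_k j (\<lambda>x. exp (f x) :: real)"
proof (induction j arbitrary: f)
  case (Suc j)
  show ?case
    by (rule C_k_SucI[where f' = "\<lambda>x v. exp (f x) * frechet_derivative f (at x) v"])
      ((auto intro!: derivative_eq_intros C_k_has_derivative[OF Suc.prems] simp del: C_k.simps)[1],
       intro C_k_mult Suc.IH C_k_SucD[OF Suc.prems] C_k_frechet[OF Suc.prems])
qed (auto intro: continuous_intros)

lemma C_k_affine:
  assumes "bounded_linear L" shows "C_k j f \<Longrightarrow> C_k j (\<lambda>x. f (L x + a))"
proof (induction j arbitrary: f)
  case 0
  then show ?case
    by (auto intro!: continuous_on_compose2[of UNIV f] continuous_intros linear_continuous_on[OF assms])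
next
  case (Suc j)
  show ?case
  proof (rule C_k_SucI[where f' = "\<lambda>x v. frechet_derivative f (at (L x + a)) (L v)"])
    fix x
    have "((\<lambda>x. L x + a) has_derivative L) (at x)"
      using bounded_linear_imp_has_derivative[OF assms] by (auto intro!: derivative_eq_intros)
    from has_derivative_compose[OF this C_k_has_derivative[OF Suc.prems]]
    show "((\<lambda>x. f (L x + a)) has_derivative (\<lambda>v. frechet_derivative f (at (L x + a)) (L v))) (at x)" .
  qed (intro Suc.IH C_k_frechet[OF Suc.prems])
qed

text \<open>The outer function has only a one-sided derivative at 1. This is enough, because
  \<open>r\<close> takes its values in the half-line.\<close>

lemma C_k_comp_half_line:
  fixes F F' :: "real \<Rightarrow> real"
  assumes F: "\<And>y. y \<ge> 1 \<Longrightarrow> (F has_real_derivative F' y) (at y within {1..})"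
    and r: "C_k (Suc j) r" "\<And>x. r x \<ge> 1" and F': "C_k j (\<lambda>x. F' (r x))"
  shows "((\<lambda>x. F (r x)) has_derivative (\<lambda>v. F' (r x) * frechet_derivative r (at x) v)) (at x)"
    and "C_k (Suc j) (\<lambda>x. F (r x))"
proof -
  show d: "((\<lambda>x. F (r x)) has_derivative (\<lambda>v. F' (r x) * frechet_derivative r (at x) v)) (at x)" for x
  proof (rule has_derivative_in_compose[OF C_k_has_derivative[OF r(1)]])
    have "(F has_derivative (*) (F' (r x))) (at (r x) within {1..})"
      using F[OF r(2)] by (simp add: has_field_derivative_def)
    then show "(F has_derivative (*) (F' (r x))) (at (r x) within range r)"
      by (rule has_derivative_subset) (use r(2) in auto)
  qed
  show "C_k (Suc j) (\<lambda>x. F (r x))"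
    by (rule C_k_SucI[OF d]) (intro C_k_mult F' C_k_frechet[OF r(1)])
qed

lemma C_k_partial_deriv: "C_k (Suc j) f \<Longrightarrow> C_k j (partial_deriv i f)"
  unfolding partial_deriv_def by simp

lemma partial_deriv_unique: "(f has_derivative f') (at p) \<Longrightarrow> partial_deriv i f p = f' (axis i 1)"
  unfolding partial_deriv_def by (metis frechet_derivative_at)

lemma partial_deriv_scaleR:
  assumes "C_k (Suc j) a" "C_k (Suc l) f"
  shows "partial_deriv i (\<lambda>q. a q *\<^sub>R f q) p = a p *\<^sub>R partial_deriv i f p + partial_deriv i a p *\<^sub>R f p"
  by (rule trans[OF partial_deriv_unique[OF has_derivative_scaleR[OF C_k_has_derivative[OF assms(1)] C_k_has_derivative[OF assms(2)]]]])
    (simp add: partial_deriv_def)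

lemma partial_deriv_diff:
  assumes "C_k (Suc j) a" "C_k (Suc l) f"
  shows "partial_deriv i (\<lambda>q. a q - f q) p = partial_deriv i a p - partial_deriv i f p"
  by (rule trans[OF partial_deriv_unique[OF has_derivative_diff[OF C_k_has_derivative[OF assms(1)] C_k_has_derivative[OF assms(2)]]]])
    (simp add: partial_deriv_def)

text \<open>A divergence theorem without boundary terms: the integral of y \<mapsto> \<phi>(y + h v)
  does not depend on h by translation invariance, and differentiation under the integral at h = 0
  gives the claim.\<close>

lemma integral_frechet_derivative_eq_0:
  fixes \<phi> :: "'a::euclidean_space \<Rightarrow> 'b::banach"
  assumes \<phi>: "C_k 1 \<phi>" and supp: "\<And>y. norm y > r \<Longrightarrow> \<phi> y = 0"
    and box: "cball 0 (r + norm v) \<subseteq> cbox (- b) b"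
  shows "integral (cbox (- b) b) (\<lambda>y. frechet_derivative \<phi> (at y) v) = 0"
proof -
  have cont: "continuous_on S \<phi>" for S by (rule C_k_continuous[OF \<phi>])
  have cont': "continuous_on UNIV (\<lambda>y. frechet_derivative \<phi> (at y) v)" using \<phi> by simp
  let ?F = "\<lambda>h. integral (cbox (- b) b) (\<lambda>y. \<phi> (y + h *\<^sub>R v))"
  have "(?F has_vector_derivative integral (cbox (- b) b) (\<lambda>y. frechet_derivative \<phi> (at (y + 0 *\<^sub>R v)) v))
     (at 0 within {-1..1})"
  proof (rule leibniz_rule_vector_derivative)
    fix h :: real and y :: 'a
    have "((\<lambda>h. y + h *\<^sub>R v) has_derivative (\<lambda>k. k *\<^sub>R v)) (at h within {-1..1})"
      by (auto intro!: derivative_eq_intros)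
    moreover have "(\<phi> has_derivative frechet_derivative \<phi> (at (y + h *\<^sub>R v)))
        (at (y + h *\<^sub>R v) within (\<lambda>h. y + h *\<^sub>R v) ` {-1..1})"
      using \<phi> by (intro has_derivative_at_withinI[OF C_k_has_derivative[of 0]]) simp
    ultimately have d: "((\<lambda>h. \<phi> (y + h *\<^sub>R v)) has_derivative (\<lambda>k. frechet_derivative \<phi> (at (y + h *\<^sub>R v)) (k *\<^sub>R v)))
        (at h within {-1..1})"
      by (rule has_derivative_in_compose)
    have "linear (frechet_derivative \<phi> (at (y + h *\<^sub>R v)))"
      using \<phi> by (intro linear_frechet_derivative) simp
    with d show "((\<lambda>h. \<phi> (y + h *\<^sub>R v)) has_vector_derivative frechet_derivative \<phi> (at (y + h *\<^sub>R v)) v) (at h within {-1..1})"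
      by (simp add: has_vector_derivative_def linear_cmul)
    show "(\<lambda>y. \<phi> (y + h *\<^sub>R v)) integrable_on cbox (- b) b"
      by (intro integrable_continuous continuous_on_compose2[OF cont[of UNIV]] continuous_intros) auto
    show "continuous_on ({-1..1} \<times> cbox (- b) b) (\<lambda>(h, y). frechet_derivative \<phi> (at (y + h *\<^sub>R v)) v)"
      unfolding split_beta
      by (intro continuous_on_compose2[OF cont'] continuous_intros) auto
  qed auto
  \<comment> \<open>For |h| \<le> 1 the box contains the support of the translate, so the integral
    over it equals the one over the whole space, where translations act freely.\<close>
  moreover have F: "?F h = ?F 0" if "h \<in> {-1..1}" for h
  proof -
    have int: "(\<lambda>y. \<phi> (y + k *\<^sub>R v)) integrable_on cbox (- b) b" for k
      by (intro integrable_continuous continuous_on_compose2[OF cont[of UNIV]] continuous_intros) auto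
    have z: "\<phi> (y + k *\<^sub>R v) = 0" if "y \<notin> cbox (- b) b" "\<bar>k\<bar> \<le> 1" for y k
    proof -
      have "norm y > r + norm v" using that(1) box by (auto simp: subset_eq not_le)
      moreover have "norm y \<le> norm (y + k *\<^sub>R v) + norm (k *\<^sub>R v)"
        using norm_triangle_ineq4[of "y + k *\<^sub>R v" "k *\<^sub>R v"] by simp
      moreover have "norm (k *\<^sub>R v) \<le> norm v" using that(2) by (simp add: mult_left_le_one_le)
      ultimately show ?thesis by (intro supp) linarith
    qed
    have U: "((\<lambda>y. \<phi> (y + k *\<^sub>R v)) has_integral ?F k) UNIV" if "\<bar>k\<bar> \<le> 1" for k
      by (rule has_integral_on_superset[OF integrable_integral[OF int]]) (use z that in auto)
    have "((\<lambda>x. \<phi> (x + h *\<^sub>R v)) has_integral ?F 0) (cbox (- b - h *\<^sub>R v) (b - h *\<^sub>R v))"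
      using has_integral_shift_cbox[OF integrable_integral[OF int[of 0]], of "h *\<^sub>R v"] by simp
    then have "((\<lambda>x. \<phi> (x + h *\<^sub>R v)) has_integral ?F 0) UNIV"
    proof (rule has_integral_on_superset)
      fix x assume "x \<notin> cbox (- b - h *\<^sub>R v) (b - h *\<^sub>R v)"
      then have "x + h *\<^sub>R v \<notin> cbox (- b) b"
        by (auto simp: mem_box inner_add_left inner_diff_left algebra_simps)
      then show "\<phi> (x + h *\<^sub>R v) = 0" using z[of "x + h *\<^sub>R v" 0] by simp
    qed simp
    moreover have "\<bar>h\<bar> \<le> 1" using that by auto
    ultimately show ?thesis using has_integral_unique[OF U] by blast
  qed
  have "(?F has_vector_derivative 0) (at 0 within {-1..1})"
    by (rule has_vector_derivative_transform[OF _ _ has_vector_derivative_const[of "?F 0"]]) (use F in auto)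
  ultimately show ?thesis
    using vector_derivative_unique_within_closed_interval[of "-1" 1 0 ?F] by (simp add: cbox_interval)
qed

section \<open>The bracket and the left-invariant frame\<close>

text \<open>A permutation with nonzero product can move only indices of \<open>B\<close>, and only
  into \<open>A\<close>, where it is the identity. Injectivity then leaves the identity as the only
  such permutation.\<close>

lemma det_eq_prod_diagonal:
  fixes M :: "real ^ 'n::finite ^ 'n"
  assumes AB: "A \<union> B \<union> {c} = UNIV" "A \<inter> B = {}" "c \<notin> A" "c \<notin> B"
    and tri: "\<And>i j. i \<noteq> j \<Longrightarrow> M $ i $ j \<noteq> 0 \<Longrightarrow> i \<in> B \<and> j \<in> A"
  shows "det M = (\<Prod>i\<in>UNIV. M $ i $ i)"
proof -
  have zero: "of_int (sign p) * (\<Prod>i\<in>UNIV. M $ i $ p i) = 0" if p: "p permutes UNIV" "p \<noteq> id" for p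
  proof -
    have "\<exists>i. M $ i $ p i = 0"
    proof (rule ccontr)
      assume "\<not> ?thesis"
      then have nz: "\<And>i. M $ i $ p i \<noteq> 0" by blast
      have fixA: "p i = i" if "i \<notin> B" for i using tri[of i "p i"] nz[of i] that by metis
      have "p i = i" for i
      proof (rule ccontr)
        assume "p i \<noteq> i"
        then have "i \<in> B" "p i \<in> A" using tri[of i "p i"] nz[of i] by metis+
        then have "p (p i) = p i" using fixA AB(2) by blast
        then show False using \<open>p i \<noteq> i\<close> permutes_inj[OF p(1)] by (meson injD)
      qed
      then show False using p(2) by (auto simp: fun_eq_iff)
    qed
    then show ?thesis by (simp add: prod_zero_iff)
  qed
  have "det M = (\<Sum>p\<in>{id}. of_int (sign p) * (\<Prod>i\<in>UNIV. M $ i $ p i))"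
    unfolding det_def
  proof (rule sum.mono_neutral_right)
    show "{id} \<subseteq> {p. p permutes (UNIV :: 'n set)}" by (simp add: permutes_id)
    show "\<forall>p\<in>{p. p permutes UNIV} - {id}. of_int (sign p) * (\<Prod>i\<in>UNIV. M $ i $ p i) = 0"
      using zero by blast
  qed (simp add: finite_permutations)
  then show ?thesis by (simp add: sign_id)
qed

text \<open>The columns of \<open>M\<close> are an orthonormal frame for \<open>g p\<close>. In
  matrices, G = L^T L, so its inverse is M M^T.\<close>

lemma metric_matrix_of_frame:
  fixes L M :: "real ^ 'n::finite \<Rightarrow> real ^ 'n"
  assumes L: "linear L" and M: "linear M" and LM: "\<And>w. L (M w) = w"
    and G: "\<And>v w. g p v w = L v \<bullet> L w"
  shows "matrix_inv (metric_matrix g p) $ i $ j = (\<Sum>a\<in>UNIV. M (axis a 1) $ i * M (axis a 1) $ j)"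
    and "det (metric_matrix g p) = (det (matrix L))\<^sup>2"
proof -
  have G': "metric_matrix g p = transpose (matrix L) ** matrix L"
    by (simp add: metric_matrix_def G vec_eq_iff matrix_matrix_mult_def transpose_def matrix_def inner_vec_def)
  then show "det (metric_matrix g p) = (det (matrix L))\<^sup>2"
    by (simp add: det_mul det_transpose power2_eq_square)
  have LMm: "matrix L ** matrix M = mat 1"
    using matrix_compose[OF M L] LM by (simp add: o_def matrix_id_mat_1[unfolded id_def])
  then have MLm: "matrix M ** matrix L = mat 1" by (simp add: matrix_left_right_inverse)
  let ?K = "matrix M ** transpose (matrix M)"
  have t: "transpose (matrix M) ** transpose (matrix L) = mat 1"
    "transpose (matrix L) ** transpose (matrix M) = mat 1"
    using LMm MLm by (simp_all flip: matrix_transpose_mul)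
  have "metric_matrix g p ** ?K = transpose (matrix L) ** (matrix L ** matrix M) ** transpose (matrix M)"
    unfolding G' by (simp only: matrix_mul_assoc)
  then have 1: "metric_matrix g p ** ?K = mat 1" by (simp add: LMm t)
  then have 2: "?K ** metric_matrix g p = mat 1" by (simp add: matrix_left_right_inverse)
  \<comment> \<open>\<open>matrix_inv\<close> is defined by choice, so the chosen matrix is
    identified through uniqueness of inverses.\<close>
  have "matrix_inv (metric_matrix g p) = ?K"
  proof -
    have "metric_matrix g p ** matrix_inv (metric_matrix g p) = mat 1
        \<and> matrix_inv (metric_matrix g p) ** metric_matrix g p = mat 1"
      unfolding matrix_inv_def by (rule someI_ex) (use 1 2 in blast)
    then have "matrix_inv (metric_matrix g p) ** metric_matrix g p ** ?K = ?K" by simp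
    then show ?thesis by (simp add: 1 flip: matrix_mul_assoc)
  qed
  then show "matrix_inv (metric_matrix g p) $ i $ j = (\<Sum>a\<in>UNIV. M (axis a 1) $ i * M (axis a 1) $ j)"
    by (simp add: matrix_matrix_mult_def transpose_def matrix_def)
qed

section \<open>Coordinate projections and the algebra of the bracket\<close>

lemma proj_on_linear: "linear (proj_on I)"
  by (auto simp: linear_iff proj_on_def vec_eq_iff)

lemmas proj_on_add [simp] = linear_add[OF proj_on_linear]
lemmas proj_on_diff [simp] = linear_diff[OF proj_on_linear]
lemmas proj_on_scale [simp] = linear_cmul[OF proj_on_linear]
lemmas proj_on_zero [simp] = linear_0[OF proj_on_linear]

lemma proj_on_minus [simp]: "proj_on I (- x) = - proj_on I x"
  by (simp add: proj_on_def vec_eq_iff)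

lemma proj_on_nth [simp]: "proj_on I p $ i = (if i \<in> I then p $ i else 0)"
  by (simp add: proj_on_def)

lemma inner_proj_on: "proj_on I x \<bullet> y = (\<Sum>i\<in>I. x $ i * y $ i)"
proof -
  have "proj_on I x \<bullet> y = (\<Sum>i\<in>UNIV. if i \<in> I then x $ i * y $ i else 0)"
    by (auto simp: inner_vec_def intro: sum.cong)
  then show ?thesis by (simp add: sum.If_cases)
qed

lemma inner_proj_on_swap: "proj_on I x \<bullet> y = x \<bullet> proj_on I y"
  by (simp add: inner_vec_def) (intro sum.cong, auto)

lemma proj_on_axis: "proj_on I (axis i a) = (if i \<in> I then axis i a else 0)"
  by (auto simp: vec_eq_iff axis_def)

locale damek_ricci_space =
  fixes m k :: nat and A B :: "'n::finite set" and c :: 'n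
    and br :: "real ^ 'n \<Rightarrow> real ^ 'n \<Rightarrow> real ^ 'n"
  assumes damek_ricci: "damek_ricci m k A B c br"
begin

lemma AB: "A \<union> B \<union> {c} = UNIV" "A \<inter> B = {}" "c \<notin> A" "c \<notin> B" "card A = m" "card B = k"
  and heis: "heisenberg_type A B br"
  using damek_ricci unfolding damek_ricci_def by blast+

lemmas AB_notin [simp] = AB(3,4)

abbreviation pA where "pA \<equiv> proj_on A"
abbreviation pB where "pB \<equiv> proj_on B"

lemma AB_cases: obtains "i \<in> A" "i \<notin> B" "i \<noteq> c" | "i \<in> B" "i \<notin> A" "i \<noteq> c" | "i = c" "i \<notin> A" "i \<notin> B"
  using AB by blast

lemma decompose: "pA w + pB w + axis c (w $ c) = w"
  unfolding vec_eq_iff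
proof
  fix i show "(pA w + pB w + axis c (w $ c)) $ i = w $ i"
    by (cases i rule: AB_cases) (auto simp: axis_def AB)
qed

lemma proj_simps [simp]:
  "pA (pB x) = 0" "pB (pA x) = 0" "pA (axis c a) = 0" "pB (axis c a) = 0"
  "pA (pA x) = pA x" "pB (pB x) = pB x" "pA x $ c = 0" "pB x $ c = 0"
  using AB by (auto simp: vec_eq_iff axis_def)

text \<open>The values of \<open>br\<close> off \<open>coord_space A\<close> are arbitrary;
  composing with the projections gives a map that is bilinear on the whole space.\<close>

definition bb where "bb X X' = br (pA X) (pA X')"

lemma bb_bilinear: "bilinear bb"
  using heis unfolding heisenberg_type_def bb_def by blast

lemmas bb_simps = bilinear_ladd[OF bb_bilinear] bilinear_radd[OF bb_bilinear]
  bilinear_lmul[OF bb_bilinear] bilinear_rmul[OF bb_bilinear]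
  bilinear_lsub[OF bb_bilinear] bilinear_rsub[OF bb_bilinear]
  bilinear_lzero[OF bb_bilinear] bilinear_rzero[OF bb_bilinear]
  bilinear_lneg[OF bb_bilinear] bilinear_rneg[OF bb_bilinear]

lemma bb_proj [simp]: "bb (pA X) Y = bb X Y" "bb X (pA Y) = bb X Y" "bb (pB X) Y = 0" "bb X (pB Y) = 0"
    "bb (axis c a) Y = 0" "bb X (axis c a) = 0"
proof -
  have 1: "br 0 (pA Z) = 0" and 2: "br (pA Z) 0 = 0" for Z
    using bb_simps(7,8)[of Z] by (simp_all add: bb_def)
  show "bb (pA X) Y = bb X Y" "bb X (pA Y) = bb X Y" "bb (pB X) Y = 0" "bb X (pB Y) = 0"
    "bb (axis c a) Y = 0" "bb X (axis c a) = 0" by (simp_all add: bb_def 1 2)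
qed

lemma bb_coord: "bb X Y \<in> coord_space B"
  using heis proj_on_in_coord_space[of A X] proj_on_in_coord_space[of A Y]
  unfolding heisenberg_type_def bb_def by blast

lemma bb_projB [simp]: "pB (bb X Y) = bb X Y" "pA (bb X Y) = 0" "bb X Y $ c = 0"
  using bb_coord[of X Y] AB by (auto simp: coord_space_def vec_eq_iff)

lemma bb_skew: "bb X Y = - bb Y X"
  using heis proj_on_in_coord_space[of A X] proj_on_in_coord_space[of A Y]
  unfolding heisenberg_type_def bb_def by blast

lemma bb_self [simp]: "bb X X = 0"
  using bb_skew[of X X] by (simp add: vec_eq_iff)

definition JJ where "JJ Y X = J_map A br Y (pA X)"

lemma JJ_coord: "JJ Y X \<in> coord_space A"
  unfolding JJ_def by (rule J_map(1)[OF heis]) simp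

lemma JJ_proj [simp]: "pA (JJ Y X) = JJ Y X" "pB (JJ Y X) = 0" "JJ Y X $ c = 0" "JJ Y (pA X) = JJ Y X"
  using JJ_coord[of Y X] AB by (auto simp: coord_space_def vec_eq_iff JJ_def)

lemma JJ_inner: "JJ Y X \<bullet> X' = Y \<bullet> bb X X'"
proof -
  have "JJ Y X \<bullet> X' = JJ Y X \<bullet> pA X'" by (metis JJ_proj(1) inner_proj_on_swap)
  then show ?thesis unfolding JJ_def bb_def using J_map(2)[OF heis] by simp
qed

lemma JJ_bilinear: "bilinear JJ"
proof -
  have ext: "x = y" if "\<And>v. x \<bullet> v = y \<bullet> v" for x y :: "real ^ 'n"
    using that vector_eq_rdot by blast
  show ?thesis unfolding bilinear_def linear_iff
    by (intro conjI allI; rule ext) (simp_all add: JJ_inner inner_add_left bb_simps inner_add_right)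
qed

lemmas JJ_simps = bilinear_ladd[OF JJ_bilinear] bilinear_radd[OF JJ_bilinear]
  bilinear_lmul[OF JJ_bilinear] bilinear_rmul[OF JJ_bilinear]
  bilinear_lsub[OF JJ_bilinear] bilinear_rsub[OF JJ_bilinear]
  bilinear_lzero[OF JJ_bilinear] bilinear_rzero[OF JJ_bilinear]
  bilinear_lneg[OF JJ_bilinear] bilinear_rneg[OF JJ_bilinear]

lemma JJ_projB [simp]: "JJ (pB Y) X = JJ Y X"
proof (rule vector_eq_rdot[THEN iffD1], intro allI)
  fix v show "JJ (pB Y) X \<bullet> v = JJ Y X \<bullet> v" unfolding JJ_inner by (simp add: inner_proj_on_swap)
qed

lemma JJ_skew: "JJ Y X \<bullet> X = 0" by (simp add: JJ_inner)

lemma JJ_JJ: "JJ Y (JJ Y X) = - (norm (pB Y))\<^sup>2 *\<^sub>R pA X"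
proof -
  have "J_map A br (pB Y) (J_map A br (pB Y) (pA X)) = - (norm (pB Y))\<^sup>2 *\<^sub>R pA X"
    using heis unfolding heisenberg_type_def by auto
  moreover have "J_map A br (pB Y) (J_map A br (pB Y) (pA X)) = JJ (pB Y) (JJ (pB Y) X)"
    using JJ_proj(1)[of "pB Y" X] unfolding JJ_def by simp
  ultimately show ?thesis by simp
qed

text \<open>J_Y is skew because the bracket is, so |J_Y X|^2 = - <J_Y^2 X, X>, and the Heisenberg
  condition applies.\<close>

lemma JJ_norm: "JJ Y X \<bullet> JJ Y X = (pB Y \<bullet> pB Y) * (pA X \<bullet> pA X)"
proof -
  have "JJ Y X \<bullet> JJ Y X = - (Y \<bullet> bb (JJ Y X) X)" unfolding JJ_inner using bb_skew[of X] by simp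
  also have "\<dots> = - (JJ Y (JJ Y X) \<bullet> X)" by (simp add: JJ_inner)
  also have "\<dots> = (norm (pB Y))\<^sup>2 * (pA X \<bullet> X)" unfolding JJ_JJ by simp
  also have "pA X \<bullet> X = pA X \<bullet> pA X" by (metis inner_proj_on_swap proj_simps(5))
  finally show ?thesis by (simp add: power2_norm_eq_inner)
qed

text \<open>Polarization of \<open>JJ_norm\<close> in \<open>X\<close>; the next lemma polarizes in
  \<open>Y\<close>.\<close>

lemma JJ_inner_right: "JJ Y X \<bullet> JJ Y X' = (pB Y \<bullet> pB Y) * (pA X \<bullet> pA X')"
proof -
  have sq: "(a + b) \<bullet> (a + b) = a \<bullet> a + 2 * (a \<bullet> b) + b \<bullet> b" for a b :: "real ^ 'n"
    by (simp add: inner_add_left inner_add_right inner_commute[of b a])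
  have "JJ Y (X + X') \<bullet> JJ Y (X + X') = JJ Y X \<bullet> JJ Y X + 2 * (JJ Y X \<bullet> JJ Y X') + JJ Y X' \<bullet> JJ Y X'"
    unfolding JJ_simps(2) by (rule sq)
  moreover have "pA (X + X') \<bullet> pA (X + X') = pA X \<bullet> pA X + 2 * (pA X \<bullet> pA X') + pA X' \<bullet> pA X'"
    unfolding proj_on_add by (rule sq)
  ultimately show ?thesis unfolding JJ_norm by (simp add: distrib_left)
qed

lemma JJ_inner_left: "JJ Y X \<bullet> JJ Y' X = (pB Y \<bullet> pB Y') * (pA X \<bullet> pA X)"
proof -
  have sq: "(a + b) \<bullet> (a + b) = a \<bullet> a + 2 * (a \<bullet> b) + b \<bullet> b" for a b :: "real ^ 'n"
    by (simp add: inner_add_left inner_add_right inner_commute[of b a])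
  have "JJ (Y + Y') X \<bullet> JJ (Y + Y') X = JJ Y X \<bullet> JJ Y X + 2 * (JJ Y X \<bullet> JJ Y' X) + JJ Y' X \<bullet> JJ Y' X"
    unfolding JJ_simps(1) by (rule sq)
  moreover have "pB (Y + Y') \<bullet> pB (Y + Y') = pB Y \<bullet> pB Y + 2 * (pB Y \<bullet> pB Y') + pB Y' \<bullet> pB Y'"
    unfolding proj_on_add by (rule sq)
  ultimately show ?thesis unfolding JJ_norm by (simp add: distrib_right)
qed

text \<open>Tested against v, the left side is <J_v X, J_Y X>, and \<open>JJ_inner_left\<close>
  evaluates it.\<close>

lemma bb_JJ: "bb X (JJ Y X) = (pA X \<bullet> pA X) *\<^sub>R pB Y"
proof (rule vector_eq_rdot[THEN iffD1], intro allI)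
  fix v
  have "bb X (JJ Y X) \<bullet> v = JJ v X \<bullet> JJ Y X" by (simp only: JJ_inner[of v] inner_commute[of v])
  also have "\<dots> = (pB v \<bullet> pB Y) * (pA X \<bullet> pA X)" by (rule JJ_inner_left)
  also have "pB v \<bullet> pB Y = pB Y \<bullet> v" by (metis inner_commute inner_proj_on_swap proj_simps(6))
  finally show "bb X (JJ Y X) \<bullet> v = ((pA X \<bullet> pA X) *\<^sub>R pB Y) \<bullet> v" by simp
qed

text \<open>Expanding the brackets in the coordinates of \<open>B\<close> turns the sum into the k
  terms <J_j X, J_j X'>, each equal to the inner product of the \<open>A\<close>-parts. This is the
  trace that enters the divergence of \<open>V\<close>.\<close>

lemma bb_trace: "(\<Sum>i\<in>A. bb X (axis i 1) \<bullet> bb X' (axis i 1)) = k * (pA X \<bullet> pA X')"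
proof -
  have "(\<Sum>i\<in>A. bb X (axis i 1) \<bullet> bb X' (axis i 1)) = (\<Sum>i\<in>A. \<Sum>j\<in>B. JJ (axis j 1) X $ i * JJ (axis j 1) X' $ i)"
  proof (intro sum.cong refl)
    fix i
    have J: "JJ (axis j 1) X $ i = bb X (axis i 1) $ j" for j X
      using JJ_inner[of "axis j 1" X "axis i 1"] by (simp add: inner_axis inner_axis')
    have "bb X (axis i 1) \<bullet> bb X' (axis i 1) = pB (bb X (axis i 1)) \<bullet> bb X' (axis i 1)" by simp
    also have "\<dots> = (\<Sum>j\<in>B. JJ (axis j 1) X $ i * JJ (axis j 1) X' $ i)"
      unfolding inner_proj_on J ..
    finally show "bb X (axis i 1) \<bullet> bb X' (axis i 1) = (\<Sum>j\<in>B. JJ (axis j 1) X $ i * JJ (axis j 1) X' $ i)" .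
  qed
  also have "\<dots> = (\<Sum>j\<in>B. pA (JJ (axis j 1) X) \<bullet> JJ (axis j 1) X')"
    unfolding inner_proj_on by (rule sum.swap)
  also have "\<dots> = (\<Sum>j\<in>B. pA X \<bullet> pA X')"
    by (intro sum.cong refl) (simp add: JJ_inner_right proj_on_axis inner_axis')
  finally show ?thesis using AB by simp
qed

section \<open>The left-invariant frame, the inverse metric and the volume density\<close>

text \<open>The differential at \<open>p\<close> of the left translation by \<open>p\<^sup>-\<^sup>1\<close>, and its inverse.\<close>

definition LL where
  "LL p w = exp (- (p $ c) / 2) *\<^sub>R pA w + exp (- (p $ c)) *\<^sub>R (pB w - (1/2) *\<^sub>R bb p w) + axis c (w $ c)"

definition MM where
  "MM p w = exp (p $ c / 2) *\<^sub>R pA w + exp (p $ c) *\<^sub>R pB w + (1/2 * exp (p $ c / 2)) *\<^sub>R bb p w + axis c (w $ c)"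

lemma axis_add: "axis i (a + b) = axis i a + axis i (b::real)"
  and axis_scale: "axis i (r * a) = r *\<^sub>R axis i (a::real)"
  by (auto simp: vec_eq_iff axis_def)

lemma LL_linear: "linear (LL p)"
  by (auto simp: linear_iff LL_def bb_simps axis_add axis_scale algebra_simps)

lemma MM_linear: "linear (MM p)"
  by (auto simp: linear_iff MM_def bb_simps axis_add axis_scale algebra_simps)

lemma MM_proj [simp]: "pA (MM p w) = exp (p $ c / 2) *\<^sub>R pA w"
  "pB (MM p w) = exp (p $ c) *\<^sub>R pB w + (1/2 * exp (p $ c / 2)) *\<^sub>R bb p w" "MM p w $ c = w $ c"
  by (simp_all add: MM_def axis_nth)

lemma LL_MM: "LL p (MM p w) = w"
proof -
  have "bb p (MM p w) = exp (p $ c / 2) *\<^sub>R bb p w"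
    by (metis MM_proj(1) bb_proj(2) bb_simps(4))
  then have "LL p (MM p w) = pA w + pB w + axis c (w $ c)"
    by (simp add: LL_def algebra_simps flip: exp_add)
  then show ?thesis by (simp add: decompose)
qed

text \<open>Left translation by the inverse of \<open>p\<close> is affine in these coordinates, so
  its differential is the linear part \<open>LL p\<close>.\<close>

lemma dr_mult_inv_affine:
  "dr_mult A B c br (dr_inv A B c p) q = (- exp (- (p $ c) / 2) *\<^sub>R pA p - exp (- (p $ c)) *\<^sub>R pB p - axis c (p $ c)) + LL p q"
proof -
  have 1: "pA (dr_inv A B c p) = - exp (- (p $ c) / 2) *\<^sub>R pA p"
    "pB (dr_inv A B c p) = - exp (- (p $ c)) *\<^sub>R pB p" "dr_inv A B c p $ c = - (p $ c)"
    by (simp_all add: dr_inv_def axis_nth)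
  have 2: "br (- exp (- (p $ c) / 2) *\<^sub>R pA p) (pA q) = - exp (- (p $ c) / 2) *\<^sub>R bb p q"
    using bb_simps(3)[of "- exp (- (p $ c) / 2)" "pA p" q] by (simp add: bb_def)
  have 3: "exp (- (p $ c) / 2) * exp (- (p $ c) / 2) = exp (- (p $ c))" by (simp flip: exp_add)
  have 4: "axis c (- (p $ c) + q $ c) = axis c (q $ c) - axis c (p $ c)" by (auto simp: vec_eq_iff axis_def)
  show ?thesis
    unfolding dr_mult_def Let_def 1 2 4 LL_def
    by (simp add: algebra_simps flip: 3)
qed

lemma dr_metric_eq: "dr_metric A B c br p v w = LL p v \<bullet> LL p w"
proof -
  have "(dr_mult A B c br (dr_inv A B c p) has_derivative LL p) (at p)"
    unfolding dr_mult_inv_affine[abs_def]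
    by (auto intro!: derivative_eq_intros linear_imp_has_derivative LL_linear)
  then show ?thesis by (simp add: dr_metric_def Let_def frechet_derivative_at[symmetric])
qed

lemma matrix_inv_metric:
  "matrix_inv (metric_matrix (dr_metric A B c br) p) $ i $ j = (\<Sum>a\<in>UNIV. MM p (axis a 1) $ i * MM p (axis a 1) $ j)"
  by (rule metric_matrix_of_frame(1)[OF LL_linear MM_linear LL_MM dr_metric_eq])

text \<open>\<open>LL p\<close> is triangular, since the bracket maps \<open>A\<close>-directions
  into \<open>B\<close>. With z = \<open>p $ c\<close>, its diagonal has m entries exp(-z/2), k
  entries exp(-z) and a single 1.\<close>

lemma sqrt_det_metric:
  "sqrt (det (metric_matrix (dr_metric A B c br) p)) = exp (- (real m / 2 + real k) * p $ c)"
proof -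
  have e: "matrix (LL p) $ i $ j = LL p (axis j 1) $ i" for i j by (simp add: matrix_def)
  have "det (matrix (LL p)) = (\<Prod>i\<in>UNIV. matrix (LL p) $ i $ i)"
  proof (rule det_eq_prod_diagonal[OF AB(1-4)])
    fix i j assume "i \<noteq> j" "matrix (LL p) $ i $ j \<noteq> 0"
    then have nz: "LL p (axis j 1) $ i \<noteq> 0" by (simp add: e)
    have b0: "bb p (axis j 1) $ i = 0" if "i \<notin> B" using bb_coord[of p "axis j 1"] that by (auto simp: coord_space_def)
    have b1: "bb p (axis j 1) = 0" if "j \<notin> A" using bb_proj(2)[of p "axis j 1"] that by (simp add: proj_on_axis bb_simps)
    define b where "b = bb p (axis j 1)"
    have b: "b $ i = 0" if "i \<notin> B \<or> j \<notin> A" using that b0 b1 by (auto simp: b_def)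
    show "i \<in> B \<and> j \<in> A"
    proof (rule ccontr)
      assume "\<not> ?thesis"
      then have "b $ i = 0" using b by blast
      with nz \<open>i \<noteq> j\<close> show False unfolding LL_def b_def[symmetric] by (auto simp: axis_def split: if_splits)
    qed
  qed
  also have "\<dots> = (\<Prod>i\<in>UNIV. if i \<in> A then exp (- (p $ c) / 2) else if i \<in> B then exp (- (p $ c)) else 1)"
  proof (rule prod.cong[OF refl])
    fix i :: 'n
    have "bb p (axis i 1) $ i = 0"
      using bb_coord[of p "axis i 1"] bb_proj(2)[of p "axis i 1"] AB
      by (cases i rule: AB_cases) (auto simp: coord_space_def proj_on_axis bb_simps)
    then show "matrix (LL p) $ i $ i = (if i \<in> A then exp (- (p $ c) / 2) else if i \<in> B then exp (- (p $ c)) else 1)"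
      unfolding e by (cases i rule: AB_cases) (auto simp: LL_def proj_on_axis axis_def AB)
  qed
  also have "\<dots> = (\<Prod>i\<in>A. exp (- (p $ c) / 2)) * (\<Prod>i\<in>B. exp (- (p $ c)))"
  proof -
    have "(\<Prod>i\<in>UNIV. if i \<in> A then exp (- (p $ c) / 2) else if i \<in> B then exp (- (p $ c)) else 1)
       = (\<Prod>i\<in>UNIV. (if i \<in> A then exp (- (p $ c) / 2) else 1) * (if i \<in> B then exp (- (p $ c)) else 1))"
      using AB by (intro prod.cong) auto
    then show ?thesis by (simp add: prod.distrib prod.If_cases)
  qed
  also have "\<dots> = exp (- (real m / 2 + real k) * p $ c)"
    using AB by (simp add: exp_add[symmetric] exp_of_nat_mult[symmetric] algebra_simps)
  finally show ?thesis
    unfolding metric_matrix_of_frame(2)[where g = "dr_metric A B c br", OF LL_linear MM_linear LL_MM dr_metric_eq] by simp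
qed

end

section \<open>The radial function and its gradient\<close>

lemma C_k_inner: "C_k j f \<Longrightarrow> C_k j g \<Longrightarrow> C_k j (\<lambda>x. f x \<bullet> g x)"
  by (rule bounded_bilinear.C_k_prod[OF bounded_bilinear_inner])

lemma C_k_nth: "C_k j f \<Longrightarrow> C_k j (\<lambda>x. f x $ i :: real)"
  using C_k_inner[OF _ C_k_const, of j f "axis i 1"] by (simp add: inner_axis)

lemma C_k_axis: "C_k j f \<Longrightarrow> C_k j (\<lambda>x. axis i (f x :: real))"
proof -
  assume "C_k j f"
  then have "C_k j (\<lambda>x. f x *\<^sub>R axis i (1 :: real))" by (intro C_k_scaleR C_k_const)
  moreover have "f x *\<^sub>R axis i (1 :: real) = axis i (f x)" for x by (simp add: vec_eq_iff axis_def)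
  ultimately show ?thesis by simp
qed

context damek_ricci_space
begin

lemma bb_bounded: "bounded_bilinear bb" and JJ_bounded: "bounded_bilinear JJ"
  using bb_bilinear JJ_bilinear by (simp_all add: bilinear_conv_bounded_bilinear)

text \<open>
  With base point \<open>x\<close>, the function \<open>rho x y\<close> is \<open>cosh\<^sup>2 (d(x, y) / 2)\<close>, a smooth function of \<open>y\<close>, and the
  vector field \<open>V x\<close> is its Riemannian gradient.
\<close>

definition X1 where "X1 x y = pA (y - x)"
definition Y1 where "Y1 x y = pB (y - x) - (1/2) *\<^sub>R bb x y"
text \<open>The point x^(-1) y has the components exp(-z/2) \<open>X1\<close>, exp(-z)
  \<open>Y1\<close> and \<open>y $ c - x $ c\<close>, where z = \<open>x $ c\<close>. If these are
  called X, Y and log a, then \<open>rho\<close> is ((1 + a + |X|^2 / 4)^2 + |Y|^2) / (4 a), and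
  \<open>NN\<close> is exp(z) (1 + a + |X|^2 / 4).\<close>

definition NN where "NN x y = exp (y $ c) + exp (x $ c) + (X1 x y \<bullet> X1 x y) / 4"
definition rho where "rho x y = ((NN x y)\<^sup>2 + Y1 x y \<bullet> Y1 x y) * exp (- (x $ c) - y $ c) / 4"

definition VX where "VX x y = (exp (- (x $ c)) / 4) *\<^sub>R (NN x y *\<^sub>R X1 x y + JJ (Y1 x y) (X1 x y))"
definition Vc where "Vc x y = NN x y * exp (- (x $ c)) / 2 - rho x y"
definition VY where "VY x y = (exp (y $ c - x $ c) / 2) *\<^sub>R Y1 x y + (1/2) *\<^sub>R bb y (VX x y)"
definition V where "V x y = VX x y + VY x y + axis c (Vc x y)"

definition dY1 where "dY1 x w = pB w - (1/2) *\<^sub>R bb x w"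
definition dNN where "dNN x y w = exp (y $ c) * w $ c + (X1 x y \<bullet> w) / 2"
definition drho where "drho x y w = (2 * NN x y * dNN x y w + 2 * (Y1 x y \<bullet> dY1 x w)) * exp (- (x $ c) - y $ c) / 4
    - rho x y * w $ c"

lemma pA_X1 [simp]: "pA (X1 x y) = X1 x y" and pB_X1 [simp]: "pB (X1 x y) = 0" and X1_c [simp]: "X1 x y $ c = 0"
  by (simp_all add: X1_def)

lemma pA_Y1 [simp]: "pA (Y1 x y) = 0" and pB_Y1 [simp]: "pB (Y1 x y) = Y1 x y" and Y1_c [simp]: "Y1 x y $ c = 0"
  by (simp_all add: Y1_def)

lemma pA_VX [simp]: "pA (VX x y) = VX x y" and pB_VX [simp]: "pB (VX x y) = 0" and VX_c [simp]: "VX x y $ c = 0"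
  by (simp_all add: VX_def)

lemma pA_VY [simp]: "pA (VY x y) = 0" and pB_VY [simp]: "pB (VY x y) = VY x y" and VY_c [simp]: "VY x y $ c = 0"
  by (simp_all add: VY_def)

lemma V_proj [simp]: "pA (V x y) = VX x y" "pB (V x y) = VY x y" "V x y $ c = Vc x y"
  by (simp_all add: V_def)

lemma rho_eq: "(NN x y)\<^sup>2 + Y1 x y \<bullet> Y1 x y = 4 * exp (x $ c) * exp (y $ c) * rho x y"
  by (simp add: rho_def exp_diff exp_minus field_simps)

text \<open>The bound is (a + b)^2 \<ge> 4 a b, because \<open>NN\<close> is at least a + b.\<close>

lemma rho_ge_1: "rho x y \<ge> 1"
proof -
  define a b where "a = exp (y $ c)" and "b = exp (x $ c)"
  have ab: "a > 0" "b > 0" by (auto simp: a_def b_def)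
  have "(a + b)\<^sup>2 \<le> (NN x y)\<^sup>2"
    unfolding NN_def a_def b_def by (rule power_mono) auto
  moreover have "(a + b)\<^sup>2 = (a - b)\<^sup>2 + 4 * (b * a)" by (simp add: power2_eq_square algebra_simps)
  ultimately have "4 * (b * a) \<le> (NN x y)\<^sup>2" using zero_le_power2[of "a - b"] by linarith
  also have "\<dots> \<le> 4 * (b * a) * rho x y"
    using rho_eq[of x y] inner_ge_zero[of "Y1 x y"] unfolding a_def b_def mult.assoc by linarith
  finally have "4 * (b * a) * 1 \<le> 4 * (b * a) * rho x y" by simp
  then show ?thesis using ab by (simp only: mult_le_cancel_left_pos mult_pos_pos zero_less_numeral)
qed

lemma rho_self [simp]: "rho x x = 1"
proof -
  have "exp (x $ c) * exp (x $ c) * exp (- (x $ c) - x $ c) = 1" by (simp flip: exp_add)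
  then show ?thesis
    by (simp add: rho_def NN_def X1_def Y1_def power2_eq_square)
qed

text \<open>Equality makes (a - b)^2, \<open>X1\<close> and \<open>Y1\<close> vanish. Once the
  \<open>A\<close>-parts agree, \<open>bb x y\<close> is 0 and the \<open>B\<close>-parts agree
  too.\<close>

lemma rho_eq_1_iff: "rho x y = 1 \<longleftrightarrow> y = x"
proof
  assume r: "rho x y = 1"
  define a b where "a = exp (y $ c)" and "b = exp (x $ c)"
  have ab: "a > 0" "b > 0" by (auto simp: a_def b_def)
  define n where "n = X1 x y \<bullet> X1 x y / 4"
  have n: "n \<ge> 0" by (simp add: n_def)
  have "(a + b + n)\<^sup>2 + Y1 x y \<bullet> Y1 x y = 4 * b * a"
    using rho_eq[of x y] r by (simp add: NN_def a_def b_def n_def)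
  moreover have "(a + b + n)\<^sup>2 = (a - b)\<^sup>2 + 4 * b * a + (2 * (a + b) * n + n\<^sup>2)"
    by (simp add: power2_eq_square algebra_simps)
  ultimately have s: "(a - b)\<^sup>2 + (2 * (a + b) * n + n\<^sup>2) + Y1 x y \<bullet> Y1 x y = 0" by simp
  have nn: "2 * (a + b) * n \<ge> 0" "n\<^sup>2 \<ge> 0" "(a - b)\<^sup>2 \<ge> 0" "Y1 x y \<bullet> Y1 x y \<ge> 0" using ab n by auto
  have "(a - b)\<^sup>2 = 0" "n\<^sup>2 = 0" "Y1 x y \<bullet> Y1 x y = 0" using s nn by linarith+
  then have *: "a = b" "n = 0" "Y1 x y = 0" by simp_all
  then have "X1 x y = 0" by (simp add: n_def)
  then have A: "pA y = pA x" by (simp add: X1_def)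
  then have "bb x y = 0" by (metis bb_proj(2) bb_self)
  then have Bq: "pB y = pB x" using *(3) by (simp add: Y1_def)
  have "y $ c = x $ c" using *(1) by (simp add: a_def b_def)
  then show "y = x" using A Bq decompose[of x] decompose[of y] by metis
qed simp

lemma C_k_coords: "C_k j (\<lambda>y. y $ c)" "C_k j (\<lambda>y. pA y)" "C_k j (\<lambda>y. pB y)" "C_k j (\<lambda>y. bb x y)" "C_k j (\<lambda>y. bb y w)"
proof -
  show "C_k j (\<lambda>y. y $ c)" by (intro C_k_linear bounded_linear_vec_nth)
  show "C_k j (\<lambda>y. pA y)" "C_k j (\<lambda>y. pB y)"
    by (intro C_k_linear proj_on_linear[THEN linear_conv_bounded_linear[THEN iffD1]])+
  show "C_k j (\<lambda>y. bb x y)" "C_k j (\<lambda>y. bb y w)"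
    using bounded_bilinear.bounded_linear_right[OF bb_bounded] bounded_bilinear.bounded_linear_left[OF bb_bounded]
    by (intro C_k_linear; simp)+
qed

lemma C_k_X1: "C_k j (X1 x)"
  unfolding X1_def[abs_def] proj_on_diff by (intro C_k_diff C_k_coords C_k_const)

lemma C_k_Y1: "C_k j (Y1 x)"
  unfolding Y1_def[abs_def] proj_on_diff by (intro C_k_diff C_k_scaleR C_k_coords C_k_const)

lemma C_k_NN: "C_k j (NN x)"
  unfolding NN_def[abs_def] divide_inverse
  by (intro C_k_add C_k_mult C_k_exp C_k_inner C_k_X1 C_k_coords C_k_const)

lemma C_k_rho: "C_k j (rho x)"
  unfolding rho_def[abs_def] divide_inverse
  by (intro C_k_add C_k_mult C_k_power C_k_exp C_k_inner C_k_Y1 C_k_NN C_k_diff C_k_coords C_k_const)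

lemma C_k_V: "C_k j (V x)"
  unfolding V_def[abs_def] VX_def[abs_def] VY_def[abs_def] Vc_def[abs_def] divide_inverse
  by (intro C_k_add C_k_mult C_k_scaleR C_k_exp C_k_NN C_k_X1 C_k_Y1 C_k_rho C_k_diff C_k_coords C_k_const C_k_axis
      bounded_bilinear.C_k_prod[OF bb_bounded] bounded_bilinear.C_k_prod[OF JJ_bounded] C_k_linear[OF bounded_linear_ident])

lemma C_k_MM: "C_k j (\<lambda>p. MM p w)"
  unfolding MM_def[abs_def] divide_inverse
  by (intro C_k_add C_k_mult C_k_scaleR C_k_exp C_k_coords C_k_const)

lemma has_derivative_nth_c: "((\<lambda>y. y $ c) has_derivative (\<lambda>w. w $ c)) (at y)"
  by (intro bounded_linear_imp_has_derivative bounded_linear_vec_nth)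

lemma X1_has_derivative: "(X1 x has_derivative pA) (at y)"
proof -
  have "((\<lambda>y. pA y - pA x) has_derivative (\<lambda>w. pA w - 0)) (at y)"
    by (intro has_derivative_diff linear_imp_has_derivative proj_on_linear has_derivative_const)
  then show ?thesis by (simp add: X1_def[abs_def])
qed

lemma Y1_has_derivative: "(Y1 x has_derivative dY1 x) (at y)"
proof -
  have l: "linear (bb x)" using bb_bilinear unfolding bilinear_def by blast
  have "((\<lambda>y. pB y - pB x - (1/2) *\<^sub>R bb x y) has_derivative (\<lambda>w. pB w - 0 - (1/2) *\<^sub>R bb x w)) (at y)"
    by (intro has_derivative_diff has_derivative_scaleR_right linear_imp_has_derivative proj_on_linear l has_derivative_const)
  then show ?thesis by (simp add: Y1_def[abs_def] dY1_def[abs_def])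
qed

lemma X1_inner_pA: "X1 x y \<bullet> pA w = X1 x y \<bullet> w"
  by (metis inner_proj_on_swap pA_X1)

lemma Y1_inner_pB: "Y1 x y \<bullet> pB w = Y1 x y \<bullet> w"
  by (metis inner_proj_on_swap pB_Y1)

lemma NN_has_derivative: "(NN x has_derivative dNN x y) (at y)"
proof -
  have "((\<lambda>y. exp (y $ c) + exp (x $ c) + (X1 x y \<bullet> X1 x y) / 4) has_derivative
     (\<lambda>w. exp (y $ c) * (w $ c) + 0 + (X1 x y \<bullet> pA w + pA w \<bullet> X1 x y) / 4)) (at y)"
    by (rule derivative_eq_intros X1_has_derivative has_derivative_nth_c refl | simp add: fun_eq_iff mult.commute)+
  then show ?thesis
    by (simp add: NN_def[abs_def] dNN_def[abs_def] inner_commute[of "pA _"] X1_inner_pA)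
qed

lemma rho_has_derivative: "(rho x has_derivative drho x y) (at y)"
proof -
  let ?e = "exp (- (x $ c) - y $ c)"
  have 1: "((\<lambda>y. (NN x y)\<^sup>2 + Y1 x y \<bullet> Y1 x y) has_derivative
      (\<lambda>w. 2 * NN x y * dNN x y w + 2 * (Y1 x y \<bullet> dY1 x w))) (at y)"
    by (rule derivative_eq_intros NN_has_derivative Y1_has_derivative refl
      | simp add: inner_commute[of "dY1 _ _"] fun_eq_iff mult_ac)+
  have 2: "((\<lambda>y. exp (- (x $ c) - y $ c) / 4) has_derivative (\<lambda>w. - (?e * w $ c) / 4)) (at y)"
    by (rule derivative_eq_intros has_derivative_nth_c refl | simp add: fun_eq_iff mult.commute)+
  have eq: "rho x = (\<lambda>y. ((NN x y)\<^sup>2 + Y1 x y \<bullet> Y1 x y) * (exp (- (x $ c) - y $ c) / 4))"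
    by (simp add: rho_def fun_eq_iff)
  have "drho x y = (\<lambda>w. ((NN x y)\<^sup>2 + Y1 x y \<bullet> Y1 x y) * (- (?e * w $ c) / 4)
      + (2 * NN x y * dNN x y w + 2 * (Y1 x y \<bullet> dY1 x w)) * (?e / 4))"
    by (simp add: fun_eq_iff drho_def rho_def add_divide_distrib algebra_simps)
  then show ?thesis
    using has_derivative_mult[OF 1 2] unfolding eq by simp
qed

lemma drho_linear: "linear (drho x y)"
  using rho_has_derivative by (rule has_derivative_linear)

text \<open>This identifies \<open>V x\<close> as the gradient. The bracket term of
  \<open>VY\<close> is exactly what \<open>LL y\<close> subtracts, so in the orthonormal frame the
  \<open>B\<close>-component is a multiple of \<open>Y1\<close>.\<close>

lemma drho_metric: "LL y (V x y) \<bullet> LL y w = drho x y w"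
proof -
  have bV: "bb y (V x y) = bb y (VX x y)" by (metis V_proj(1) bb_proj(2))
  have 1: "LL y (V x y) = exp (- (y $ c) / 2) *\<^sub>R VX x y + (exp (- (x $ c)) / 2) *\<^sub>R Y1 x y + axis c (Vc x y)"
    unfolding LL_def V_proj bV by (simp add: VY_def flip: exp_add)
  have p: "pA (LL y w) = exp (- (y $ c) / 2) *\<^sub>R pA w" "pB (LL y w) = exp (- (y $ c)) *\<^sub>R (pB w - (1/2) *\<^sub>R bb y w)"
     "LL y w $ c = w $ c" by (simp_all add: LL_def axis_nth)
  have 2: "VX x y \<bullet> LL y w = exp (- (y $ c) / 2) * (VX x y \<bullet> w)"
    by (metis (no_types, lifting) inner_proj_on_swap inner_scaleR_right p(1) pA_VX)
  have 3: "Y1 x y \<bullet> LL y w = exp (- (y $ c)) * (Y1 x y \<bullet> w - (1/2) * (Y1 x y \<bullet> bb y w))"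
  proof -
    have "Y1 x y \<bullet> LL y w = Y1 x y \<bullet> pB (LL y w)" by (simp only: Y1_inner_pB)
    then show ?thesis unfolding p by (simp add: inner_diff_right Y1_inner_pB)
  qed
  have 4: "VX x y \<bullet> w = exp (- (x $ c)) / 4 * (NN x y * (X1 x y \<bullet> w) + (Y1 x y \<bullet> bb y w - Y1 x y \<bullet> bb x w))"
  proof -
    have "bb (X1 x y) w = bb y w - bb x w" by (simp add: X1_def bb_simps)
    then show ?thesis by (simp add: VX_def inner_add_left JJ_inner inner_diff_right)
  qed
  have e: "exp (- (y $ c) / 2) * exp (- (y $ c) / 2) = exp (- (y $ c))" by (simp flip: exp_add)
  have "LL y (V x y) \<bullet> LL y w = exp (- (y $ c) / 2) * (VX x y \<bullet> LL y w) + exp (- (x $ c)) / 2 * (Y1 x y \<bullet> LL y w) + Vc x y * w $ c"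
    unfolding 1 by (simp add: inner_add_left inner_axis' p)
  also have "\<dots> = exp (- (y $ c)) * (VX x y \<bullet> w) + exp (- (x $ c)) / 2 * (Y1 x y \<bullet> LL y w) + Vc x y * w $ c"
    unfolding 2 mult.assoc[symmetric] e ..
  also have "\<dots> = drho x y w"
    unfolding 3 4 drho_def dNN_def dY1_def Vc_def inner_diff_right inner_scaleR_right Y1_inner_pB
    by (simp add: exp_diff exp_minus field_simps)
  finally show ?thesis .
qed

text \<open>This is |grad r| = 1, expressed through \<rho>. The Heisenberg condition enters by
  \<open>JJ_norm\<close>, which makes |VX| a function of |X1|, |Y1| and \<open>NN\<close>.\<close>

lemma drho_V: "drho x y (V x y) = rho x y * (rho x y - 1)"
proof -
  define a b where "a = exp (y $ c)" and "b = exp (x $ c)"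
  have ab: "a > 0" "b > 0" by (auto simp: a_def b_def)
  define n s r where "n = X1 x y \<bullet> X1 x y" and "s = Y1 x y \<bullet> Y1 x y" and "r = rho x y"
  define N where "N = NN x y"
  have N: "N = a + b + n / 4" by (simp add: N_def NN_def a_def b_def n_def)
  \<comment> \<open>Eliminating |Y1|^2 in favour of \<rho> leaves a rational identity in a, b, n and
    r.\<close>
  have r: "s = 4 * b * a * r - N\<^sup>2" using rho_eq[of x y] by (simp add: N_def s_def r_def a_def b_def)
  have "bb y (V x y) = bb y (VX x y)" by (metis V_proj(1) bb_proj(2))
  then have L: "LL y (V x y) = exp (- (y $ c) / 2) *\<^sub>R VX x y + (exp (- (x $ c)) / 2) *\<^sub>R Y1 x y + axis c (Vc x y)"
    unfolding LL_def V_proj by (simp add: VY_def flip: exp_add)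
  have orth: "VX x y \<bullet> Y1 x y = 0" by (metis inner_proj_on_swap inner_zero_right pA_VX pA_Y1)
  have "VX x y \<bullet> VX x y = (exp (- (x $ c)) / 4)\<^sup>2 * (N\<^sup>2 * n + s * n)"
    using JJ_norm[of "Y1 x y" "X1 x y"] JJ_skew[of "Y1 x y" "X1 x y"]
    by (simp add: VX_def inner_add_left inner_add_right inner_commute[of "X1 x y" "JJ _ _"] N_def n_def s_def
        power2_eq_square algebra_simps)
  then have VV: "VX x y \<bullet> VX x y = (N\<^sup>2 * n + s * n) / (16 * b\<^sup>2)"
    by (simp add: b_def exp_minus power2_eq_square field_simps)
  have e: "exp (- (y $ c) / 2) * exp (- (y $ c) / 2) = exp (- (y $ c))" by (simp flip: exp_add)
  have "drho x y (V x y) = LL y (V x y) \<bullet> LL y (V x y)" by (simp add: drho_metric)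
  also have "\<dots> = exp (- (y $ c)) * (VX x y \<bullet> VX x y) + (exp (- (x $ c)) / 2)\<^sup>2 * s + (Vc x y)\<^sup>2"
  proof -
    have o: "Y1 x y \<bullet> VX x y = 0" using orth by (simp add: inner_commute)
    show ?thesis unfolding L e[symmetric]
      by (simp add: inner_add_left inner_add_right inner_axis inner_axis' axis_nth orth o
        power2_eq_square s_def mult.assoc del: exp_minus)
  qed
  also have "\<dots> = (N\<^sup>2 * n + s * n) / (16 * a * b\<^sup>2) + s / (4 * b\<^sup>2) + (N / (2 * b) - r)\<^sup>2"
    unfolding VV Vc_def by (simp add: a_def b_def N_def r_def exp_minus power2_eq_square field_simps)
  also have "\<dots> = r * (r - 1)"
    unfolding r using ab by (simp add: N field_simps power2_eq_square)
  finally show ?thesis by (simp add: r_def)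
qed

lemma MM_LL: "MM p (LL p w) = w"
  using linear_inverse_left[OF LL_linear MM_linear, of p p] LL_MM by (auto simp: fun_eq_iff)

text \<open>Passes from the gradient as dual of \<open>drho\<close> to the index form with the
  inverse matrix that occurs in \<open>laplace_beltrami\<close>.\<close>

lemma gradient_rho:
  "(\<Sum>j\<in>UNIV. matrix_inv (metric_matrix (dr_metric A B c br) y) $ i $ j * drho x y (axis j 1)) = V x y $ i"
proof -
  have lin: "drho x y w = (\<Sum>j\<in>UNIV. w $ j * drho x y (axis j 1))" for w
    using linear_sum[OF drho_linear[of x y], of "\<lambda>j. (w $ j) *\<^sub>R axis j 1" UNIV] basis_expansion[of w]
    by (simp add: linear_cmul[OF drho_linear] scalar_mult_eq_scaleR)
  have "(\<Sum>j\<in>UNIV. matrix_inv (metric_matrix (dr_metric A B c br) y) $ i $ j * drho x y (axis j 1))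
     = (\<Sum>a\<in>UNIV. MM y (axis a 1) $ i * (\<Sum>j\<in>UNIV. MM y (axis a 1) $ j * drho x y (axis j 1)))"
    unfolding matrix_inv_metric sum_distrib_right sum_distrib_left
    by (subst sum.swap) (simp add: mult.assoc)
  also have "\<dots> = (\<Sum>a\<in>UNIV. MM y (axis a 1) $ i * (LL y (V x y) $ a))"
    unfolding lin[symmetric] unfolding drho_metric[symmetric] LL_MM by (simp add: inner_axis)
  also have "\<dots> = MM y (LL y (V x y)) $ i"
  proof -
    have "MM y v = (\<Sum>a\<in>UNIV. v $ a *\<^sub>R MM y (axis a 1))" for v
      using linear_sum[OF MM_linear[of y], of "\<lambda>j. (v $ j) *\<^sub>R axis j 1" UNIV] basis_expansion[of v]
      by (simp add: linear_cmul[OF MM_linear] scalar_mult_eq_scaleR)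
    from arg_cong[OF this[of "LL y (V x y)"], of "\<lambda>v. v $ i"] show ?thesis
      by (simp only: sum_component vector_scaleR_component real_scaleR_def mult.commute)
  qed
  finally show ?thesis by (simp add: MM_LL)
qed

end

section \<open>The Laplacian of radial functions\<close>

context damek_ricci_space
begin

definition dVX where "dVX x y w = (exp (- (x $ c)) / 4) *\<^sub>R
    ((NN x y *\<^sub>R pA w + dNN x y w *\<^sub>R X1 x y) + (JJ (Y1 x y) (pA w) + JJ (dY1 x w) (X1 x y)))"
definition dVY where "dVY x y w = ((exp (y $ c - x $ c) / 2) *\<^sub>R dY1 x w + (exp (y $ c - x $ c) * w $ c / 2) *\<^sub>R Y1 x y)
    + (1/2) *\<^sub>R (bb y (dVX x y w) + bb w (VX x y))"
definition dVc where "dVc x y w = dNN x y w * exp (- (x $ c)) / 2 - drho x y w"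

lemma VX_has_derivative: "(VX x has_derivative dVX x y) (at y)"
  unfolding VX_def[abs_def] dVX_def[abs_def]
  by (intro has_derivative_scaleR_right has_derivative_add has_derivative_scaleR NN_has_derivative X1_has_derivative
      bounded_bilinear.FDERIV[OF JJ_bounded] Y1_has_derivative)

lemma VY_has_derivative: "(VY x has_derivative dVY x y) (at y)"
proof -
  have e: "((\<lambda>y. exp (y $ c - x $ c) / 2) has_derivative (\<lambda>w. exp (y $ c - x $ c) * w $ c / 2)) (at y)"
    by (rule derivative_eq_intros has_derivative_nth_c refl | simp add: fun_eq_iff mult.commute)+
  show ?thesis
    unfolding VY_def[abs_def] dVY_def[abs_def]
    by (intro has_derivative_add has_derivative_scaleR[OF e] Y1_has_derivative has_derivative_scaleR_right
        bounded_bilinear.FDERIV[OF bb_bounded] has_derivative_ident VX_has_derivative)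
qed

lemma Vc_has_derivative: "(Vc x has_derivative dVc x y) (at y)"
proof -
  have "((\<lambda>y. NN x y * (exp (- (x $ c)) / 2) - rho x y) has_derivative
      (\<lambda>w. dNN x y w * (exp (- (x $ c)) / 2) - drho x y w)) (at y)"
    by (intro has_derivative_diff has_derivative_mult_left NN_has_derivative rho_has_derivative)
  then show ?thesis by (simp add: Vc_def[abs_def] dVc_def[abs_def])
qed

lemma V_has_derivative:
  "(V x has_derivative (\<lambda>w. dVX x y w + dVY x y w + axis c (dVc x y w))) (at y)"
proof -
  have l: "linear (axis c :: real \<Rightarrow> real ^ 'n)" by (auto simp: linear_iff axis_add axis_scale)
  have "((\<lambda>y. axis c (Vc x y)) has_derivative (\<lambda>w. axis c (dVc x y w))) (at y)"
    by (rule has_derivative_compose[OF Vc_has_derivative linear_imp_has_derivative[OF l]])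
  then show ?thesis unfolding V_def[abs_def]
    by (intro has_derivative_add VX_has_derivative VY_has_derivative)
qed

lemma partial_deriv_V:
  "partial_deriv i (\<lambda>y. V x y $ i) y = (dVX x y (axis i 1) + dVY x y (axis i 1) + axis c (dVc x y (axis i 1))) $ i"
  by (rule partial_deriv_unique) (rule bounded_linear.has_derivative[OF bounded_linear_vec_nth V_has_derivative])

lemma sum_coordinates: "(\<Sum>i\<in>UNIV. f i) = (\<Sum>i\<in>A. f i) + (\<Sum>i\<in>B. f i) + f c" for f :: "'n \<Rightarrow> 'b::comm_monoid_add"
proof -
  have "(\<Sum>i\<in>UNIV. f i) = (\<Sum>i\<in>A \<union> B \<union> {c}. f i)" using AB by simp
  also have "\<dots> = (\<Sum>i\<in>A \<union> B. f i) + (\<Sum>i\<in>{c}. f i)" by (rule sum.union_disjoint) (use AB in auto)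
  also have "(\<Sum>i\<in>A \<union> B. f i) = (\<Sum>i\<in>A. f i) + (\<Sum>i\<in>B. f i)" by (rule sum.union_disjoint) (use AB in auto)
  finally show ?thesis by simp
qed

text \<open>This is the Laplacian of \<open>rho x\<close>: the density exp(-Q z) contributes -Q
  times the \<open>c\<close>-component of the gradient.\<close>

lemma divergence_V:
  "(\<Sum>i\<in>UNIV. partial_deriv i (\<lambda>y. V x y $ i) y) - (real m / 2 + real k) * Vc x y
     = (1 + (real m / 2 + real k)) * rho x y - (real k + 1) / 2"
proof -
  define a b where "a = exp (y $ c)" and "b = exp (x $ c)"
  have ab: "a > 0" "b > 0" by (auto simp: a_def b_def)
  have e: "exp (- (x $ c)) = 1 / b" "exp (y $ c - x $ c) = a / b" by (simp_all add: a_def b_def exp_diff exp_minus field_simps)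
  define n where "n = X1 x y \<bullet> X1 x y"
  have sA: "(\<Sum>i\<in>A. X1 x y $ i * X1 x y $ i) = n" unfolding n_def using inner_proj_on[of A "X1 x y" "X1 x y"] by simp
  have A: "(\<Sum>i\<in>A. partial_deriv i (\<lambda>y. V x y $ i) y)
      = (1 / (4 * b)) * (n / 2 + real m * NN x y - real k * (pA x \<bullet> X1 x y) / 2)"
  proof -
    have "(\<Sum>i\<in>A. partial_deriv i (\<lambda>y. V x y $ i) y)
        = (\<Sum>i\<in>A. (1 / (4 * b)) * (X1 x y $ i * X1 x y $ i / 2 + NN x y - (bb x (axis i 1) \<bullet> bb (X1 x y) (axis i 1)) / 2))"
    proof (rule sum.cong[OF refl])
      fix i assume i: "i \<in> A"
      then have i': "i \<noteq> c" "i \<notin> B" using AB by auto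
      have p: "pA (axis i 1) = axis i 1" "pB (axis i 1) = 0" "axis i (1::real) $ c = 0"
        using i i' by (simp_all add: proj_on_axis) (simp add: axis_def)
      have 1: "dVY x y (axis i 1) $ i = 0"
      proof -
        have "dVY x y (axis i 1) = pB (dVY x y (axis i 1))" by (simp add: dVY_def dY1_def)
        then show ?thesis using i' by (metis proj_on_nth)
      qed
      have 2: "axis c (dVc x y (axis i 1)) $ i = 0" using i' by (simp add: axis_def)
      have 3: "JJ (Y1 x y) (axis i 1) $ i = 0" using JJ_skew[of "Y1 x y" "axis i 1"] by (simp add: inner_axis)
      have 4: "JJ (dY1 x (axis i 1)) (X1 x y) $ i = - (bb x (axis i 1) \<bullet> bb (X1 x y) (axis i 1)) / 2"
      proof -
        have "JJ (dY1 x (axis i 1)) (X1 x y) $ i = JJ (dY1 x (axis i 1)) (X1 x y) \<bullet> axis i 1" by (simp add: inner_axis)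
        then show ?thesis unfolding JJ_inner by (simp add: dY1_def p)
      qed
      have 5: "dNN x y (axis i 1) = X1 x y $ i / 2" by (simp add: dNN_def p inner_axis)
      show "partial_deriv i (\<lambda>y. V x y $ i) y
         = (1 / (4 * b)) * (X1 x y $ i * X1 x y $ i / 2 + NN x y - (bb x (axis i 1) \<bullet> bb (X1 x y) (axis i 1)) / 2)"
        unfolding partial_deriv_V vector_add_component 1 2 dVX_def p vector_scaleR_component 3 4 5 e
        by (simp add: algebra_simps)
    qed
    also have "\<dots> = (1 / (4 * b)) * (n / 2 + real m * NN x y - real k * (pA x \<bullet> X1 x y) / 2)"
      unfolding sum_distrib_left[symmetric] sum.distrib sum_subtractf sum_divide_distrib[symmetric] sA bb_trace
      using AB by simp
    finally show ?thesis .
  qed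
  have B: "(\<Sum>i\<in>B. partial_deriv i (\<lambda>y. V x y $ i) y) = real k * (a / b / 2 + (pA y \<bullet> X1 x y) / (8 * b))"
  proof -
    have "(\<Sum>i\<in>B. partial_deriv i (\<lambda>y. V x y $ i) y) = (\<Sum>i\<in>B. a / b / 2 + (pA y \<bullet> X1 x y) / (8 * b))"
    proof (rule sum.cong[OF refl])
      fix i assume i: "i \<in> B"
      then have i': "i \<noteq> c" "i \<notin> A" using AB by auto
      have p: "pA (axis i 1) = 0" "pB (axis i 1) = axis i 1" "axis i (1::real) $ c = 0"
        using i i' by (simp_all add: proj_on_axis) (simp add: axis_def)
      have b0: "bb z (axis i 1) = 0" "bb (axis i 1) z = 0" for z
        using bb_proj(2)[of z "axis i 1"] bb_proj(1)[of "axis i 1" z] unfolding p by (simp_all add: bb_simps)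
      have d: "dY1 x (axis i 1) = axis i 1" "dNN x y (axis i 1) = 0"
        using X1_inner_pA[of x y "axis i 1"] by (simp_all add: dY1_def dNN_def p b0)
      have 1: "dVX x y (axis i 1) = (1 / (4 * b)) *\<^sub>R JJ (axis i 1) (X1 x y)"
        unfolding dVX_def d p e by (simp add: JJ_simps)
      have 2: "dVX x y (axis i 1) $ i = 0"
      proof -
        have "pA (dVX x y (axis i 1)) = dVX x y (axis i 1)" unfolding 1 by simp
        then show ?thesis using i' by (metis proj_on_nth)
      qed
      have 3: "axis c (dVc x y (axis i 1)) $ i = 0" using i' by (simp add: axis_def)
      have 4: "bb y (JJ (axis i 1) (X1 x y)) $ i = pA y \<bullet> X1 x y"
      proof -
        have "bb y (JJ (axis i 1) (X1 x y)) $ i = axis i 1 \<bullet> bb y (JJ (axis i 1) (X1 x y))" by (simp add: inner_axis')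
        also have "\<dots> = JJ (axis i 1) y \<bullet> JJ (axis i 1) (X1 x y)" by (simp add: JJ_inner)
        finally show ?thesis by (simp add: JJ_inner_right p inner_axis axis_nth)
      qed
      show "partial_deriv i (\<lambda>y. V x y $ i) y = a / b / 2 + (pA y \<bullet> X1 x y) / (8 * b)"
        unfolding partial_deriv_V vector_add_component 2 3 unfolding dVY_def d p e b0 1
        by (simp add: bb_simps 4 axis_nth)
    qed
    then show ?thesis using AB by simp
  qed
  have C: "partial_deriv c (\<lambda>y. V x y $ c) y = a / (2 * b) - (NN x y / (2 * b) - rho x y)"
  proof -
    have p: "pA (axis c 1) = 0" "pB (axis c 1) = 0" "axis c (1::real) $ c = 1" by (simp_all add: axis_nth)
    have d: "dY1 x (axis c 1) = 0" by (simp add: dY1_def p)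
    have dn: "dNN x y (axis c 1) = a" by (simp add: dNN_def a_def inner_axis)
    have "dVX x y (axis c 1) $ c = 0" unfolding dVX_def d p by simp
    moreover have "dVY x y (axis c 1) $ c = 0" unfolding dVY_def d p by simp
    moreover have "drho x y (axis c 1) = NN x y / (2 * b) - rho x y"
    proof -
      have "exp (- (x $ c) - y $ c) = 1 / (a * b)" by (simp add: a_def b_def exp_diff exp_minus field_simps)
      then show ?thesis using ab by (simp add: drho_def dn d p axis_nth)
    qed
    ultimately show ?thesis unfolding partial_deriv_V vector_add_component by (simp add: dVc_def dn e axis_nth)
  qed
  have Vc: "Vc x y = NN x y / (2 * b) - rho x y" by (simp add: Vc_def e)
  \<comment> \<open>The bracket terms of the \<open>A\<close>-sum and the \<open>B\<close>-sum
    contain <x, X1> and <y, X1> with opposite signs; only n = |X1|^2 survives.\<close>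
  have X: "pA y \<bullet> X1 x y = pA x \<bullet> X1 x y + n"
    unfolding n_def by (subst (3) X1_def) (simp add: inner_diff_left)
  have N: "NN x y = a + b + n / 4" by (simp add: NN_def a_def b_def n_def)
  show ?thesis
    unfolding sum_coordinates A B C Vc X N using ab by (simp add: field_simps)
qed

section \<open>The Laplacian in divergence form\<close>

abbreviation gS where "gS \<equiv> dr_metric A B c br"
abbreviation QQ where "QQ \<equiv> real m / 2 + real k"
abbreviation Kij where "Kij q i j \<equiv> matrix_inv (metric_matrix gS q) $ i $ j"

definition flux :: "'n \<Rightarrow> (real ^ 'n \<Rightarrow> 'b::real_normed_vector) \<Rightarrow> real ^ 'n \<Rightarrow> 'b" where
  "flux i f q = (\<Sum>j\<in>UNIV. Kij q i j *\<^sub>R partial_deriv j f q)"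

lemma C_k_Kij: "C_k j (\<lambda>q. Kij q i l)"
  unfolding matrix_inv_metric by (intro C_k_sum C_k_mult C_k_nth C_k_MM)

lemma Kij_sym: "Kij q i l = Kij q l i"
  unfolding matrix_inv_metric by (simp add: mult.commute)

lemma C_k_flux: "C_k (Suc j) f \<Longrightarrow> C_k j (flux i f)"
  unfolding flux_def[abs_def] by (intro C_k_sum C_k_scaleR C_k_Kij C_k_partial_deriv)

definition vol where "vol q = exp (- QQ * q $ c)"

lemma vol_pos: "vol q > 0" by (simp add: vol_def)

lemma C_k_vol: "C_k j vol"
  unfolding vol_def[abs_def] by (intro C_k_exp C_k_mult C_k_const C_k_coords)

lemma partial_deriv_vol: "partial_deriv i vol q = (if i = c then - QQ * vol q else 0)"
proof -
  have "(vol has_derivative (\<lambda>w. - QQ * w $ c * vol q)) (at q)"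
    unfolding vol_def[abs_def]
    by (rule derivative_eq_intros has_derivative_nth_c refl | simp add: fun_eq_iff mult.commute)+
  from partial_deriv_unique[OF this, of i] show ?thesis by (simp add: axis_def)
qed

lemma laplace_flux: "vol p *\<^sub>R laplace_beltrami gS f p = (\<Sum>i\<in>UNIV. partial_deriv i (\<lambda>q. vol q *\<^sub>R flux i f q) p)"
proof -
  have "sqrt (det (metric_matrix gS q)) = vol q" for q unfolding sqrt_det_metric vol_def by simp
  then show ?thesis using vol_pos[of p] by (simp add: laplace_beltrami_def flux_def)
qed

text \<open>The chain rule F'' |grad \<rho>|^2 + F' \<Delta>\<rho>, with the two coefficients
  supplied by \<open>drho_V\<close> and \<open>divergence_V\<close>. One-sided derivatives at 1 are
  enough by \<open>C_k_comp_half_line\<close>.\<close>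

lemma laplace_radial:
  assumes F: "\<And>y. y \<ge> 1 \<Longrightarrow> (F has_real_derivative F1 y) (at y within {1..})"
    and F1: "\<And>y. y \<ge> 1 \<Longrightarrow> (F1 has_real_derivative F2 y) (at y within {1..})"
    and F2: "continuous_on {1..} F2"
  shows "C_k 2 (\<lambda>y. F (rho x y))"
    and "laplace_beltrami gS (\<lambda>y. F (rho x y)) p
       = rho x p * (rho x p - 1) * F2 (rho x p) + ((1 + QQ) * rho x p - (real k + 1) / 2) * F1 (rho x p)"
proof -
  have c2: "C_k 0 (\<lambda>y. F2 (rho x y))"
    using continuous_on_compose2[OF F2 C_k_continuous[OF C_k_rho[of 0]]] by (simp add: image_subset_iff rho_ge_1)
  have d1: "((\<lambda>y. F1 (rho x y)) has_derivative (\<lambda>v. F2 (rho x y) * frechet_derivative (rho x) (at y) v)) (at y)" for y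
    by (rule C_k_comp_half_line(1)[OF F1 C_k_rho rho_ge_1 c2])
  have c1: "C_k (Suc 0) (\<lambda>y. F1 (rho x y))"
    by (rule C_k_comp_half_line(2)[OF F1 C_k_rho rho_ge_1 c2])
  have d0: "((\<lambda>y. F (rho x y)) has_derivative (\<lambda>v. F1 (rho x y) * frechet_derivative (rho x) (at y) v)) (at y)" for y
    by (rule C_k_comp_half_line(1)[OF F C_k_rho rho_ge_1 c1])
  show "C_k 2 (\<lambda>y. F (rho x y))"
    using C_k_comp_half_line(2)[OF F C_k_rho rho_ge_1 c1] unfolding numeral_2_eq_2 .
  have fr: "frechet_derivative (rho x) (at y) = drho x y" for y using frechet_derivative_at[OF rho_has_derivative] by simp
  have fl: "flux i (\<lambda>y. F (rho x y)) q = F1 (rho x q) * V x q $ i" for i q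
    unfolding flux_def partial_deriv_unique[OF d0] fr gradient_rho[symmetric] sum_distrib_left
    by (simp add: mult_ac)
  have "vol p * laplace_beltrami gS (\<lambda>y. F (rho x y)) p
      = (\<Sum>i\<in>UNIV. partial_deriv i (\<lambda>q. vol q *\<^sub>R (F1 (rho x q) *\<^sub>R V x q $ i)) p)"
    using laplace_flux[of p "\<lambda>y. F (rho x y)"] by (simp add: fl)
  also have "\<dots> = (\<Sum>i\<in>UNIV. vol p * (F1 (rho x p) * partial_deriv i (\<lambda>q. V x q $ i) p + F2 (rho x p) * drho x p (axis i 1) * V x p $ i)
        + (if i = c then - QQ * vol p else 0) * (F1 (rho x p) * V x p $ i))"
  proof (rule sum.cong[OF refl])
    fix i
    have cV: "C_k (Suc 0) (\<lambda>q. V x q $ i)" by (intro C_k_nth C_k_V)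
    have "partial_deriv i (\<lambda>q. vol q *\<^sub>R (F1 (rho x q) *\<^sub>R V x q $ i)) p
        = vol p *\<^sub>R partial_deriv i (\<lambda>q. F1 (rho x q) *\<^sub>R V x q $ i) p + partial_deriv i vol p *\<^sub>R (F1 (rho x p) *\<^sub>R V x p $ i)"
      by (rule partial_deriv_scaleR[OF C_k_vol[of "Suc 0"] C_k_scaleR[OF c1 cV]])
    also have "partial_deriv i (\<lambda>q. F1 (rho x q) *\<^sub>R V x q $ i) p
        = F1 (rho x p) *\<^sub>R partial_deriv i (\<lambda>q. V x q $ i) p + partial_deriv i (\<lambda>q. F1 (rho x q)) p *\<^sub>R V x p $ i"
      by (rule partial_deriv_scaleR[OF c1 cV])
    also have "partial_deriv i (\<lambda>q. F1 (rho x q)) p = F2 (rho x p) * drho x p (axis i 1)"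
      unfolding partial_deriv_unique[OF d1] fr ..
    finally show "partial_deriv i (\<lambda>q. vol q *\<^sub>R (F1 (rho x q) *\<^sub>R V x q $ i)) p
      = vol p * (F1 (rho x p) * partial_deriv i (\<lambda>q. V x q $ i) p + F2 (rho x p) * drho x p (axis i 1) * V x p $ i)
        + (if i = c then - QQ * vol p else 0) * (F1 (rho x p) * V x p $ i)"
      unfolding partial_deriv_vol by simp
  qed
  also have "\<dots> = vol p * (F1 (rho x p) * (\<Sum>i\<in>UNIV. partial_deriv i (\<lambda>q. V x q $ i) p)
       + F2 (rho x p) * (\<Sum>i\<in>UNIV. V x p $ i * drho x p (axis i 1))) - QQ * vol p * (F1 (rho x p) * Vc x p)"
  proof -
    have "(\<Sum>i\<in>UNIV. (if i = c then - QQ * vol p else 0) * (F1 (rho x p) * V x p $ i)) = - QQ * vol p * (F1 (rho x p) * Vc x p)"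
      by (subst sum.remove[of _ c]) auto
    then show ?thesis unfolding sum.distrib by (simp add: sum_distrib_left distrib_left sum.distrib mult_ac) (simp add: algebra_simps)
  qed
  also have "(\<Sum>i\<in>UNIV. V x p $ i * drho x p (axis i 1)) = drho x p (V x p)"
    using linear_sum[OF drho_linear[of x p], of "\<lambda>j. (V x p $ j) *\<^sub>R axis j 1" UNIV] basis_expansion[of "V x p"]
    by (simp add: linear_cmul[OF drho_linear] scalar_mult_eq_scaleR)
  also have "vol p * (F1 (rho x p) * (\<Sum>i\<in>UNIV. partial_deriv i (\<lambda>q. V x q $ i) p) + F2 (rho x p) * drho x p (V x p))
       - QQ * vol p * (F1 (rho x p) * Vc x p)
     = vol p * (F1 (rho x p) * ((\<Sum>i\<in>UNIV. partial_deriv i (\<lambda>q. V x q $ i) p) - QQ * Vc x p) + F2 (rho x p) * drho x p (V x p))"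
    by (simp add: algebra_simps)
  also have "\<dots> = vol p * (rho x p * (rho x p - 1) * F2 (rho x p) + ((1 + QQ) * rho x p - (real k + 1) / 2) * F1 (rho x p))"
    unfolding divergence_V drho_V by (simp add: algebra_simps)
  finally show "laplace_beltrami gS (\<lambda>y. F (rho x y)) p
       = rho x p * (rho x p - 1) * F2 (rho x p) + ((1 + QQ) * rho x p - (real k + 1) / 2) * F1 (rho x p)"
    using vol_pos[of p] by simp
qed

end

section \<open>Green's identity and the energy pairing\<close>

lemma partial_deriv_zero_open:
  assumes "open S" "p \<in> S" "\<And>y. y \<in> S \<Longrightarrow> f y = 0"
  shows "partial_deriv i f p = 0"
proof -
  have "(f has_derivative (\<lambda>v. 0)) (at p)"
    by (rule has_derivative_transform_within_open[OF has_derivative_const assms(1,2)]) (simp add: assms(3))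
  from partial_deriv_unique[OF this] show ?thesis .
qed

context damek_ricci_space
begin

section \<open>Sublevel sets of \<open>rho\<close>\<close>

lemma continuous_on_rho: "continuous_on S (rho x)"
  by (rule C_k_continuous[OF C_k_rho[of 0]])

text \<open>Both a^2 and b^2 are at most \<open>NN\<close>^2 \<le> 4 a b C, which confines a between
  b / (4 C) and 4 b C. Then \<open>NN\<close> bounds \<open>X1\<close>, and \<open>Y1\<close>
  together with the bracket bounds the \<open>B\<close>-part.\<close>

lemma rho_sublevel_bounded:
  assumes "C \<ge> 1"
  obtains r where "\<And>y. rho x y \<le> C \<Longrightarrow> norm y \<le> r"
proof -
  define b where "b = exp (x $ c)"
  have b: "b > 0" by (simp add: b_def)
  obtain Kx where Kx: "Kx \<ge> 0" "\<And>w. norm (bb x w) \<le> norm w * Kx"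
    using bounded_linear.nonneg_bounded[OF bounded_bilinear.bounded_linear_right[OF bb_bounded, of x]] by blast
  define rA where "rA = sqrt (16 * b * C) + norm (pA x)"
  define r where "r = rA + (4 * b * C + norm (pB x) + rA * Kx) + (\<bar>ln (4 * b * C)\<bar> + \<bar>ln (b / (4 * C))\<bar>)"
  have "norm y \<le> r" if C: "rho x y \<le> C" for y
  proof -
    define a where "a = exp (y $ c)"
    have a: "a > 0" by (simp add: a_def)
    have le: "(NN x y)\<^sup>2 + Y1 x y \<bullet> Y1 x y \<le> 4 * b * a * C"
      unfolding rho_eq a_def b_def by (rule mult_left_mono[OF C]) simp
    have N: "NN x y = a + b + (X1 x y \<bullet> X1 x y) / 4" by (simp add: NN_def a_def b_def)
    have n0: "X1 x y \<bullet> X1 x y \<ge> 0" "Y1 x y \<bullet> Y1 x y \<ge> 0" by auto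
    have N2: "(NN x y)\<^sup>2 \<le> 4 * b * a * C" using le n0(2) by linarith
    have "a\<^sup>2 \<le> (NN x y)\<^sup>2" "b\<^sup>2 \<le> (NN x y)\<^sup>2" using N n0 a b by (auto intro!: power_mono)
    then have "a * a \<le> a * (4 * b * C)" "b * b \<le> b * (4 * a * C)"
      using N2 by (auto simp: power2_eq_square mult_ac)
    then have a1: "a \<le> 4 * b * C" and a2: "b \<le> 4 * a * C" using a b by auto
    have z1: "y $ c \<le> ln (4 * b * C)" using a1 a b assms ln_mono[of a "4 * b * C"] by (simp add: a_def)
    have "b / (4 * C) \<le> a" using a2 assms by (simp add: field_simps)
    then have z2: "ln (b / (4 * C)) \<le> y $ c" using ln_mono[of "b / (4 * C)" a] a b assms by (simp add: a_def)
    have z: "\<bar>y $ c\<bar> \<le> \<bar>ln (4 * b * C)\<bar> + \<bar>ln (b / (4 * C))\<bar>" using z1 z2 by linarith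
    have "4 * b * a * C = (4 * b * C) * a" by simp
    also have "\<dots> \<le> (4 * b * C) * (4 * b * C)" using a1 assms b by (intro mult_left_mono) auto
    finally have q: "4 * b * a * C \<le> (4 * b * C)\<^sup>2" by (simp add: power2_eq_square)
    have "NN x y \<le> 4 * b * C" using power2_le_imp_le[of "NN x y" "4 * b * C"] N2 q assms b by simp
    then have "X1 x y \<bullet> X1 x y \<le> 16 * b * C" using N a b by simp
    then have X: "norm (X1 x y) \<le> sqrt (16 * b * C)" by (simp add: norm_eq_sqrt_inner)
    have A: "norm (pA y) \<le> rA"
    proof -
      have "pA y = X1 x y + pA x" by (simp add: X1_def)
      then show ?thesis using norm_triangle_ineq[of "X1 x y" "pA x"] X by (simp add: rA_def)
    qed
    have "norm (Y1 x y) \<le> sqrt ((4 * b * C)\<^sup>2)"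
      using le q zero_le_power2[of "NN x y"] unfolding norm_eq_sqrt_inner by (intro real_sqrt_le_mono) linarith
    then have Y: "norm (Y1 x y) \<le> 4 * b * C" using assms b by simp
    have B: "norm (pB y) \<le> 4 * b * C + norm (pB x) + rA * Kx"
    proof -
      have e: "pB y = Y1 x y + pB x + (1/2) *\<^sub>R bb x (pA y)" by (simp add: Y1_def)
      have "norm (pB y) \<le> norm (Y1 x y) + norm (pB x) + norm ((1/2) *\<^sub>R bb x (pA y))"
        unfolding e by (intro order.trans[OF norm_triangle_ineq] add_mono norm_triangle_ineq order_refl)
      moreover have "norm ((1/2) *\<^sub>R bb x (pA y)) \<le> norm (bb x (pA y))" by simp
      moreover have "norm (bb x (pA y)) \<le> rA * Kx"
        by (rule order.trans[OF Kx(2) mult_right_mono[OF A Kx(1)]])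
      ultimately show ?thesis using Y by linarith
    qed
    have "norm y \<le> norm (pA y) + norm (pB y) + norm (axis c (y $ c))"
      by (subst decompose[of y, symmetric]) (intro order.trans[OF norm_triangle_ineq] add_mono norm_triangle_ineq order_refl)
    moreover have "norm (axis c (y $ c)) = \<bar>y $ c\<bar>" by (simp add: norm_eq_sqrt_inner inner_axis_axis)
    ultimately show ?thesis using A B z by (simp add: r_def)
  qed
  then show ?thesis by (rule that)
qed

text \<open>On the compact set where \<open>rho x\<close> is at most 2 and the distance to
  \<open>x\<close> at least \<delta>, the minimum of \<open>rho x\<close> exceeds 1.\<close>

lemma rho_small_imp_close:
  assumes "\<delta> > 0"
  obtains \<eta> where "\<eta> > 0" "\<And>y. rho x y < 1 + \<eta> \<Longrightarrow> dist y x < \<delta>"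
proof -
  obtain r where r: "\<And>y. rho x y \<le> 2 \<Longrightarrow> norm y \<le> r" using rho_sublevel_bounded[of 2] by auto
  define S where "S = {y. rho x y \<le> 2 \<and> dist y x \<ge> \<delta>}"
  have "closed S" unfolding S_def
    by (intro closed_Collect_conj closed_Collect_le continuous_intros continuous_on_rho)
  moreover have "bounded S" using r by (auto simp: S_def bounded_iff)
  ultimately have "compact S" by (simp add: compact_eq_bounded_closed)
  show ?thesis
  proof (cases "S = {}")
    case True
    have "dist y x < \<delta>" if "rho x y < 1 + 1" for y
    proof (rule ccontr)
      assume "\<not> dist y x < \<delta>"
      then have "y \<in> S" using that by (simp add: S_def)
      with True show False by simp
    qed
    then show ?thesis by (intro that[of 1]) auto
  next
    case False
    then obtain y0 where y0: "y0 \<in> S" "\<And>y. y \<in> S \<Longrightarrow> rho x y0 \<le> rho x y"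
      using continuous_attains_inf[OF \<open>compact S\<close> _ continuous_on_rho] by blast
    have "rho x y0 \<noteq> 1" using y0(1) assms rho_eq_1_iff by (auto simp: S_def)
    then have gt: "rho x y0 > 1" using rho_ge_1[of x y0] by simp
    show ?thesis
    proof (rule that[of "min 1 (rho x y0 - 1)"])
      fix y assume y: "rho x y < 1 + min 1 (rho x y0 - 1)"
      show "dist y x < \<delta>"
      proof (rule ccontr)
        assume "\<not> dist y x < \<delta>"
        then have "y \<in> S" using y by (auto simp: S_def)
        from y0(2)[OF this] y show False by auto
      qed
    qed (use gt in auto)
  qed
qed

text \<open>The integrand is the divergence of \<open>\<Phi>\<close>, which vanishes wherever
  \<open>w\<close> does, so no decay of \<open>f\<close> enters. The box leaves room 1 for the unit
  coordinate vectors.\<close>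

lemma green:
  fixes f :: "real ^ 'n \<Rightarrow> 'b::euclidean_space" and w :: "real ^ 'n \<Rightarrow> real"
  assumes f: "C_k 2 f" and w: "C_k 2 w" and supp: "\<And>y. norm y > r \<Longrightarrow> w y = 0"
    and box: "cball 0 (r + 1) \<subseteq> cbox (- b) b"
  shows "integral (cbox (- b) b) (\<lambda>y. vol y *\<^sub>R (w y *\<^sub>R laplace_beltrami gS f y - laplace_beltrami gS w y *\<^sub>R f y)) = 0"
proof -
  have f2: "C_k (Suc (Suc 0)) f" and w2: "C_k (Suc (Suc 0)) w" using f w by (simp_all only: numeral_2_eq_2)
  have f1: "C_k (Suc 0) f" and w1: "C_k (Suc 0) w" using C_k_SucD[OF f2] C_k_SucD[OF w2] .
  define \<Phi> where "\<Phi> i = (\<lambda>y. w y *\<^sub>R (vol y *\<^sub>R flux i f y) - (vol y *\<^sub>R flux i w y) *\<^sub>R f y)" for i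
  have cvf: "C_k (Suc 0) (\<lambda>y. vol y *\<^sub>R flux i f y)" and cvw: "C_k (Suc 0) (\<lambda>y. vol y *\<^sub>R flux i w y)" for i
    by (intro C_k_scaleR C_k_vol C_k_flux f2 w2)+
  have c\<Phi>: "C_k (Suc 0) (\<Phi> i)" for i
    unfolding \<Phi>_def by (intro C_k_diff C_k_scaleR[OF w1 cvf] C_k_scaleR[OF cvw f1])
  have \<Phi>0: "\<Phi> i y = 0" if "norm y > r" for i y
  proof -
    have "partial_deriv j w y = 0" for j
      by (rule partial_deriv_zero_open[of "{y. norm y > r}"])
        (use that supp in \<open>auto intro!: open_Collect_less continuous_intros\<close>)
    then show ?thesis using supp[OF that] by (simp add: \<Phi>_def flux_def)
  qed
  have int: "integral (cbox (- b) b) (\<lambda>y. partial_deriv i (\<Phi> i) y) = 0" for i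
    unfolding partial_deriv_def
    by (rule integral_frechet_derivative_eq_0[of _ r]) (use c\<Phi> \<Phi>0 box in \<open>auto simp del: C_k.simps\<close>)
  have eq: "vol y *\<^sub>R (w y *\<^sub>R laplace_beltrami gS f y - laplace_beltrami gS w y *\<^sub>R f y) = (\<Sum>i\<in>UNIV. partial_deriv i (\<Phi> i) y)" for y
  proof -
    have "partial_deriv i (\<Phi> i) y =
        (w y *\<^sub>R partial_deriv i (\<lambda>y. vol y *\<^sub>R flux i f y) y + partial_deriv i w y *\<^sub>R (vol y *\<^sub>R flux i f y))
        - ((vol y *\<^sub>R flux i w y) *\<^sub>R partial_deriv i f y + partial_deriv i (\<lambda>y. vol y *\<^sub>R flux i w y) y *\<^sub>R f y)" for i
      unfolding \<Phi>_def
      by (simp only: partial_deriv_diff[OF C_k_scaleR[OF w1 cvf] C_k_scaleR[OF cvw f1]]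
          partial_deriv_scaleR[OF w1 cvf] partial_deriv_scaleR[OF cvw f1])
    then have "(\<Sum>i\<in>UNIV. partial_deriv i (\<Phi> i) y) =
        (w y *\<^sub>R (\<Sum>i\<in>UNIV. partial_deriv i (\<lambda>y. vol y *\<^sub>R flux i f y) y)
         + (\<Sum>i\<in>UNIV. partial_deriv i w y *\<^sub>R (vol y *\<^sub>R flux i f y)))
        - ((\<Sum>i\<in>UNIV. (vol y *\<^sub>R flux i w y) *\<^sub>R partial_deriv i f y)
           + (\<Sum>i\<in>UNIV. partial_deriv i (\<lambda>y. vol y *\<^sub>R flux i w y) y) *\<^sub>R f y)"
      by (simp add: sum.distrib sum_subtractf scaleR_sum_right scaleR_sum_left)
    \<comment> \<open>The mixed gradient terms cancel by symmetry of the inverse metric.\<close>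
    also have "(\<Sum>i\<in>UNIV. (vol y *\<^sub>R flux i w y) *\<^sub>R partial_deriv i f y) = (\<Sum>i\<in>UNIV. partial_deriv i w y *\<^sub>R (vol y *\<^sub>R flux i f y))"
    proof -
      have "(\<Sum>i\<in>UNIV. (vol y *\<^sub>R flux i w y) *\<^sub>R partial_deriv i f y)
          = (\<Sum>i\<in>UNIV. \<Sum>j\<in>UNIV. (vol y * (Kij y i j * partial_deriv j w y)) *\<^sub>R partial_deriv i f y)"
        by (simp add: flux_def sum_distrib_left scaleR_sum_left)
      also have "\<dots> = (\<Sum>j\<in>UNIV. \<Sum>i\<in>UNIV. (vol y * (Kij y i j * partial_deriv j w y)) *\<^sub>R partial_deriv i f y)"
        by (rule sum.swap)
      also have "\<dots> = (\<Sum>j\<in>UNIV. partial_deriv j w y *\<^sub>R (vol y *\<^sub>R flux j f y))"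
        by (simp add: flux_def scaleR_sum_right Kij_sym mult_ac)
      finally show ?thesis .
    qed
    finally show ?thesis unfolding laplace_flux[symmetric] by (simp add: algebra_simps)
  qed
  have "integral (cbox (- b) b) (\<lambda>y. \<Sum>i\<in>UNIV. partial_deriv i (\<Phi> i) y) = (\<Sum>i\<in>UNIV. integral (cbox (- b) b) (\<lambda>y. partial_deriv i (\<Phi> i) y))"
    by (intro integral_sum finite integrable_continuous C_k_continuous[OF C_k_partial_deriv[OF c\<Phi>]])
  then show ?thesis unfolding eq int by simp
qed

text \<open>Values lie in a Euclidean space, which covers complex solutions; positivity is tested by
  the inner product with \<open>u x t\<close>.\<close>

lemma wave_at_point_eq_0:
  fixes u ut utt :: "real ^ 'n \<Rightarrow> real \<Rightarrow> 'b::euclidean_space"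
  assumes mk: "even m" "even k" "k \<ge> 1" and \<epsilon>0: "\<epsilon>0 > 0"
    and u2: "\<And>s. C_k 2 (\<lambda>y. u y s)"
    and cu: "continuous_on UNIV (\<lambda>(y, s). u y s)" "continuous_on UNIV (\<lambda>(y, s). ut y s)"
      "continuous_on UNIV (\<lambda>(y, s). utt y s)"
    and ut: "\<And>y s. ((\<lambda>s. u y s) has_vector_derivative ut y s) (at s)"
    and utt: "\<And>y s. ((\<lambda>s. ut y s) has_vector_derivative utt y s) (at s)"
    and wave: "\<And>y s. utt y s = laplace_beltrami gS (\<lambda>y. u y s) y + (QQ\<^sup>2 / 4) *\<^sub>R u y s"
    and init: "\<And>y. \<bar>\<bar>t\<bar> - arcosh (2 * rho x y - 1)\<bar> \<le> \<epsilon>0 \<Longrightarrow> u y 0 = 0 \<and> ut y 0 = 0"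
  shows "u x t = 0"
proof (rule ccontr)
  assume nz: "u x t \<noteq> 0"
  have "continuous_on UNIV (\<lambda>y. u y t \<bullet> u x t)"
    by (intro continuous_intros continuous_on_compose2[OF cu(1), where f = "\<lambda>y. (y, t)", unfolded split_beta fst_conv snd_conv]) auto
  then have "open {y. u y t \<bullet> u x t > 0}" by (intro open_Collect_less continuous_on_const)
  moreover have "x \<in> {y. u y t \<bullet> u x t > 0}" using nz by simp
  ultimately obtain \<delta> where \<delta>: "\<delta> > 0" "\<And>y. dist y x < \<delta> \<Longrightarrow> u y t \<bullet> u x t > 0"
    unfolding open_dist by blast
  obtain \<eta> where \<eta>: "\<eta> > 0" "\<And>y. rho x y < 1 + \<eta> \<Longrightarrow> dist y x < \<delta>"
    using rho_small_imp_close[OF \<delta>(1)] by blast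
  \<comment> \<open>Small enough for the hypothesis on the initial data and for u(., t) to have
    positive inner product with \<open>u x t\<close> wherever r \<le> \<epsilon>.\<close>
  define \<epsilon> where "\<epsilon> = min \<epsilon>0 (arcosh (1 + \<eta>))"
  have \<epsilon>: "\<epsilon> > 0" "\<epsilon> \<le> \<epsilon>0" using \<epsilon>0 \<eta>(1) by (auto simp: \<epsilon>_def)
  have near: "u y t \<bullet> u x t > 0" if "arcosh (2 * rho x y - 1) \<le> \<epsilon>" for y
  proof -
    have "arcosh (2 * rho x y - 1) \<le> arcosh (1 + \<eta>)" using that by (simp add: \<epsilon>_def)
    then have "2 * rho x y - 1 \<le> 1 + \<eta>"
      using arcosh_less_iff_real[of "1 + \<eta>" "2 * rho x y - 1"] rho_ge_1[of x y] \<eta>(1) by (auto simp: not_less[symmetric])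
    then show ?thesis using \<eta> \<delta>(2) by auto
  qed
  obtain W W1 W2 Wt Wtt :: "real \<Rightarrow> real \<Rightarrow> real" where
    W: "continuous_on ({1..} \<times> UNIV) (\<lambda>(\<rho>, s). W \<rho> s)"
    "continuous_on ({1..} \<times> UNIV) (\<lambda>(\<rho>, s). W1 \<rho> s)"
    "continuous_on ({1..} \<times> UNIV) (\<lambda>(\<rho>, s). W2 \<rho> s)"
    "continuous_on ({1..} \<times> UNIV) (\<lambda>(\<rho>, s). Wt \<rho> s)"
    "continuous_on ({1..} \<times> UNIV) (\<lambda>(\<rho>, s). Wtt \<rho> s)"
    and dW: "\<And>\<rho> s. \<rho> \<ge> 1 \<Longrightarrow> ((\<lambda>\<rho>. W \<rho> s) has_real_derivative W1 \<rho> s) (at \<rho> within {1..})"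
    "\<And>\<rho> s. \<rho> \<ge> 1 \<Longrightarrow> ((\<lambda>\<rho>. W1 \<rho> s) has_real_derivative W2 \<rho> s) (at \<rho> within {1..})"
    "\<And>\<rho> s. \<rho> \<ge> 1 \<Longrightarrow> ((\<lambda>s. W \<rho> s) has_real_derivative Wt \<rho> s) (at s)"
    "\<And>\<rho> s. \<rho> \<ge> 1 \<Longrightarrow> ((\<lambda>s. Wt \<rho> s) has_real_derivative Wtt \<rho> s) (at s)"
    and pde: "\<And>\<rho> s. \<rho> \<ge> 1 \<Longrightarrow> \<rho> * (\<rho> - 1) * W2 \<rho> s + ((1 + QQ) * \<rho> - (real k + 1) / 2) * W1 \<rho> s
        + QQ\<^sup>2 / 4 * W \<rho> s = Wtt \<rho> s"
    and W0: "\<And>\<rho>. \<rho> \<ge> 1 \<Longrightarrow> W \<rho> 0 = 0" "\<And>\<rho>. \<rho> \<ge> 1 \<Longrightarrow> Wt \<rho> 0 \<ge> 0" "Wt 1 0 > 0"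
    and supp: "\<And>\<rho> s. \<rho> \<ge> 1 \<Longrightarrow> \<bar>\<bar>s\<bar> - arcosh (2 * \<rho> - 1)\<bar> > \<epsilon> \<Longrightarrow> W \<rho> s = 0"
    "\<And>\<rho> s. \<rho> \<ge> 1 \<Longrightarrow> \<bar>\<bar>s\<bar> - arcosh (2 * \<rho> - 1)\<bar> > \<epsilon> \<Longrightarrow> Wt \<rho> s = 0"
    by (rule radial_kernel[OF mk \<epsilon>(1) refl, of thesis]) blast
  \<comment> \<open>The sublevel set \<open>rho x y \<le> C\<close> is the ball r \<le> |t| +
    \<epsilon>.\<close>
  define C where "C = (cosh (\<bar>t\<bar> + \<epsilon>) + 1) / 2"
  have C1: "C \<ge> 1" using cosh_real_ge_1[of "\<bar>t\<bar> + \<epsilon>"] by (simp add: C_def)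
  obtain r where r: "\<And>y. rho x y \<le> C \<Longrightarrow> norm y \<le> r" using rho_sublevel_bounded[OF C1] by blast
  have xr: "norm x \<le> r" using r[of x] C1 by simp
  have far: "arcosh (2 * rho x y - 1) > \<bar>t\<bar> + \<epsilon>" if "norm y > r" for y
  proof -
    have "rho x y > C" using r[of y] that by force
    then have "2 * rho x y - 1 > cosh (\<bar>t\<bar> + \<epsilon>)" by (simp add: C_def field_simps)
    then have "arcosh (2 * rho x y - 1) > arcosh (cosh (\<bar>t\<bar> + \<epsilon>))"
      using cosh_real_ge_1[of "\<bar>t\<bar> + \<epsilon>"] by (intro arcosh_real_strict_mono) auto
    then show ?thesis using \<epsilon>(1) by (simp add: arcosh_cosh_real)
  qed
  obtain b :: "real ^ 'n" where "ball 0 (r + 2) \<subseteq> cbox (- b) b"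
    using bounded_subset_cbox_symmetric[of "ball 0 (r + 2) :: (real ^ 'n) set"] by auto
  moreover have "cball 0 (r + 1) \<subseteq> ball (0 :: real ^ 'n) (r + 2)" by auto
  ultimately have box: "cball 0 (r + 1) \<subseteq> cbox (- b) b" and box': "ball 0 (r + 2) \<subseteq> box (- b) b"
    by (auto simp: interior_maximal simp flip: interior_cbox)
  \<comment> \<open>An interval containing 0 and t on which the kernel time s - t stays within |t|,
    so that one box holds all supports.\<close>
  let ?I = "{s. \<bar>s - t\<bar> \<le> \<bar>t\<bar>}"
  have cI: "convex ?I"
  proof -
    have "?I = {t - \<bar>t\<bar>..t + \<bar>t\<bar>}" by auto
    then show ?thesis by simp
  qed
  have cont: "continuous_on S (\<lambda>p. F (rho x (snd p)) (fst p - t))"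
    if "continuous_on ({1..} \<times> UNIV) (\<lambda>(\<rho>, s). F \<rho> s)" for F :: "real \<Rightarrow> real \<Rightarrow> real" and S
  proof -
    have "continuous_on S (\<lambda>p. (rho x (snd p), fst p - t))"
      by (intro continuous_intros continuous_on_compose2[OF continuous_on_rho[of UNIV]]) auto
    from continuous_on_compose2[OF that this] show ?thesis by (simp add: image_subset_iff rho_ge_1 split_beta)
  qed
  have contu: "continuous_on S (\<lambda>p. F (snd p) (fst p))"
    if "continuous_on UNIV (\<lambda>(y, s). F y s)" for F :: "real ^ 'n \<Rightarrow> real \<Rightarrow> 'b" and S
  proof -
    have "continuous_on S (\<lambda>p. (snd p, fst p))" by (intro continuous_intros)
    from continuous_on_compose2[OF that this] show ?thesis by (simp add: split_beta)
  qed
  define g where "g s y = vol y *\<^sub>R (Wt (rho x y) (s - t) *\<^sub>R u y s - W (rho x y) (s - t) *\<^sub>R ut y s)" for s y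
  define g' where "g' s y = vol y *\<^sub>R (Wtt (rho x y) (s - t) *\<^sub>R u y s - W (rho x y) (s - t) *\<^sub>R utt y s)" for s y
  have cvol: "continuous_on S (\<lambda>p. vol (snd p))" for S :: "(real \<times> (real ^ 'n)) set"
    by (intro continuous_on_compose2[OF C_k_continuous[OF C_k_vol[of 0], of UNIV]] continuous_intros) auto
  have cg: "continuous_on S (\<lambda>p. g (fst p) (snd p))" for S
    unfolding g_def by (intro continuous_intros cvol cont contu cu W)
  have cg': "continuous_on S (\<lambda>p. g' (fst p) (snd p))" for S
    unfolding g'_def by (intro continuous_intros cvol cont contu cu W)
  have cgs: "continuous_on S (g s)" for s S
  proof -
    have "continuous_on S (\<lambda>y. (s, y))" by (intro continuous_intros)
    from continuous_on_compose2[OF cg[of UNIV] this] show ?thesis by simp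
  qed
  have E0: "integral (cbox (- b) b) (g' s) = 0" if s: "s \<in> ?I" for s
  proof -
    let ?w = "\<lambda>y. W (rho x y) (s - t)"
    have c2: "continuous_on {1..} (\<lambda>\<rho>. W2 \<rho> (s - t))"
      using continuous_on_compose2[OF W(3), of "{1..}" "\<lambda>\<rho>. (\<rho>, s - t)"] by (force intro!: continuous_intros)
    note lr = laplace_radial[OF dW(1) dW(2) c2, of x]
    have lap: "laplace_beltrami gS ?w y = Wtt (rho x y) (s - t) - QQ\<^sup>2 / 4 * W (rho x y) (s - t)" for y
      using lr(2)[of y] pde[OF rho_ge_1, of x y "s - t"] by linarith
    have "g' s y = vol y *\<^sub>R (laplace_beltrami gS ?w y *\<^sub>R u y s - ?w y *\<^sub>R laplace_beltrami gS (\<lambda>y. u y s) y)" for y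
      unfolding g'_def wave lap by (simp add: algebra_simps)
    then have eq: "g' s = (\<lambda>y. - (vol y *\<^sub>R (?w y *\<^sub>R laplace_beltrami gS (\<lambda>y. u y s) y - laplace_beltrami gS ?w y *\<^sub>R u y s)))"
      by (auto simp: algebra_simps)
    have "integral (cbox (- b) b) (\<lambda>y. vol y *\<^sub>R (?w y *\<^sub>R laplace_beltrami gS (\<lambda>y. u y s) y - laplace_beltrami gS ?w y *\<^sub>R u y s)) = 0"
    proof (rule green[OF u2 lr(1) _ box])
      fix y :: "real ^ 'n" assume "norm y > r"
      from far[OF this] s have "\<bar>\<bar>s - t\<bar> - arcosh (2 * rho x y - 1)\<bar> > \<epsilon>" by auto
      then show "W (rho x y) (s - t) = 0" by (rule supp(1)[OF rho_ge_1])
    qed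
    then show ?thesis unfolding eq by simp
  qed
  have "((\<lambda>s. integral (cbox (- b) b) (g s)) has_vector_derivative integral (cbox (- b) b) (g' s)) (at s within ?I)"
    if s: "s \<in> ?I" for s
  proof (rule leibniz_rule_vector_derivative[OF _ _ _ s cI])
    fix s y
    have ds: "((\<lambda>s. f (s - t)) has_vector_derivative d) (at s within ?I)"
      if "(f has_real_derivative d) (at (s - t))" for f :: "real \<Rightarrow> real" and d
    proof -
      have "((\<lambda>s. s - t) has_real_derivative 1) (at s)" by (auto intro!: derivative_eq_intros)
      from DERIV_chain2[OF that this] show ?thesis
        by (simp add: has_real_derivative_iff_has_vector_derivative has_vector_derivative_at_within)
    qed
    have 1: "((\<lambda>s. Wt (rho x y) (s - t) *\<^sub>R u y s) has_vector_derivative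
        Wt (rho x y) (s - t) *\<^sub>R ut y s + Wtt (rho x y) (s - t) *\<^sub>R u y s) (at s within ?I)"
      using has_vector_derivative_scaleR[of "\<lambda>s. Wt (rho x y) (s - t)" "Wtt (rho x y) (s - t)" s ?I "u y" "ut y s"]
        ds[OF dW(4)[OF rho_ge_1, of x y "s - t"]] has_vector_derivative_at_within[OF ut]
      by (simp add: has_real_derivative_iff_has_vector_derivative)
    have 2: "((\<lambda>s. W (rho x y) (s - t) *\<^sub>R ut y s) has_vector_derivative
        W (rho x y) (s - t) *\<^sub>R utt y s + Wt (rho x y) (s - t) *\<^sub>R ut y s) (at s within ?I)"
      using has_vector_derivative_scaleR[of "\<lambda>s. W (rho x y) (s - t)" "Wt (rho x y) (s - t)" s ?I "ut y" "utt y s"]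
        ds[OF dW(3)[OF rho_ge_1, of x y "s - t"]] has_vector_derivative_at_within[OF utt]
      by (simp add: has_real_derivative_iff_has_vector_derivative)
    have "((\<lambda>s. vol y *\<^sub>R (Wt (rho x y) (s - t) *\<^sub>R u y s - W (rho x y) (s - t) *\<^sub>R ut y s)) has_vector_derivative
       vol y *\<^sub>R ((Wt (rho x y) (s - t) *\<^sub>R ut y s + Wtt (rho x y) (s - t) *\<^sub>R u y s)
         - (W (rho x y) (s - t) *\<^sub>R utt y s + Wt (rho x y) (s - t) *\<^sub>R ut y s))) (at s within ?I)"
      by (rule bounded_linear.has_vector_derivative[OF bounded_linear_scaleR_right has_vector_derivative_diff[OF 1 2]])
    then show "((\<lambda>s. g s y) has_vector_derivative g' s y) (at s within ?I)"
      unfolding g_def g'_def by (simp add: algebra_simps)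
  next
    show "g s integrable_on cbox (- b) b" for s by (intro integrable_continuous cgs)
    show "continuous_on (?I \<times> cbox (- b) b) (\<lambda>(s, y). g' s y)" unfolding split_beta by (rule cg')
  qed
  then have "\<exists>e. \<forall>s\<in>?I. integral (cbox (- b) b) (g s) = e"
    by (intro has_derivative_zero_constant[OF cI]) (simp add: E0 has_vector_derivative_def)
  then have "integral (cbox (- b) b) (g t) = integral (cbox (- b) b) (g 0)" by auto
  \<comment> \<open>Within \<epsilon>0 of the sphere of radius |t| the data vanish; elsewhere the
    kernel does.\<close>
  moreover have "g 0 y = 0" for y
  proof (cases "\<bar>\<bar>t\<bar> - arcosh (2 * rho x y - 1)\<bar> \<le> \<epsilon>0")
    case True
    then show ?thesis using init[OF True] by (simp add: g_def)
  next
    case False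
    then have "\<bar>\<bar>0 - t\<bar> - arcosh (2 * rho x y - 1)\<bar> > \<epsilon>" using \<epsilon>(2) by simp
    from supp[OF rho_ge_1 this] show ?thesis by (simp add: g_def)
  qed
  then have "g 0 = (\<lambda>y. 0)" by auto
  ultimately have int0: "integral (cbox (- b) b) (g t) = 0" by simp
  define G where "G y = g t y \<bullet> u x t" for y
  have Geq: "G y = vol y * Wt (rho x y) 0 * (u y t \<bullet> u x t)" for y
    by (simp add: G_def g_def W0(1) rho_ge_1)
  have cG: "continuous_on (cbox (- b) b) G" unfolding G_def by (intro continuous_intros cgs)
  have "(g t has_integral 0) (cbox (- b) b)"
    using int0 integrable_integral[OF integrable_continuous[OF cgs]] by metis
  from has_integral_linear[OF this bounded_linear_inner_left[of "u x t"]]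
  have "(G has_integral 0) (cbox (- b) b)" by (simp add: G_def[abs_def] o_def)
  moreover have "G y \<ge> 0" for y
  proof (cases "arcosh (2 * rho x y - 1) \<le> \<epsilon>")
    case True
    then show ?thesis unfolding Geq using vol_pos[of y] W0(2)[OF rho_ge_1, of x y] near[OF True] by simp
  next
    case False
    then have "Wt (rho x y) 0 = 0" by (intro supp(2) rho_ge_1) auto
    then show ?thesis by (simp add: Geq)
  qed
  \<comment> \<open>A nonnegative continuous function with integral 0 vanishes at interior points;
    at \<open>x\<close> this contradicts \<open>Wt 1 0 > 0\<close>.\<close>
  moreover have "x \<in> box (- b) b" using box' xr by (auto simp: subset_eq)
  ultimately have "G x = 0"
    using has_integral_0_cbox_imp_0[OF cG, of x] box_subset_cbox by blast
  moreover have "G x > 0" unfolding Geq using vol_pos[of x] W0(3) nz by simp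
  ultimately show False by simp
qed

end

section \<open>The Riemannian distance\<close>

context damek_ricci_space
begin

abbreviation rdist where "rdist x y \<equiv> arcosh (2 * rho x y - 1)"

definition path_length where
  "path_length \<gamma> L \<longleftrightarrow> ((\<lambda>t. sqrt (dr_metric A B c br (\<gamma> t) (vector_derivative \<gamma> (at t)) (vector_derivative \<gamma> (at t))))
        has_integral L) {0..1}"

lemma drho_bound: "\<bar>drho x y w\<bar> \<le> sqrt (rho x y * (rho x y - 1)) * norm (LL y w)"
proof -
  have "norm (LL y (V x y)) = sqrt (rho x y * (rho x y - 1))"
    by (simp add: norm_eq_sqrt_inner drho_metric drho_V)
  then show ?thesis unfolding drho_metric[symmetric]
    by (metis Cauchy_Schwarz_ineq2)
qed

text \<open>A curve may pass through \<open>x\<close>, where \<open>arcosh\<close> is not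
  differentiable. The shift by \<open>d\<close> keeps the argument above 1 and only enlarges the
  denominator, so the gradient bound 1 persists.\<close>

lemma rdist_le_path_length_shifted:
  assumes \<gamma>: "valid_path \<gamma>" and L: "path_length \<gamma> L" and d: "d > 0"
  shows "arcosh (2 * rho x (pathfinish \<gamma>) - 1 + d) - arcosh (2 * rho x (pathstart \<gamma>) - 1 + d) \<le> L"
proof -
  obtain S where S: "finite S" "\<gamma> C1_differentiable_on ({0..1} - S)" and cont: "continuous_on {0..1} \<gamma>"
    using \<gamma> unfolding valid_path_def piecewise_C1_differentiable_on_def by blast
  then obtain D where D: "\<And>t. t \<in> {0..1} - S \<Longrightarrow> (\<gamma> has_vector_derivative D t) (at t)"
    unfolding C1_differentiable_on_def by blast
  have cr: "continuous_on UNIV (rho x)" by (rule C_k_continuous[OF C_k_rho[of 0]])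
  let ?h = "\<lambda>t. arcosh (2 * rho x (\<gamma> t) - 1 + d)"
  \<comment> \<open>At the exceptional points the value 0 is safe, because the speed integrand is
    nonnegative whatever \<open>vector_derivative\<close> returns there.\<close>
  define h' where "h' t = (if t \<in> S then 0 else 1 / sqrt ((2 * rho x (\<gamma> t) - 1 + d)\<^sup>2 - 1) * (2 * drho x (\<gamma> t) (D t)))" for t
  have "(h' has_integral (?h 1 - ?h 0)) {0..1}"
  proof (rule fundamental_theorem_of_calculus_strong[OF S(1)])
    show "continuous_on {0..1} ?h"
    proof (rule continuous_on_arcosh')
      show "continuous_on {0..1} (\<lambda>t. 2 * rho x (\<gamma> t) - 1 + d)"
        by (intro continuous_intros continuous_on_compose2[OF cr cont]) auto
      show "1 \<le> 2 * rho x (\<gamma> t) - 1 + d" for t using rho_ge_1[of x "\<gamma> t"] d by linarith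
    qed
    fix t assume t: "t \<in> {0..1} - S"
    have g1: "2 * rho x (\<gamma> t) - 1 + d > 1" using rho_ge_1[of x "\<gamma> t"] d by linarith
    have "((\<lambda>t. rho x (\<gamma> t)) has_derivative (\<lambda>s. drho x (\<gamma> t) (s *\<^sub>R D t))) (at t)"
      using has_derivative_compose[OF D[OF t, unfolded has_vector_derivative_def] rho_has_derivative] .
    then have "((\<lambda>t. rho x (\<gamma> t)) has_real_derivative drho x (\<gamma> t) (D t)) (at t)"
      unfolding has_field_derivative_def by (simp add: linear_cmul[OF drho_linear] mult_commute_abs)
    from DERIV_chain2[OF arcosh_real_has_field_derivative[OF g1] DERIV_add[OF DERIV_diff[OF DERIV_cmult[OF this, of 2] DERIV_const[of 1]] DERIV_const[of d]]]
    have "(?h has_real_derivative h' t) (at t)" using t by (simp add: h'_def)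
    then show "(?h has_vector_derivative h' t) (at t)"
      by (simp add: has_real_derivative_iff_has_vector_derivative)
  qed simp
  moreover have "h' t \<le> sqrt (dr_metric A B c br (\<gamma> t) (vector_derivative \<gamma> (at t)) (vector_derivative \<gamma> (at t)))"
    if t: "t \<in> {0..1}" for t
  proof (cases "t \<in> S")
    case True
    then show ?thesis by (simp add: h'_def dr_metric_eq)
  next
    case False
    define y r where "y = \<gamma> t" and "r = rho x y"
    have r1: "r \<ge> 1" by (simp add: r_def rho_ge_1)
    have vd: "vector_derivative \<gamma> (at t) = D t" using D[of t] t False by (auto intro: vector_derivative_at)
    have sp: "sqrt (dr_metric A B c br (\<gamma> t) (D t) (D t)) = norm (LL y (D t))"
      by (simp add: dr_metric_eq norm_eq_sqrt_inner y_def)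
    have e: "4 * (r * (r - 1)) = (2 * r - 1)\<^sup>2 - 1" by (simp add: power2_eq_square algebra_simps)
    have "(2 * r - 1)\<^sup>2 \<le> (2 * r - 1 + d)\<^sup>2" using r1 d by (intro power_mono) auto
    then have le: "sqrt (4 * (r * (r - 1))) \<le> sqrt ((2 * r - 1 + d)\<^sup>2 - 1)" unfolding e by simp
    have "1\<^sup>2 < (2 * r - 1 + d)\<^sup>2" using r1 d by (intro power_strict_mono) auto
    then have pos: "sqrt ((2 * r - 1 + d)\<^sup>2 - 1) > 0" by simp
    have "2 * drho x y (D t) \<le> sqrt (4 * (r * (r - 1))) * norm (LL y (D t))"
      using drho_bound[of x y "D t"] by (simp add: r_def real_sqrt_mult)
    also have "\<dots> \<le> sqrt ((2 * r - 1 + d)\<^sup>2 - 1) * norm (LL y (D t))" by (intro mult_right_mono le) simp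
    finally have "h' t \<le> norm (LL y (D t))" using False pos
      by (simp add: h'_def divide_le_eq mult.commute flip: r_def y_def)
    then show ?thesis unfolding vd sp .
  qed
  ultimately have "?h 1 - ?h 0 \<le> L" by (rule has_integral_le[OF _ L[unfolded path_length_def]])
  then show ?thesis by (simp add: pathstart_def pathfinish_def)
qed

lemma rdist_le_path_length:
  assumes "valid_path \<gamma>" "path_length \<gamma> L"
  shows "rdist x (pathfinish \<gamma>) - rdist x (pathstart \<gamma>) \<le> L"
proof (rule tendsto_upperbound)
  show "\<forall>\<^sub>F d in at_right 0. arcosh (2 * rho x (pathfinish \<gamma>) - 1 + d) - arcosh (2 * rho x (pathstart \<gamma>) - 1 + d) \<le> L"
    using rdist_le_path_length_shifted[OF assms] eventually_at_right_less[of "0::real"]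
    by (auto elim: eventually_mono)
  have "((\<lambda>d. arcosh (2 * rho x p - 1 + d)) \<longlongrightarrow> rdist x p) (at_right 0)" for p
  proof -
    have "continuous_on {0..} (\<lambda>d. arcosh (2 * rho x p - 1 + d))"
      using rho_ge_1[of x p] by (intro continuous_on_arcosh' continuous_intros) auto
    then have "((\<lambda>d. arcosh (2 * rho x p - 1 + d)) \<longlongrightarrow> arcosh (2 * rho x p - 1 + 0)) (at 0 within {0..})"
      unfolding continuous_on_def by blast
    from tendsto_within_subset[OF this, of "{0<..}"] show ?thesis by (simp add: greaterThan_subset_iff subset_eq)
  qed
  then show "((\<lambda>d. arcosh (2 * rho x (pathfinish \<gamma>) - 1 + d) - arcosh (2 * rho x (pathstart \<gamma>) - 1 + d))
      \<longlongrightarrow> rdist x (pathfinish \<gamma>) - rdist x (pathstart \<gamma>)) (at_right 0)"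
    by (intro tendsto_diff)
qed simp

text \<open>The squared speed of the Cayley image of a ray, with P = |\<xi>|^2 and R = |\<eta>|^2.
  The three terms on the left are the \<open>A\<close>, \<open>B\<close> and \<open>c\<close> parts;
  the right side is the squared speed 2 sqrt n / (1 - t^2 n) of a ray in the ball model.
  \<open>D'\<close> is the t-derivative of \<open>D\<close>.\<close>

lemma geodesic_identity:
  fixes P R s t :: real
  defines "n \<equiv> P + R + s\<^sup>2" and "\<sigma> \<equiv> 1 - s * t"
  defines "D \<equiv> \<sigma>\<^sup>2 + R * t\<^sup>2" and "D' \<equiv> - (2 * s * \<sigma>) + 2 * R * t" and "q \<equiv> 1 - t\<^sup>2 * n"
  assumes D: "D > 0" and q: "q > 0"
  shows "4 * P / (D * q) + 4 * R / D\<^sup>2 + (2 * t * n / q + D' / D)\<^sup>2 = 4 * n / q\<^sup>2"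
proof -
  have 1: "D'\<^sup>2 + 4 * R = 4 * (s\<^sup>2 + R) * D"
    unfolding D'_def D_def \<sigma>_def by (simp add: power2_eq_square algebra_simps)
  have 2: "P + (s\<^sup>2 + R) * q + t * n * D' = n * D"
    unfolding D'_def D_def \<sigma>_def q_def n_def by (simp add: power2_eq_square algebra_simps)
  have "D\<^sup>2 * q\<^sup>2 * (4 * P / (D * q) + 4 * R / D\<^sup>2 + (2 * t * n / q + D' / D)\<^sup>2)
      = 4 * P * D * q + q\<^sup>2 * (D'\<^sup>2 + 4 * R) + 4 * t * n * D' * q * D + 4 * t\<^sup>2 * n\<^sup>2 * D\<^sup>2"
    using D q by (simp add: field_simps power2_eq_square)
  also have "\<dots> = 4 * D * q * (P + (s\<^sup>2 + R) * q + t * n * D') + 4 * t\<^sup>2 * n\<^sup>2 * D\<^sup>2"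
    unfolding 1 by (simp add: power2_eq_square algebra_simps)
  also have "\<dots> = 4 * n * D\<^sup>2 * (q + t\<^sup>2 * n)"
    unfolding 2 by (simp add: power2_eq_square algebra_simps)
  also have "\<dots> = D\<^sup>2 * q\<^sup>2 * (4 * n / q\<^sup>2)" using q by (simp add: q_def)
  finally have "q\<^sup>2 * (4 * P / (D * q) + 4 * R / D\<^sup>2 + (2 * t * n / q + D' / D)\<^sup>2) = 4 * n"
    using D q by simp
  then show ?thesis using q by (simp add: eq_divide_eq mult.commute)
qed

text \<open>Inside the unit ball |s| < 1 and n < 1 keep both denominators positive. The four
  functions are the scalar coefficients of the Cayley image of the ray.\<close>

lemma geodesic_derivatives:
  fixes R s t n :: real
  assumes n: "s\<^sup>2 \<le> n" "R \<ge> 0" "n < 1" and t: "t \<in> {0..1}"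
  shows "(1 - s * t)\<^sup>2 + R * t\<^sup>2 > 0" "1 - t\<^sup>2 * n > 0"
    and "((\<lambda>t. 2 * t * (1 - s * t) / ((1 - s * t)\<^sup>2 + R * t\<^sup>2)) has_real_derivative
        2 * ((1 - s * t)\<^sup>2 - R * t\<^sup>2) / ((1 - s * t)\<^sup>2 + R * t\<^sup>2)\<^sup>2) (at t)"
    and "((\<lambda>t. 2 * t\<^sup>2 / ((1 - s * t)\<^sup>2 + R * t\<^sup>2)) has_real_derivative
        4 * t * (1 - s * t) / ((1 - s * t)\<^sup>2 + R * t\<^sup>2)\<^sup>2) (at t)"
    and "((\<lambda>t. 2 * t / ((1 - s * t)\<^sup>2 + R * t\<^sup>2)) has_real_derivative
        2 * (1 - s\<^sup>2 * t\<^sup>2 - R * t\<^sup>2) / ((1 - s * t)\<^sup>2 + R * t\<^sup>2)\<^sup>2) (at t)"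
    and "((\<lambda>t. ln ((1 - t\<^sup>2 * n) / ((1 - s * t)\<^sup>2 + R * t\<^sup>2))) has_real_derivative
        - (2 * t * n / (1 - t\<^sup>2 * n) + (- (2 * s * (1 - s * t)) + 2 * R * t) / ((1 - s * t)\<^sup>2 + R * t\<^sup>2))) (at t)"
proof -
  have "s\<^sup>2 < 1\<^sup>2" using n by simp
  then have "\<bar>s\<bar> < 1" using abs_square_less_1 by force
  moreover have "s * t \<le> \<bar>s\<bar> * 1"
    using t abs_ge_self[of "s * t"] mult_left_mono[of t 1 "\<bar>s\<bar>"] by (simp add: abs_mult)
  ultimately have "1 - s * t > 0" by simp
  then show D: "(1 - s * t)\<^sup>2 + R * t\<^sup>2 > 0" using n(2) by (intro add_pos_nonneg) auto
  have "t\<^sup>2 \<le> 1" using t by (simp add: power_le_one)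
  moreover have "n \<ge> 0" using n(1) zero_le_power2[of s] by linarith
  ultimately have "t\<^sup>2 * n \<le> 1 * n" by (intro mult_right_mono)
  then show q: "1 - t\<^sup>2 * n > 0" using n by linarith
  have nz: "(1 - s * t)\<^sup>2 + R * t\<^sup>2 \<noteq> 0" using D by simp
  have dD: "((\<lambda>t. (1 - s * t)\<^sup>2 + R * t\<^sup>2) has_real_derivative - (2 * s * (1 - s * t)) + 2 * R * t) (at t)"
    by (auto intro!: derivative_eq_intros simp: algebra_simps)
  have q2: "(x * D - y * E) / (D * D) = z / D\<^sup>2" if "x * D - y * E = z" for x y z D E :: real
    using that by (simp add: power2_eq_square)
  have "((\<lambda>t. 2 * t * (1 - s * t)) has_real_derivative 2 - 4 * s * t) (at t)"
    by (auto intro!: derivative_eq_intros simp: algebra_simps)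
  from DERIV_divide[OF this dD nz]
  show "((\<lambda>t. 2 * t * (1 - s * t) / ((1 - s * t)\<^sup>2 + R * t\<^sup>2)) has_real_derivative
        2 * ((1 - s * t)\<^sup>2 - R * t\<^sup>2) / ((1 - s * t)\<^sup>2 + R * t\<^sup>2)\<^sup>2) (at t)"
    by (rule DERIV_cong) (rule q2, simp add: power2_eq_square algebra_simps)
  have "((\<lambda>t. 2 * t\<^sup>2) has_real_derivative 4 * t) (at t)"
    by (auto intro!: derivative_eq_intros)
  from DERIV_divide[OF this dD nz]
  show "((\<lambda>t. 2 * t\<^sup>2 / ((1 - s * t)\<^sup>2 + R * t\<^sup>2)) has_real_derivative
        4 * t * (1 - s * t) / ((1 - s * t)\<^sup>2 + R * t\<^sup>2)\<^sup>2) (at t)"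
    by (rule DERIV_cong) (rule q2, simp add: power2_eq_square algebra_simps)
  have "((\<lambda>t. 2 * t) has_real_derivative 2) (at t)"
    by (auto intro!: derivative_eq_intros)
  from DERIV_divide[OF this dD nz]
  show "((\<lambda>t. 2 * t / ((1 - s * t)\<^sup>2 + R * t\<^sup>2)) has_real_derivative
        2 * (1 - s\<^sup>2 * t\<^sup>2 - R * t\<^sup>2) / ((1 - s * t)\<^sup>2 + R * t\<^sup>2)\<^sup>2) (at t)"
    by (rule DERIV_cong) (rule q2, simp add: power2_eq_square algebra_simps)
  have "((\<lambda>t. 1 - t\<^sup>2 * n) has_real_derivative - (2 * t * n)) (at t)"
    by (auto intro!: derivative_eq_intros)
  from DERIV_divide[OF this dD nz]
  have dq: "((\<lambda>t. (1 - t\<^sup>2 * n) / ((1 - s * t)\<^sup>2 + R * t\<^sup>2)) has_real_derivative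
      (- (2 * t * n) * ((1 - s * t)\<^sup>2 + R * t\<^sup>2) - (1 - t\<^sup>2 * n) * (- (2 * s * (1 - s * t)) + 2 * R * t))
        / (((1 - s * t)\<^sup>2 + R * t\<^sup>2) * ((1 - s * t)\<^sup>2 + R * t\<^sup>2))) (at t)" .
  have al: "(- T * D - q * E) / (D * D) / (q / D) = - (T / q + E / D)" if "D > 0" "q > 0" for T D q E :: real
    using that by (simp add: field_simps)
  have pos: "(1 - t\<^sup>2 * n) / ((1 - s * t)\<^sup>2 + R * t\<^sup>2) > 0" using D q by simp
  have eq: "1 / z * y = y / z" for y z :: real by simp
  show "((\<lambda>t. ln ((1 - t\<^sup>2 * n) / ((1 - s * t)\<^sup>2 + R * t\<^sup>2))) has_real_derivative
        - (2 * t * n / (1 - t\<^sup>2 * n) + (- (2 * s * (1 - s * t)) + 2 * R * t) / ((1 - s * t)\<^sup>2 + R * t\<^sup>2))) (at t)"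
    by (rule DERIV_cong[OF DERIV_chain2[OF DERIV_ln_divide[OF pos] dq]]) (unfold eq, rule al[OF D q])
qed

text \<open>
  The geodesic is the translate by \<open>x\<close> of the image of a ray \<open>{t (\<xi>, \<eta>, s)}\<close> of the unit ball under the
  Cayley transform. The point \<open>(\<xi>, \<eta>, s)\<close> is the inverse Cayley transform of
  \<open>x\<^sup>-\<^sup>1 y = (X, Y, ln a)\<close>.
\<close>

lemma geodesic_exists:
  "\<exists>\<gamma>. valid_path \<gamma> \<and> pathstart \<gamma> = x \<and> pathfinish \<gamma> = y \<and> path_length \<gamma> (rdist x y)"
proof -
  define b sb where "b = exp (x $ c)" and "sb = exp (x $ c / 2)"
  have b: "b > 0" "sb > 0" "sb * sb = b" by (auto simp: b_def sb_def simp flip: exp_add)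
  define a where "a = exp (y $ c - x $ c)"
  have a: "a > 0" by (simp add: a_def)
  define X where "X = (1 / sb) *\<^sub>R X1 x y"
  define Y where "Y = (1 / b) *\<^sub>R Y1 x y"
  have XY [simp]: "pA X = X" "pB X = 0" "X $ c = 0" "pA Y = 0" "pB Y = Y" "Y $ c = 0"
    by (simp_all add: X_def Y_def)
  define h where "h = a + (X \<bullet> X) / 4"
  define YY where "YY = Y \<bullet> Y"
  define den where "den = (1 + h)\<^sup>2 + YY"
  have h: "h > 0" unfolding h_def using a by (intro add_pos_nonneg) auto
  have YY: "YY \<ge> 0" by (simp add: YY_def)
  have den: "den > 0" unfolding den_def using h YY by (intro add_pos_nonneg) auto
  define \<xi> where "\<xi> = (1 / den) *\<^sub>R ((1 + h) *\<^sub>R X - JJ Y X)"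
  define \<eta> where "\<eta> = (2 / den) *\<^sub>R Y"
  define s where "s = (h\<^sup>2 + YY - 1) / den"
  define P R n where "P = \<xi> \<bullet> \<xi>" and "R = \<eta> \<bullet> \<eta>" and "n = P + R + s\<^sup>2"
  have proj [simp]: "pA \<xi> = \<xi>" "pB \<xi> = 0" "\<xi> $ c = 0" "pA \<eta> = 0" "pB \<eta> = \<eta>" "\<eta> $ c = 0"
    by (simp_all add: \<xi>_def \<eta>_def)
  have PR: "P \<ge> 0" "R \<ge> 0" by (simp_all add: P_def R_def)
  have s1: "1 - s = 2 * (1 + h) / den" "1 + s = 2 * (h * (1 + h) + YY) / den"
    unfolding s_def using den by (simp_all add: den_def field_simps power2_eq_square)
  have R': "R = 4 * YY / den\<^sup>2" by (simp add: R_def \<eta>_def YY_def power2_eq_square)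
  have P': "P = (X \<bullet> X) / den"
  proof -
    have "(( 1 + h) *\<^sub>R X - JJ Y X) \<bullet> ((1 + h) *\<^sub>R X - JJ Y X) = den * (X \<bullet> X)"
      using JJ_norm[of Y X] JJ_skew[of Y X]
      by (simp add: inner_diff_left inner_diff_right inner_commute[of X "JJ Y X"] den_def YY_def power2_eq_square algebra_simps)
    then show ?thesis using den by (simp add: P_def \<xi>_def)
  qed
  \<comment> \<open>Since \<rho> = den / (4 a), this says 1 - n = 1 / \<rho>, so n = tanh^2
    (r/2).\<close>
  have n1: "1 - n = 4 * a / den"
  proof -
    have "1 - n = (1 - s) * (1 + s) - R - P" by (simp add: n_def power2_eq_square algebra_simps)
    also have "\<dots> = 4 * (h * ((1 + h)\<^sup>2 + YY)) / den\<^sup>2 - P"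
      unfolding s1 R' using den by (simp add: field_simps power2_eq_square)
    also have "\<dots> = 4 * h / den - P" unfolding den_def[symmetric] using den by (simp add: power2_eq_square)
    also have "\<dots> = 4 * a / den" unfolding P' using den by (simp add: h_def field_simps)
    finally show ?thesis .
  qed
  have "4 * a / den > 0" using a den by simp
  then have nle: "s\<^sup>2 \<le> n" "n < 1" using PR n1 by (simp add: n_def, linarith)
  have n0: "n \<ge> 0" using nle(1) zero_le_power2[of s] by linarith
  define D where "D t = (1 - s * t)\<^sup>2 + R * t\<^sup>2" for t
  define f where "f t = 2 * t * (1 - s * t) / D t" for t
  define g where "g t = 2 * t\<^sup>2 / D t" for t
  define e where "e t = 2 * t / D t" for t
  define l where "l t = ln ((1 - t\<^sup>2 * n) / D t)" for t
  define f' where "f' t = 2 * ((1 - s * t)\<^sup>2 - R * t\<^sup>2) / (D t)\<^sup>2" for t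
  define g' where "g' t = 4 * t * (1 - s * t) / (D t)\<^sup>2" for t
  define e' where "e' t = 2 * (1 - s\<^sup>2 * t\<^sup>2 - R * t\<^sup>2) / (D t)\<^sup>2" for t
  define l' where "l' t = - (2 * t * n / (1 - t\<^sup>2 * n) + (- (2 * s * (1 - s * t)) + 2 * R * t) / D t)" for t
  note gd = geodesic_derivatives[OF nle(1) PR(2) nle(2)]
  have Dpos: "D t > 0" "1 - t\<^sup>2 * n > 0" if "t \<in> {0..1}" for t using gd(1,2)[OF that] by (simp_all add: D_def)
  have d: "(f has_real_derivative f' t) (at t)" "(g has_real_derivative g' t) (at t)"
    "(e has_real_derivative e' t) (at t)" "(l has_real_derivative l' t) (at t)" if "t \<in> {0..1}" for t
    using gd(3-6)[OF that] unfolding f_def[abs_def] g_def[abs_def] e_def[abs_def] l_def[abs_def] f'_def g'_def e'_def l'_def D_def by simp_all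
  define GX where "GX t = f t *\<^sub>R \<xi> + g t *\<^sub>R JJ \<eta> \<xi>" for t
  define GX' where "GX' t = f' t *\<^sub>R \<xi> + g' t *\<^sub>R JJ \<eta> \<xi>" for t
  define \<Gamma> where "\<Gamma> t = (pA x + sb *\<^sub>R GX t) + (pB x + (b * e t) *\<^sub>R \<eta> + (sb / 2) *\<^sub>R bb x (GX t)) + axis c (x $ c + l t)" for t
  define \<Gamma>' where "\<Gamma>' t = sb *\<^sub>R GX' t + ((b * e' t) *\<^sub>R \<eta> + (sb / 2) *\<^sub>R bb x (GX' t)) + axis c (l' t)" for t
  have GXp [simp]: "pA (GX t) = GX t" "pB (GX t) = 0" "GX t $ c = 0" "pA (GX' t) = GX' t" "pB (GX' t) = 0" "GX' t $ c = 0" for t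
    by (simp_all add: GX_def GX'_def)
  have dv: "(\<Gamma> has_vector_derivative \<Gamma>' t) (at t)" if t: "t \<in> {0..1}" for t
  proof -
    note hv = d[OF t, unfolded has_real_derivative_iff_has_vector_derivative]
    have sc: "((\<lambda>t. F t *\<^sub>R v) has_vector_derivative F' *\<^sub>R v) (at t)" if "(F has_vector_derivative F') (at t)"
      for F F' and v :: "real ^ 'n"
      by (rule bounded_linear.has_vector_derivative[OF bounded_linear_scaleR_left that])
    have gx: "(GX has_vector_derivative GX' t) (at t)"
      unfolding GX_def[abs_def] GX'_def by (intro has_vector_derivative_add sc hv)
    have bx: "((\<lambda>t. bb x (GX t)) has_vector_derivative bb x (GX' t)) (at t)"
      by (rule bounded_linear.has_vector_derivative[OF bounded_bilinear.bounded_linear_right[OF bb_bounded] gx])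
    have lin: "bounded_linear (axis c :: real \<Rightarrow> real ^ 'n)"
      by (rule linear_conv_bounded_linear[THEN iffD1]) (auto simp: linear_iff axis_add axis_scale)
    have "((\<lambda>t. (pA x + sb *\<^sub>R GX t) + (pB x + e t *\<^sub>R (b *\<^sub>R \<eta>) + (sb / 2) *\<^sub>R bb x (GX t)) + axis c (x $ c + l t)) has_vector_derivative
       (0 + sb *\<^sub>R GX' t) + (0 + e' t *\<^sub>R (b *\<^sub>R \<eta>) + (sb / 2) *\<^sub>R bb x (GX' t)) + axis c (0 + l' t)) (at t)"
      by (intro has_vector_derivative_add has_vector_derivative_const sc hv
          bounded_linear.has_vector_derivative[OF bounded_linear_scaleR_right] gx bx
          bounded_linear.has_vector_derivative[OF lin])
    then show ?thesis unfolding \<Gamma>_def[abs_def] \<Gamma>'_def by (simp add: mult.commute)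
  qed
  have c\<Gamma>': "continuous_on {0..1} \<Gamma>'"
  proof -
    have cD: "continuous_on {0..1} D" unfolding D_def[abs_def] by (intro continuous_intros)
    have nz: "\<forall>t\<in>{0..1}. (D t)\<^sup>2 \<noteq> 0" "\<forall>t\<in>{0..1}. D t \<noteq> 0" "\<forall>t\<in>{0..1}. 1 - t\<^sup>2 * n \<noteq> 0"
      using Dpos by (force simp: less_imp_neq)+
    have c1: "continuous_on {0..1} f'" "continuous_on {0..1} g'" "continuous_on {0..1} e'" "continuous_on {0..1} l'"
      unfolding f'_def[abs_def] g'_def[abs_def] e'_def[abs_def] l'_def[abs_def]
      by (intro continuous_intros cD nz)+
    have cgx: "continuous_on {0..1} GX'" unfolding GX'_def[abs_def] by (intro continuous_intros c1)
    have "axis c (l' t) = l' t *\<^sub>R axis c 1" for t by (simp add: axis_scale[symmetric])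
    then show ?thesis unfolding \<Gamma>'_def[abs_def]
      by (simp only:) (intro continuous_intros c1 cgx bounded_bilinear.continuous_on[OF bb_bounded])
  qed
  have speed: "sqrt (dr_metric A B c br (\<Gamma> t) (\<Gamma>' t) (\<Gamma>' t)) = 2 * sqrt n / (1 - t\<^sup>2 * n)" if t: "t \<in> {0..1}" for t
  proof -
    note Dq = Dpos[OF t]
    define q where "q = 1 - t\<^sup>2 * n"
    have q: "q > 0" using Dq by (simp add: q_def)
    define \<alpha> where "\<alpha> = q / D t"
    have \<alpha>: "\<alpha> > 0" using q Dq by (simp add: \<alpha>_def)
    have El: "exp (l t) = \<alpha>" using \<alpha> by (simp add: l_def \<alpha>_def q_def)
    define E where "E = exp (- (x $ c + l t) / 2)"
    have E2: "E * E = 1 / (b * \<alpha>)" unfolding E_def b_def El[symmetric] by (simp add: exp_minus exp_add field_simps flip: exp_add)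
    \<comment> \<open>By \<open>bb_JJ\<close> the bracket of \<xi> and J_\<eta> \<xi> is a multiple
      of \<eta>, so the \<open>B\<close>-component of the velocity stays on that line.\<close>
    have bGG: "bb (GX t) (GX' t) = (4 * t\<^sup>2 / (D t)\<^sup>2) *\<^sub>R (P *\<^sub>R \<eta>)"
    proof -
      have j: "bb \<xi> (JJ \<eta> \<xi>) = P *\<^sub>R \<eta>" "bb (JJ \<eta> \<xi>) \<xi> = - (P *\<^sub>R \<eta>)"
        using bb_JJ[of \<xi> \<eta>] bb_skew[of "JJ \<eta> \<xi>" \<xi>] by (simp_all add: P_def)
      have "bb (GX t) (GX' t) = (f t * g' t - g t * f' t) *\<^sub>R (P *\<^sub>R \<eta>)"
        unfolding GX_def GX'_def by (simp add: bb_simps j algebra_simps)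
      also have "f t * g' t - g t * f' t = 4 * t\<^sup>2 * (2 * (1 - s * t)\<^sup>2 - ((1 - s * t)\<^sup>2 - R * t\<^sup>2)) / (D t * (D t)\<^sup>2)"
        unfolding f_def g_def f'_def g'_def using Dq by (simp add: field_simps power2_eq_square)
      also have "\<dots> = 4 * t\<^sup>2 * D t / (D t * (D t)\<^sup>2)" by (simp add: D_def)
      also have "\<dots> = 4 * t\<^sup>2 / (D t)\<^sup>2" using Dq by simp
      finally show ?thesis .
    qed
    have p: "pA (\<Gamma> t) = pA x + sb *\<^sub>R GX t" "\<Gamma> t $ c = x $ c + l t" "pA (\<Gamma>' t) = sb *\<^sub>R GX' t"
      "pB (\<Gamma>' t) = (b * e' t) *\<^sub>R \<eta> + (sb / 2) *\<^sub>R bb x (GX' t)" "\<Gamma>' t $ c = l' t"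
      by (simp_all add: \<Gamma>_def \<Gamma>'_def axis_nth)
    have "bb (\<Gamma> t) (\<Gamma>' t) = bb (pA (\<Gamma> t)) (pA (\<Gamma>' t))" by simp
    also have "\<dots> = sb *\<^sub>R bb x (GX' t) + b *\<^sub>R bb (GX t) (GX' t)"
      unfolding p by (simp add: bb_simps scaleR_add_right flip: b(3))
    finally have "pB (\<Gamma>' t) - (1/2) *\<^sub>R bb (\<Gamma> t) (\<Gamma>' t) = (b * (e' t - 2 * t\<^sup>2 / (D t)\<^sup>2 * P)) *\<^sub>R \<eta>"
      unfolding p bGG by (simp add: algebra_simps)
    also have "e' t - 2 * t\<^sup>2 / (D t)\<^sup>2 * P = 2 * q / (D t)\<^sup>2"
      unfolding e'_def q_def n_def using Dq by (simp add: field_simps)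
    also have "2 * q / (D t)\<^sup>2 = 2 * \<alpha> / D t" by (simp add: \<alpha>_def power2_eq_square)
    finally have Bp: "pB (\<Gamma>' t) - (1/2) *\<^sub>R bb (\<Gamma> t) (\<Gamma>' t) = (b * (2 * \<alpha> / D t)) *\<^sub>R \<eta>" .
    have "exp (- (x $ c + l t)) * (b * (2 * \<alpha> / D t)) = 2 / D t"
      using b \<alpha> by (simp add: b_def exp_minus exp_diff exp_add El field_simps)
    then have LG: "LL (\<Gamma> t) (\<Gamma>' t) = (E * sb) *\<^sub>R GX' t + (2 / D t) *\<^sub>R \<eta> + axis c (l' t)"
      unfolding LL_def Bp unfolding p E_def by simp
    have GG: "GX' t \<bullet> GX' t = 4 * P / (D t)\<^sup>2"
    proof -
      have "GX' t \<bullet> GX' t = P * ((f' t)\<^sup>2 + R * (g' t)\<^sup>2)"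
        unfolding GX'_def using JJ_norm[of \<eta> \<xi>] JJ_skew[of \<eta> \<xi>]
        by (simp add: inner_add_left inner_add_right inner_commute[of \<xi> "JJ \<eta> \<xi>"] P_def R_def power2_eq_square algebra_simps)
      also have "(f' t)\<^sup>2 + R * (g' t)\<^sup>2 = 4 * (((1 - s * t)\<^sup>2 - R * t\<^sup>2)\<^sup>2 + 4 * (R * t\<^sup>2) * (1 - s * t)\<^sup>2) / ((D t)\<^sup>2)\<^sup>2"
      proof -
        have "(2 * M / K)\<^sup>2 + R * (4 * t * N / K)\<^sup>2 = 4 * (M\<^sup>2 + 4 * (R * t\<^sup>2) * N\<^sup>2) / K\<^sup>2" for M N K :: real
          by (simp add: power_divide power_mult_distrib add_divide_distrib)
        then show ?thesis unfolding f'_def g'_def .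
      qed
      also have "((1 - s * t)\<^sup>2 - R * t\<^sup>2)\<^sup>2 + 4 * (R * t\<^sup>2) * (1 - s * t)\<^sup>2 = (D t)\<^sup>2"
        unfolding D_def by (simp add: power2_eq_square algebra_simps)
      finally show ?thesis using Dq by (simp add: power2_eq_square)
    qed
    have orth: "GX' t \<bullet> \<eta> = 0" "\<eta> \<bullet> GX' t = 0"
      using inner_proj_on_swap[of A "GX' t" \<eta>] by (simp_all add: inner_commute)
    have "LL (\<Gamma> t) (\<Gamma>' t) \<bullet> LL (\<Gamma> t) (\<Gamma>' t) = (E * E) * (sb * sb) * (4 * P / (D t)\<^sup>2) + (2 / D t)\<^sup>2 * R + (l' t)\<^sup>2"
      unfolding LG by (simp add: inner_add_left inner_add_right inner_axis inner_axis' axis_nth orth GG R_def power2_eq_square)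
    also have "\<dots> = 4 * P / (D t * q) + 4 * R / (D t)\<^sup>2 + (2 * t * n / q + (- (2 * s * (1 - s * t)) + 2 * R * t) / D t)\<^sup>2"
      unfolding E2 b(3) l'_def q_def[symmetric] \<alpha>_def using b q Dq by (simp add: power2_eq_square field_simps)
    also have "\<dots> = 4 * n / q\<^sup>2"
      using geodesic_identity[of s t R P] Dq q unfolding D_def q_def n_def by simp
    also have "\<dots> = (2 * sqrt n / q)\<^sup>2" using n0 by (simp add: power_divide power_mult_distrib)
    finally have "dr_metric A B c br (\<Gamma> t) (\<Gamma>' t) (\<Gamma>' t) = (2 * sqrt n / q)\<^sup>2" by (simp add: dr_metric_eq)
    then show ?thesis using q n0 unfolding q_def[symmetric] by simp
  qed
  have start: "\<Gamma> 0 = x"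
  proof -
    have "GX 0 = 0" "e 0 = 0" "l 0 = 0" by (simp_all add: GX_def f_def g_def e_def l_def D_def)
    then show ?thesis using decompose[of x] by (simp add: \<Gamma>_def bb_simps)
  qed
  have finish: "\<Gamma> 1 = y"
  proof -
    have "(1 - s)\<^sup>2 + R = 4 * ((1 + h)\<^sup>2 + YY) / den\<^sup>2"
      unfolding s1 R' power_divide power_mult_distrib by (simp add: add_divide_distrib[symmetric])
    then have D1: "D 1 = 4 / den" unfolding den_def[symmetric] D_def using den by (simp add: power2_eq_square)
    have f1: "f 1 = 1 + h" "g 1 = den / 2" "e 1 = den / 2"
      unfolding f_def g_def e_def D1 using s1(1) den by simp_all
    have G1: "GX 1 = X"
    proof -
      have "(den / 2) *\<^sub>R JJ \<eta> \<xi> = JJ Y \<xi>" using den by (simp add: \<eta>_def JJ_simps)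
      \<comment> \<open>Expanding with J_Y^2 = -|Y|^2 cancels the mixed terms and leaves ((1 + h)^2
        + |Y|^2) X = den X.\<close>
      then have "GX 1 = (1 / den) *\<^sub>R ((1 + h) *\<^sub>R ((1 + h) *\<^sub>R X - JJ Y X) + ((1 + h) *\<^sub>R JJ Y X - JJ Y (JJ Y X)))"
      proof -
        have "JJ Y \<xi> = (1 / den) *\<^sub>R ((1 + h) *\<^sub>R JJ Y X - JJ Y (JJ Y X))" by (simp add: \<xi>_def JJ_simps)
        moreover have "(1 + h) *\<^sub>R \<xi> = (1 / den) *\<^sub>R ((1 + h) *\<^sub>R ((1 + h) *\<^sub>R X - JJ Y X))"
          unfolding \<xi>_def by (rule scaleR_left_commute)
        ultimately show ?thesis
          using \<open>(den / 2) *\<^sub>R JJ \<eta> \<xi> = JJ Y \<xi>\<close> unfolding GX_def f1 scaleR_add_right by simp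
      qed
      also have "JJ Y (JJ Y X) = - (YY *\<^sub>R X)" unfolding JJ_JJ by (simp add: YY_def power2_norm_eq_inner)
      also have "(1 + h) *\<^sub>R ((1 + h) *\<^sub>R X - JJ Y X) + ((1 + h) *\<^sub>R JJ Y X - - (YY *\<^sub>R X)) = den *\<^sub>R X"
        unfolding den_def by (simp add: vec_eq_iff algebra_simps power2_eq_square)
      finally show ?thesis using den by simp
    qed
    have "l 1 = ln a" unfolding l_def D1 using n1 den by simp
    then have l1: "x $ c + l 1 = y $ c" by (simp add: a_def)
    have e1: "(b * e 1) *\<^sub>R \<eta> = Y1 x y" unfolding f1 \<eta>_def Y_def using den b by simp
    have x1: "sb *\<^sub>R X = X1 x y" using b by (simp add: X_def)
    have "bb x X = (1 / sb) *\<^sub>R bb x (X1 x y)" by (simp add: X_def bb_simps)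
    also have "bb x (X1 x y) = bb x y" by (simp add: X1_def bb_simps)
    finally have "(sb / 2) *\<^sub>R bb x X = (1/2) *\<^sub>R bb x y" using b by simp
    then have "\<Gamma> 1 = (pA x + X1 x y) + (pB x + Y1 x y + (1/2) *\<^sub>R bb x y) + axis c (y $ c)"
      unfolding \<Gamma>_def G1 e1 l1 x1 by simp
    also have "\<dots> = pA y + pB y + axis c (y $ c)" by (simp add: X1_def Y1_def)
    finally show ?thesis by (simp add: decompose)
  qed
  have rho_n: "rho x y = 1 / (1 - n)"
  proof -
    have N: "NN x y = b * (1 + h)"
    proof -
      have "X1 x y \<bullet> X1 x y = b * (X \<bullet> X)" using b by (simp add: X_def field_simps)
      moreover have "exp (y $ c) = b * a" by (simp add: a_def b_def flip: exp_add)
      ultimately show ?thesis by (simp add: NN_def h_def b_def[symmetric] algebra_simps)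
    qed
    have Yb: "Y1 x y \<bullet> Y1 x y = b\<^sup>2 * YY" using b by (simp add: YY_def Y_def power2_eq_square)
    have ey: "exp (x $ c) = b" "exp (y $ c) = b * a" by (simp_all add: a_def b_def flip: exp_add)
    have "b\<^sup>2 * (1 + h)\<^sup>2 + b\<^sup>2 * YY = 4 * b * (b * a) * rho x y"
      using rho_eq[of x y] unfolding N Yb ey power_mult_distrib .
    then have "b\<^sup>2 * den = 4 * b * (b * a) * rho x y" unfolding den_def distrib_left .
    then have "b\<^sup>2 * den = b\<^sup>2 * (4 * a * rho x y)" by (simp add: power2_eq_square mult_ac)
    then have "den = 4 * a * rho x y" using b by simp
    then show ?thesis unfolding n1 using a den by (simp add: field_simps)
  qed
  have len: "((\<lambda>t. 2 * sqrt n / (1 - t\<^sup>2 * n)) has_integral rdist x y) {0..1}"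
  proof -
    define w where "w = sqrt n"
    have w: "w \<ge> 0" "w < 1" "w\<^sup>2 = n" using n0 nle by (auto simp: w_def)
    have wt: "1 + t * w > 0" "1 - t * w > 0" if "t \<in> {0..1}" for t
    proof -
      have "t * w \<le> 1 * w" using that w by (intro mult_right_mono) auto
      moreover have "t * w \<ge> 0" using that w by simp
      ultimately show "1 + t * w > 0" "1 - t * w > 0" using w by linarith+
    qed
    let ?F = "\<lambda>t. ln (1 + t * w) - ln (1 - t * w)"
    have "((\<lambda>t. 2 * w / (1 - t\<^sup>2 * n)) has_integral ?F 1 - ?F 0) {0..1}"
    proof (rule fundamental_theorem_of_calculus)
      fix t :: real assume t: "t \<in> {0..1}"
      have "(?F has_real_derivative w / (1 + t * w) + w / (1 - t * w)) (at t within {0..1})"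
        using wt[OF t] by (auto intro!: derivative_eq_intros simp: divide_simps)
      moreover have "w / (1 + t * w) + w / (1 - t * w) = 2 * w / (1 - t\<^sup>2 * n)"
      proof -
        have "1 - t\<^sup>2 * n = (1 + t * w) * (1 - t * w)" unfolding w(3)[symmetric] by (simp add: power2_eq_square algebra_simps)
        then show ?thesis using wt[OF t] by (simp add: field_simps)
      qed
      ultimately show "(?F has_vector_derivative 2 * w / (1 - t\<^sup>2 * n)) (at t within {0..1})"
        by (simp add: has_real_derivative_iff_has_vector_derivative)
    qed simp
    moreover have "?F 1 - ?F 0 = rdist x y"
    proof -
      \<comment> \<open>L is 2 artanh (sqrt n), and cosh L = (1 + n) / (1 - n) = 2 \<rho> -
        1.\<close>
      define L where "L = ln ((1 + w) / (1 - w))"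
      have "(1 + w) / (1 - w) \<ge> 1" using w by simp
      then have "L \<ge> 0" by (simp add: L_def)
      have "exp L = (1 + w) / (1 - w)" using w by (simp add: L_def)
      then have "cosh L = ((1 + w) / (1 - w) + (1 - w) / (1 + w)) / 2"
        unfolding cosh_def by (simp add: exp_minus)
      also have "\<dots> = (1 + n) / (1 - n)"
      proof -
        have e1: "1 - n = (1 + w) * (1 - w)" and e2: "1 + n = ((1 + w) * (1 + w) + (1 - w) * (1 - w)) / 2"
          unfolding w(3)[symmetric] by (simp_all add: power2_eq_square algebra_simps)
        have *: "(p / q + q / p) / 2 = (p * p + q * q) / 2 / (p * q)" if "p \<noteq> 0" "q \<noteq> 0" for p q :: real
          using that by (simp add: field_simps)
        show ?thesis unfolding e1 e2 by (rule *) (use w in auto)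
      qed
      also have "\<dots> = 2 * rho x y - 1" unfolding rho_n using nle by (simp add: field_simps)
      finally have "rdist x y = L" using arcosh_cosh_real[OF \<open>L \<ge> 0\<close>] by simp
      then show ?thesis using w by (simp add: L_def ln_div)
    qed
    ultimately show ?thesis by (simp add: w_def)
  qed
  have "valid_path \<Gamma>"
    unfolding valid_path_def
    by (rule C1_differentiable_imp_piecewise)
      (unfold C1_differentiable_on_def, rule exI[of _ \<Gamma>'], use dv c\<Gamma>' in blast)
  moreover have "path_length \<Gamma> (rdist x y)"
    unfolding path_length_def
    by (rule has_integral_eq[OF _ len]) (use speed vector_derivative_at[OF dv] in simp)
  ultimately show ?thesis using start finish by (auto simp: pathstart_def pathfinish_def)
qed

text \<open>The geodesic attains the lower bound \<open>rdist_le_path_length\<close>, whose starting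
  value \<open>rdist x x\<close> is 0, so the infimum is a minimum.\<close>

lemma riem_dist_eq: "riem_dist (dr_metric A B c br) x y = rdist x y"
  unfolding riem_dist_def path_length_def[symmetric]
proof (rule cInf_eq_minimum)
  show "rdist x y \<in> {L. \<exists>\<gamma>. valid_path \<gamma> \<and> pathstart \<gamma> = x \<and> pathfinish \<gamma> = y \<and> path_length \<gamma> L}"
    using geodesic_exists by simp
  fix L assume "L \<in> {L. \<exists>\<gamma>. valid_path \<gamma> \<and> pathstart \<gamma> = x \<and> pathfinish \<gamma> = y \<and> path_length \<gamma> L}"
  then obtain \<gamma> where "valid_path \<gamma>" "path_length \<gamma> L" "pathstart \<gamma> = x" "pathfinish \<gamma> = y" by blast
  with rdist_le_path_length[of \<gamma> L x] show "rdist x y \<le> L" by simp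
qed

lemma rho_sym: "rho x y = rho y x"
proof -
  have "X1 y x = - X1 x y" by (simp add: X1_def)
  then have "NN y x = NN x y" by (simp add: NN_def)
  moreover have "Y1 y x = - Y1 x y" using bb_skew[of y x] by (simp add: Y1_def)
  moreover have "- (y $ c) - x $ c = - (x $ c) - y $ c" by simp
  ultimately show ?thesis unfolding rho_def by (simp only: inner_minus_left inner_minus_right minus_minus)
qed

text \<open>The length bound with base point \<open>x\<close> is applied to a geodesic from
  \<open>y\<close> to \<open>z\<close>.\<close>

lemma rdist_triangle: "\<bar>rdist x y - rdist x z\<bar> \<le> rdist y z"
proof -
  have K: "rdist x z - rdist x y \<le> rdist y z" for x y z
  proof -
    obtain \<gamma> where "valid_path \<gamma>" "path_length \<gamma> (rdist y z)" "pathstart \<gamma> = y" "pathfinish \<gamma> = z"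
      using geodesic_exists by blast
    with rdist_le_path_length[of \<gamma> "rdist y z" x] show ?thesis by simp
  qed
  show ?thesis using K[of x z y] K[of x y z] rho_sym[of y z] by simp
qed

end

section \<open>Conclusion\<close>

lemma C_k_slices:
  fixes u :: "'a::euclidean_space \<times> real \<Rightarrow> 'b::real_normed_vector"
  assumes u: "\<And>j. C_k j u"
  shows "C_k j (\<lambda>y. u (y, s))"
    and "((\<lambda>s. u (y, s)) has_vector_derivative frechet_derivative u (at (y, s)) (0, 1)) (at s)"
    and "continuous_on UNIV (\<lambda>(y, s). u (y, s))"
proof -
  have "bounded_linear (\<lambda>y::'a. (y, 0::real))" by (intro bounded_linear_Pair bounded_linear_ident bounded_linear_zero)
  from C_k_affine[OF this u, of j "(0, s)"] show "C_k j (\<lambda>y. u (y, s))" by simp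
  have "((\<lambda>s. (y, s)) has_derivative (\<lambda>h. (0, h))) (at s)"
    by (intro has_derivative_Pair has_derivative_const has_derivative_ident)
  from has_derivative_compose[OF this C_k_has_derivative[OF u]]
  have d: "((\<lambda>s. u (y, s)) has_derivative (\<lambda>h. frechet_derivative u (at (y, s)) (0, h))) (at s)" .
  have l: "frechet_derivative u (at (y, s)) (0, h) = h *\<^sub>R frechet_derivative u (at (y, s)) (0, 1)" for h
    using linear_cmul[OF has_derivative_linear[OF C_k_has_derivative[OF u]], of "(y, s)" h "(0, 1)"] by simp
  have "(\<lambda>h. frechet_derivative u (at (y, s)) (0, h)) = (\<lambda>h. h *\<^sub>R frechet_derivative u (at (y, s)) (0, 1))"
    by (rule ext) (rule l)
  with d show "((\<lambda>s. u (y, s)) has_vector_derivative frechet_derivative u (at (y, s)) (0, 1)) (at s)"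
    unfolding has_vector_derivative_def by simp
  show "continuous_on UNIV (\<lambda>(y, s). u (y, s))" using C_k_continuous[OF u] by simp
qed

theorem corollary3p6:
  fixes m k :: nat and A B :: "'n::finite set" and c :: 'n
    and br :: "real ^ 'n \<Rightarrow> real ^ 'n \<Rightarrow> real ^ 'n"
    and g\<^sub>S :: "'n metric" and Q R :: real and x\<^sub>0 :: "real ^ 'n"
    and f g :: "real ^ 'n \<Rightarrow> complex" and u :: "(real ^ 'n) \<times> real \<Rightarrow> complex"
  assumes S: "damek_ricci m k A B c br"
    and metric: "g\<^sub>S = dr_metric A B c br"
    and odd_dim: "odd (m + k + 1)"
    and Q: "Q = real m / 2 + real k"
    and "R > 0"
    and "smooth f" "supp f \<subseteq> riem_cball g\<^sub>S x\<^sub>0 R"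
    and "smooth g" "supp g \<subseteq> riem_cball g\<^sub>S x\<^sub>0 R"
    and "smooth u"
    and wave: "\<And>x t. vector_derivative (\<lambda>s. vector_derivative (\<lambda>r. u (x, r)) (at s)) (at t)
        = laplace_beltrami g\<^sub>S (\<lambda>y. u (y, t)) x + (Q\<^sup>2 / 4) *\<^sub>R u (x, t)"
    and init: "\<And>x. u (x, 0) = f x"
    and init': "\<And>x. vector_derivative (\<lambda>t. u (x, t)) (at 0) = g x"
  shows "supp u \<subseteq> {(x, t). \<bar>t\<bar> - R \<le> riem_dist g\<^sub>S x x\<^sub>0 \<and> riem_dist g\<^sub>S x x\<^sub>0 \<le> \<bar>t\<bar> + R}"
proof -
  interpret damek_ricci_space m k A B c br by unfold_locales (rule S)
  \<comment> \<open>As m is even, odd dimension forces k to be even.\<close>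
  have mk: "even m" "even k" "k \<ge> 1" using S odd_dim unfolding damek_ricci_def by auto
  have u: "C_k j u" for j using \<open>smooth u\<close> by (simp add: smooth_def)
  define ut where "ut p = frechet_derivative u (at p) (0, 1)" for p
  have ut: "C_k j ut" for j unfolding ut_def[abs_def] by (rule C_k_frechet[OF u])
  define utt where "utt p = frechet_derivative ut (at p) (0, 1)" for p
  have utt: "C_k j utt" for j unfolding utt_def[abs_def] by (rule C_k_frechet[OF ut])
  have dt: "((\<lambda>s. u (y, s)) has_vector_derivative ut (y, s)) (at s)" for y s
    using C_k_slices(2)[OF u] by (simp add: ut_def)
  have dtt: "((\<lambda>s. ut (y, s)) has_vector_derivative utt (y, s)) (at s)" for y s
    using C_k_slices(2)[OF ut] by (simp add: utt_def)
  have vd: "vector_derivative (\<lambda>s. u (y, s)) (at s) = ut (y, s)" for y s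
    by (rule vector_derivative_at[OF dt])
  have wave': "utt (y, s) = laplace_beltrami gS (\<lambda>y. u (y, s)) y + (QQ\<^sup>2 / 4) *\<^sub>R u (y, s)" for y s
    using wave[of y s] unfolding vd vector_derivative_at[OF dtt] metric Q .
  \<comment> \<open>For every \<epsilon> > 0 some point of the support of the data has distance to
    \<open>x\<close> within \<epsilon> of |t|; the triangle inequality gives R + \<epsilon>, and
    \<epsilon> is arbitrary.\<close>
  have close: "\<bar>\<bar>t\<bar> - rdist x x\<^sub>0\<bar> \<le> R" if nz: "u (x, t) \<noteq> 0" for x t
  proof (rule field_le_epsilon)
    fix \<epsilon> :: real assume \<epsilon>: "\<epsilon> > 0"
    have "\<exists>y. \<bar>\<bar>t\<bar> - rdist x y\<bar> \<le> \<epsilon> \<and> (u (y, 0) \<noteq> 0 \<or> ut (y, 0) \<noteq> 0)"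
    proof (rule ccontr)
      assume "\<not> ?thesis"
      then have "u (x, t) = 0"
        by (intro wave_at_point_eq_0[OF mk \<epsilon>, where u = "\<lambda>y s. u (y, s)" and ut = "\<lambda>y s. ut (y, s)"
            and utt = "\<lambda>y s. utt (y, s)" and t = t and x = x]
            C_k_slices(1)[OF u] C_k_slices(3)[OF u] C_k_slices(3)[OF ut] C_k_slices(3)[OF utt] dt dtt wave') auto
      with nz show False by simp
    qed
    then obtain y where y: "\<bar>\<bar>t\<bar> - rdist x y\<bar> \<le> \<epsilon>" "u (y, 0) \<noteq> 0 \<or> ut (y, 0) \<noteq> 0" by blast
    have "f y \<noteq> 0 \<or> g y \<noteq> 0" using y(2) init[of y] init'[of y] unfolding vd by simp
    then have "y \<in> supp f \<union> supp g" 
      unfolding supp_def using closure_subset[of "{x. f x \<noteq> 0}"] closure_subset[of "{x. g x \<noteq> 0}"] by blast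
    then have "y \<in> riem_cball g\<^sub>S x\<^sub>0 R"
      using \<open>supp f \<subseteq> riem_cball g\<^sub>S x\<^sub>0 R\<close> \<open>supp g \<subseteq> riem_cball g\<^sub>S x\<^sub>0 R\<close> by blast
    then have "riem_dist g\<^sub>S y x\<^sub>0 \<le> R" by (simp add: riem_cball_def)
    then have "rdist y x\<^sub>0 \<le> R" unfolding metric riem_dist_eq .
    with rdist_triangle[of x y x\<^sub>0] y(1) show "\<bar>\<bar>t\<bar> - rdist x x\<^sub>0\<bar> \<le> R + \<epsilon>" by linarith
  qed
  have cont: "continuous_on UNIV (\<lambda>p::(real ^ 'n) \<times> real. rdist (fst p) x\<^sub>0)"
  proof (rule continuous_on_compose2[OF continuous_on_arcosh[OF order_refl]])
    have "continuous_on UNIV (\<lambda>p::(real ^ 'n) \<times> real. rho x\<^sub>0 (fst p))"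
      by (intro continuous_on_compose2[OF continuous_on_rho[of UNIV]] continuous_intros) auto
    then show "continuous_on UNIV (\<lambda>p::(real ^ 'n) \<times> real. 2 * rho (fst p) x\<^sub>0 - 1)"
      unfolding rho_sym[of _ x\<^sub>0] by (intro continuous_intros)
    show "(\<lambda>p::(real ^ 'n) \<times> real. 2 * rho (fst p) x\<^sub>0 - 1) ` UNIV \<subseteq> {1..}"
      using rho_ge_1[of _ x\<^sub>0] by auto
  qed
  \<comment> \<open>The support is a closure, so the pointwise estimate must define a closed
    set.\<close>
  have "closed {p. \<bar>\<bar>snd p\<bar> - rdist (fst p) x\<^sub>0\<bar> \<le> R}"
    by (intro closed_Collect_le continuous_intros cont)
  moreover have "{p. u p \<noteq> 0} \<subseteq> {p. \<bar>\<bar>snd p\<bar> - rdist (fst p) x\<^sub>0\<bar> \<le> R}"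
    using close by auto
  ultimately have "supp u \<subseteq> {p. \<bar>\<bar>snd p\<bar> - rdist (fst p) x\<^sub>0\<bar> \<le> R}"
    unfolding supp_def by (intro closure_minimal)
  then show ?thesis unfolding metric riem_dist_eq by (auto simp: abs_le_iff)
qed

end
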